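(* Let $k\ge2$ and $\alpha,\beta>0$, and consider the dihedral group $I_{2k}$ with multiplicity $\kappa=(\alpha,\beta)$. For $z=|z|e^{i\phi_1}$, $w=|w|e^{i\phi_2}$, $u,v\in[-1,1]$ put $q=q_{u,v}(k\phi_1,k\phi_2)$ and $$a_j^+=|zw|\cos\Big(\frac{q-2j\pi}{k}\Big),\qquad a_j^-=|zw|\cos\Big(\frac{\pi-q-2j\pi}{k}\Big),\qquad j=0,\dots,k-1.$$ Then $$\mathcal J_\kappa(z,w)=\frac{\Gamma(k(\alpha+\beta))}{2\Gamma(\alpha+\beta)^k}\int_{-1}^1\int_{-1}^1\int_{T^{k-1}}\Big(e^{\sum_{j=0}^{k-1}a_j^+t_j}+e^{\sum_{j=0}^{k-1}a_j^-t_j}\Big)\prod_{j=0}^{k-1}t_j^{\alpha+\beta-1}\,dt_1\cdots dt_{k-1}\,d\nu^\alpha(u)\,d\nu^\beta(v),$$ where $(t_1,\dots,t_{k-1})$ ranges over $T^{k-1}$ and $t_0=1-\sum_{j=1}^{k-1}t_j$.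
   Context: Identify $\mathbb{R}^2$ with $\mathbb{C}$, with inner product $\langle z,w\rangle=\mathrm{Re}(z\bar w)$, and write $z=|z|e^{i\phi_1}$, $w=|w|e^{i\phi_2}$. The dihedral group $I_{2k}$ (order $4k$) contains the reflections $z\mapsto\bar ze^{ij\pi/k}$, $j=0,\dots,2k-1$, which form two conjugacy classes ($j$ even, containing $z\mapsto\bar z$; and $j$ odd); the multiplicity $\kappa=(\alpha,\beta)$ takes the value $\alpha$ on the roots of the class with $j$ even and $\beta$ on the class with $j$ odd. Dunkl operators: $T_jf(x)=\partial_jf(x)+\sum_{\alpha\in R_+}\kappa(\alpha)\alpha_j\frac{f(x)-f(\sigma_\alpha x)}{\langle\alpha,x\rangle}$; the Dunkl kernel $E_\kappa(x,y)$ is the joint eigenfunction $T_j^{(x)}E_\kappa=y_jE_\kappa$, $E_\kappa(0,y)=1$; the generalized Bessel function is $\mathcal J_\kappa(x,y)=\frac1{|G|}\sum_{g\in G}E_\kappa(x,gy)$. Measures on $[-1,1]$: $d\nu^\alpha(u)=\frac{\Gamma(\alpha+1/2)}{\sqrt\pi\,\Gamma(\alpha)}(1-u^2)^{\alpha-1}du$. Notation: $\xi_{u,v}(\theta_1,\theta_2)=v\cos\theta_1\cos\theta_2+u\sin\theta_1\sin\theta_2$ and $q_{u,v}(\theta_1,\theta_2)=\arccos\xi_{u,v}(\theta_1,\theta_2)\in[0,\pi]$. $T^{n}=\{(t_1,\dots,t_n):t_j>0,\ \sum t_j<1\}$ is the open unit simplex in $\mathbb{R}^n$. *)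

theory Defs
  imports "HOL-Analysis.Analysis"
begin

text \<open>R^2 is identified with the type complex; the inner product on complex
  (real_inner instance) is x \<bullet> y = Re x * Re y + Im x * Im y = Re (x * cnj y).\<close>

definition dih_refl :: "nat \<Rightarrow> nat \<Rightarrow> complex \<Rightarrow> complex" where
  "dih_refl k j z = cnj z * cis (real j * pi / real k)"

definition dih_rot :: "nat \<Rightarrow> nat \<Rightarrow> complex \<Rightarrow> complex" where
  "dih_rot k j z = z * cis (real j * pi / real k)"

text \<open>A (unit) root of the reflection dih_refl k j: sigma_alpha x = x - 2 (alpha.x) alpha.\<close>
definition dih_root :: "nat \<Rightarrow> nat \<Rightarrow> complex" where
  "dih_root k j = \<i> * cis (real j * pi / (2 * real k))"

definition dih_mult :: "nat \<Rightarrow> real \<Rightarrow> real \<Rightarrow> nat \<Rightarrow> real" where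
  "dih_mult k a b j = (if even j then a else b)"

definition dunkl_op :: "nat \<Rightarrow> real \<Rightarrow> real \<Rightarrow> complex \<Rightarrow> (complex \<Rightarrow> real) \<Rightarrow> complex \<Rightarrow> real" where
  "dunkl_op k a b e f x = frechet_derivative f (at x) e
     + (\<Sum>j<2*k. dih_mult k a b j * (dih_root k j \<bullet> e)
          * (f x - f (dih_refl k j x)) / (dih_root k j \<bullet> x))"

text \<open>Points off all mirrors (where the difference quotients are literally defined).\<close>
definition dih_regular :: "nat \<Rightarrow> complex \<Rightarrow> bool" where
  "dih_regular k x \<longleftrightarrow> (\<forall>j<2*k. dih_root k j \<bullet> x \<noteq> 0)"

definition dunkl_kernel :: "nat \<Rightarrow> real \<Rightarrow> real \<Rightarrow> complex \<Rightarrow> complex \<Rightarrow> real" where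
  "dunkl_kernel k a b x y =
     (THE f. (\<forall>p. f differentiable (at p)) \<and> f 0 = 1 \<and>
        (\<forall>p. dih_regular k p \<longrightarrow>
           dunkl_op k a b 1 f p = Re y * f p \<and> dunkl_op k a b \<i> f p = Im y * f p)) x"

definition gen_bessel :: "nat \<Rightarrow> real \<Rightarrow> real \<Rightarrow> complex \<Rightarrow> complex \<Rightarrow> real" where
  "gen_bessel k a b x y =
     (\<Sum>j<2*k. dunkl_kernel k a b x (dih_rot k j y) + dunkl_kernel k a b x (dih_refl k j y))
       / (4 * real k)"

definition nu_density :: "real \<Rightarrow> real \<Rightarrow> real" where
  "nu_density a u = Gamma (a + 1/2) / (sqrt pi * Gamma a) * (1 - u\<^sup>2) powr (a - 1)"

definition xi_uv :: "real \<Rightarrow> real \<Rightarrow> real \<Rightarrow> real \<Rightarrow> real" where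
  "xi_uv u v t1 t2 = v * cos t1 * cos t2 + u * sin t1 * sin t2"

definition q_uv :: "real \<Rightarrow> real \<Rightarrow> real \<Rightarrow> real \<Rightarrow> real" where
  "q_uv u v t1 t2 = arccos (xi_uv u v t1 t2)"

text \<open>Open unit simplex T^n, coordinates indexed by {1..n} (extensional functions,
  i.e. points of the space of PiM {1..n} (\<lambda>_. lborel)).\<close>
definition unit_simplex :: "nat \<Rightarrow> (nat \<Rightarrow> real) set" where
  "unit_simplex n = {t \<in> {1..n} \<rightarrow>\<^sub>E UNIV. (\<forall>j\<in>{1..n}. 0 < t j) \<and> (\<Sum>j=1..n. t j) < 1}"

definition simplex_ext :: "nat \<Rightarrow> (nat \<Rightarrow> real) \<Rightarrow> nat \<Rightarrow> real" where
  "simplex_ext n t j = (if j = 0 then 1 - (\<Sum>i=1..n. t i) else t j)"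

end

theory Submission
  imports Defs "HOL-Complex_Analysis.Cauchy_Integral_Formula"
begin

text \<open>Write $A = \sum_j \kappa_j (1 - \sigma_j)$ and $\lambda = \alpha + \beta$. The radial part of the Dunkl
  system says $(n + A) E_n = \langle x, y\rangle E_{n-1}$ for the homogeneous components $E_n$ of the Dunkl kernel.
  As $A$ is positive on the functions on an orbit, this determines the kernel (an energy estimate along rays),
  and it also constructs it: the angular equations follow by induction, because every reflection anticommutes
  with the angular operator.

  Put $S(r) = \sum_n (k\lambda + 1)_n E_n r^n$. The radial equation for $S$ is a singular linear equation in $r$, whose
  solution is unique by the same energy estimate. After the substitution $r = 2\rho/(1 + \rho^2)$ a closed form, modelled
  on Dunkl's Poisson kernel for the map $z \mapsto z^k$, satisfies it; the reflections collapse by Poisson kernel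
  sums over roots of unity, and what remains is an integration by parts in $u$ and $v$. Averaging over the group
  leaves one integral of a power of $1 - 2\rho^k \xi_{u,v} + \rho^{2k}$. The same expression is obtained from the right-hand side
  by applying the Feynman (Dirichlet) integral to the simplex, so the Taylor coefficients agree.\<close>

section \<open>The dihedral group acting on functions\<close>

lemma sum_periodic_shift:
  fixes h :: "int \<Rightarrow> 'a::cancel_comm_monoid_add"
  assumes periodic: "\<And>i. h (i + int N) = h i"
  shows "(\<Sum>i<N. h (int i + m)) = (\<Sum>i<N. h (int i))"
proof -
  have shift_by_one: "(\<Sum>i<N. h (int i + (l + 1))) = (\<Sum>i<N. h (int i + l))" for l
  proof -
    have "(\<Sum>i<N. h (int i + (l + 1))) + h l = (\<Sum>i<Suc N. h (int i + l))"
      by (subst sum.lessThan_Suc_shift) (simp add: ac_simps)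
    also have "\<dots> = (\<Sum>i<N. h (int i + l)) + h l"
      using periodic[of l] by (simp add: ac_simps)
    finally show ?thesis by simp
  qed
  show ?thesis
  proof (induction m rule: int_induct[where k = 0])
    case base
    show ?case by simp
  next
    case (step1 i)
    then show ?case using shift_by_one[of i] by simp
  next
    case (step2 i)
    then show ?case using shift_by_one[of "i - 1"] by simp
  qed
qed

lemma sum_periodic_reflect:
  fixes h :: "int \<Rightarrow> 'a::cancel_comm_monoid_add"
  assumes periodic: "\<And>i. h (i + int N) = h i"
  shows "(\<Sum>i<N. h (m - int i)) = (\<Sum>i<N. h (int i))"
proof -
  have "(\<Sum>i<N. h (m - int i)) = (\<Sum>i<N. h (m - int (N - Suc i)))"
    by (subst sum.nat_diff_reindex) simp
  also have "\<dots> = (\<Sum>i<N. h (int i + (m + 1 - int N)))"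
    by (intro sum.cong) (auto simp: of_nat_diff algebra_simps)
  also have "\<dots> = (\<Sum>i<N. h (int i))"
    by (rule sum_periodic_shift) (rule periodic)
  finally show ?thesis .
qed

lemma sum_even_odd:
  fixes h :: "int \<Rightarrow> 'a::comm_monoid_add"
  shows "(\<Sum>j<2*m. h (int j)) = (\<Sum>i<m. h (2 * int i)) + (\<Sum>i<m. h (2 * int i + 1))"
  by (induction m) (simp_all add: ac_simps)

locale positive_weights =
  fixes a b :: real
  assumes a_pos: "0 < a" and b_pos: "0 < b"
begin

lemma weight_sum_pos: "0 < a + b"
  using a_pos b_pos by simp

end

locale dihedral = positive_weights +
  fixes k :: nat
  assumes k_pos [simp]: "0 < k"
begin

definition omega :: "int \<Rightarrow> complex" where
  "omega i = cis (real_of_int i * pi / real k)"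

definition rot :: "int \<Rightarrow> complex \<Rightarrow> complex" where
  "rot i x = x * omega i"

definition rfl :: "int \<Rightarrow> complex \<Rightarrow> complex" where
  "rfl i x = cnj x * omega i"

definition kappa :: "int \<Rightarrow> real" where
  "kappa i = (if even i then a else b)"

lemma k_neq_0 [simp]: "k \<noteq> 0"
  using k_pos by simp

lemma omega_add: "omega (i + j) = omega i * omega j"
  by (simp add: omega_def cis_mult ring_distribs add_divide_distrib)

lemma omega_0 [simp]: "omega 0 = 1"
  by (simp add: omega_def)

lemma cnj_omega: "cnj (omega i) = omega (- i)"
  by (simp add: omega_def cis_cnj)

lemma norm_omega [simp]: "cmod (omega i) = 1"
  by (simp add: omega_def)

lemma omega_mod: "omega (i mod (2 * int k)) = omega i"
proof -
  have "real_of_int (2 * int k * m) * pi / real k = 2 * pi * real_of_int m" for m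
    by simp
  then have "omega (2 * int k * m) = 1" for m
    unfolding omega_def by (metis Ints_of_int cis_multiple_2pi)
  then have "omega (i mod (2 * int k) + 2 * int k * (i div (2 * int k))) = omega (i mod (2 * int k))"
    by (simp only: omega_add mult_1_right)
  then show ?thesis by (simp only: mod_mult_div_eq)
qed

lemma omega_period [simp]: "omega (i + 2 * int k) = omega i"
  using omega_mod[of "i + 2 * int k"] omega_mod[of i] by simp

lemma omega_even: "omega (2 * int i) = cis (2 * pi * real i / real k)"
  by (simp add: omega_def mult_ac)

lemma omega_power: "omega i ^ k = (if even i then 1 else - 1)"
proof -
  have "omega i ^ k = cis (pi * real_of_int i)"
    unfolding omega_def Complex.DeMoivre by (simp add: mult.commute)
  also have "\<dots> = (if even i then 1 else - 1)"
    by (simp add: complex_eq_iff)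
  finally show ?thesis .
qed

lemma norm_rot [simp]: "cmod (rot i x) = cmod x"
  by (simp add: rot_def norm_mult)

lemma norm_rfl [simp]: "cmod (rfl i x) = cmod x"
  by (simp add: rfl_def norm_mult)

lemma rot_0 [simp]: "rot 0 x = x"
  by (simp add: rot_def)

lemma rot_rot: "rot j (rot i x) = rot (j + i) x"
  by (simp add: rot_def omega_add mult_ac)

lemma rot_rfl: "rot j (rfl i x) = rfl (j + i) x"
  by (simp add: rot_def rfl_def omega_add mult_ac)

lemma rfl_rot: "rfl j (rot i x) = rfl (j - i) x"
  by (simp add: rfl_def rot_def cnj_omega omega_add[of j "- i", simplified] mult_ac)

lemma rfl_rfl: "rfl j (rfl i x) = rot (j - i) x"
  by (simp add: rfl_def rot_def cnj_omega omega_add[of j "- i", simplified] mult_ac)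

lemma rot_period [simp]: "rot (i + 2 * int k) x = rot i x"
  by (simp add: rot_def)

lemma rfl_period [simp]: "rfl (i + 2 * int k) x = rfl i x"
  by (simp add: rfl_def)

lemma rot_scaleR: "rot i (t *\<^sub>R x) = t *\<^sub>R rot i x"
  by (simp add: rot_def)

lemma rfl_scaleR: "rfl i (t *\<^sub>R x) = t *\<^sub>R rfl i x"
  by (simp add: rfl_def)

lemma rot_power: "rot j x ^ k = (if even j then x ^ k else - (x ^ k))"
  by (simp add: rot_def power_mult_distrib omega_power)

lemma rfl_power: "rfl j x ^ k = (if even j then cnj (x ^ k) else - cnj (x ^ k))"
  by (simp add: rfl_def power_mult_distrib omega_power)

lemma kappa_period [simp]: "kappa (i + 2 * int k) = kappa i"
  by (simp add: kappa_def)

lemma kappa_nonneg: "0 \<le> kappa i"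
  using a_pos b_pos by (simp add: kappa_def)

lemma dih_refl_eq_rfl: "dih_refl k j = rfl (int j)"
  by (simp add: fun_eq_iff dih_refl_def rfl_def omega_def)

lemma dih_rot_eq_rot: "dih_rot k j = rot (int j)"
  by (simp add: fun_eq_iff dih_rot_def rot_def omega_def)

lemma dih_mult_eq_kappa: "dih_mult k a b j = kappa (int j)"
  by (simp add: dih_mult_def kappa_def)

lemma sum_kappa_mult:
  "(\<Sum>j<2*k. kappa (int j) * h (int j)) = a * (\<Sum>i<k. h (2 * int i)) + b * (\<Sum>i<k. h (2 * int i + 1))"
  using sum_even_odd[of "\<lambda>j. kappa j * h j" k] by (simp add: kappa_def sum_distrib_left)

lemma sum_kappa: "(\<Sum>j<2*k. kappa (int j)) = real k * (a + b)"
  using sum_kappa_mult[of "\<lambda>_. 1"] by (simp add: algebra_simps)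

definition orbit :: "complex \<Rightarrow> complex set" where
  "orbit x = range (\<lambda>i. rot i x) \<union> range (\<lambda>i. rfl i x)"

lemma rot_in_orbit: "rot i x \<in> orbit x" and rfl_in_orbit: "rfl i x \<in> orbit x"
  by (simp_all add: orbit_def)

lemma norm_orbit: "p \<in> orbit x \<Longrightarrow> cmod p = cmod x"
  by (auto simp: orbit_def)

definition orbit_sum :: "(complex \<Rightarrow> real) \<Rightarrow> complex \<Rightarrow> real" where
  "orbit_sum f x = (\<Sum>i<2*k. f (rot (int i) x) + f (rfl (int i) x))"

lemma orbit_sum_rfl: "orbit_sum (\<lambda>p. f (rfl j p)) x = orbit_sum f x"
proof -
  have "(\<Sum>i<2*k. f (rfl (j - int i) x)) = (\<Sum>i<2*k. f (rfl (int i) x))"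
    by (rule sum_periodic_reflect[where h = "\<lambda>i. f (rfl i x)"]) simp
  moreover have "(\<Sum>i<2*k. f (rot (j - int i) x)) = (\<Sum>i<2*k. f (rot (int i) x))"
    by (rule sum_periodic_reflect[where h = "\<lambda>i. f (rot i x)"]) simp
  ultimately show ?thesis
    by (simp add: orbit_sum_def rfl_rot rfl_rfl sum.distrib)
qed

lemma orbit_sum_add: "orbit_sum (\<lambda>p. f p + g p) x = orbit_sum f x + orbit_sum g x"
  by (simp add: orbit_sum_def sum.distrib)

lemma orbit_sum_cmult: "orbit_sum (\<lambda>p. r * f p) x = r * orbit_sum f x"
  by (simp add: orbit_sum_def sum_distrib_left ring_distribs)

lemma orbit_sum_sum: "orbit_sum (\<lambda>p. \<Sum>j\<in>J. f j p) x = (\<Sum>j\<in>J. orbit_sum (f j) x)"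
  unfolding orbit_sum_def by (subst sum.swap) (simp add: sum.distrib)

lemma orbit_sum_cong: "(\<And>p. p \<in> orbit x \<Longrightarrow> f p = g p) \<Longrightarrow> orbit_sum f x = orbit_sum g x"
  unfolding orbit_sum_def by (simp add: rot_in_orbit rfl_in_orbit)

lemma orbit_sum_mono: "(\<And>p. p \<in> orbit x \<Longrightarrow> f p \<le> g p) \<Longrightarrow> orbit_sum f x \<le> orbit_sum g x"
  unfolding orbit_sum_def by (intro sum_mono add_mono) (auto simp: rot_in_orbit rfl_in_orbit)

lemma orbit_sum_nonneg: "(\<And>p. p \<in> orbit x \<Longrightarrow> 0 \<le> f p) \<Longrightarrow> 0 \<le> orbit_sum f x"
  unfolding orbit_sum_def by (intro sum_nonneg add_nonneg_nonneg) (auto simp: rot_in_orbit rfl_in_orbit)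

lemma orbit_sum_sq_nonpos_imp_eq_0:
  assumes "orbit_sum (\<lambda>p. (f p)\<^sup>2) x \<le> 0"
  shows "f x = 0"
proof -
  have "(f (rot (int 0) x))\<^sup>2 + (f (rfl (int 0) x))\<^sup>2 \<le> orbit_sum (\<lambda>p. (f p)\<^sup>2) x"
    unfolding orbit_sum_def by (rule member_le_sum[of 0]) auto
  with assms have "(f x)\<^sup>2 + (f (rfl 0 x))\<^sup>2 \<le> 0" by simp
  then show ?thesis by (simp add: sum_power2_le_zero_iff)
qed

definition refl_diff :: "(complex \<Rightarrow> real) \<Rightarrow> complex \<Rightarrow> real" where
  "refl_diff f x = (\<Sum>j<2*k. kappa (int j) * (f x - f (rfl (int j) x)))"

definition refl_sum :: "(complex \<Rightarrow> real) \<Rightarrow> complex \<Rightarrow> real" where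
  "refl_sum f x = (\<Sum>j<2*k. kappa (int j) * (f x + f (rfl (int j) x)))"

lemma refl_diff_eq: "refl_diff f x = real k * (a + b) * f x - (\<Sum>j<2*k. kappa (int j) * f (rfl (int j) x))"
  by (simp add: refl_diff_def right_diff_distrib sum_subtractf sum_distrib_right[symmetric] sum_kappa)

lemma refl_sum_eq: "refl_sum f x = real k * (a + b) * f x + (\<Sum>j<2*k. kappa (int j) * f (rfl (int j) x))"
  by (simp add: refl_sum_def distrib_left sum.distrib sum_distrib_right[symmetric] sum_kappa)

lemma refl_diff_add: "refl_diff (\<lambda>x. f x + g x) x = refl_diff f x + refl_diff g x"
  by (simp add: refl_diff_def sum.distrib[symmetric] algebra_simps)

lemma refl_diff_diff: "refl_diff (\<lambda>x. f x - g x) x = refl_diff f x - refl_diff g x"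
  by (simp add: refl_diff_def sum_subtractf[symmetric] algebra_simps)

lemma refl_diff_cmult: "refl_diff (\<lambda>x. r * f x) x = r * refl_diff f x"
  by (simp add: refl_diff_def sum_distrib_left algebra_simps)

lemma refl_diff_sum: "refl_diff (\<lambda>x. \<Sum>i\<in>I. f i x) x = (\<Sum>i\<in>I. refl_diff (f i) x)"
  unfolding refl_diff_def by (subst sum.swap) (simp add: sum_subtractf[symmetric] sum_distrib_left)

text \<open>Since the reflection preserves orbit sums, both quantities below are half the orbit sum of the square
  of $f \pm f \circ \sigma_j$.\<close>

lemma orbit_sum_mult_add_rfl_nonneg:
  assumes "e\<^sup>2 = 1"
  shows "0 \<le> orbit_sum (\<lambda>p. f p * (f p + e * f (rfl j p))) x"
proof -
  have "0 \<le> orbit_sum (\<lambda>p. (f p + e * f (rfl j p))\<^sup>2) x"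
    by (rule orbit_sum_nonneg) simp
  also have "orbit_sum (\<lambda>p. (f p + e * f (rfl j p))\<^sup>2) x
      = orbit_sum (\<lambda>p. (2 * (f p * (f p + e * f (rfl j p))) + (f (rfl j p))\<^sup>2) + (-1) * (f p)\<^sup>2) x"
    using assms by (intro orbit_sum_cong) (simp add: power2_eq_square algebra_simps)
  also have "\<dots> = 2 * orbit_sum (\<lambda>p. f p * (f p + e * f (rfl j p))) x"
    unfolding orbit_sum_add orbit_sum_cmult orbit_sum_rfl[of "\<lambda>p. (f p)\<^sup>2"] by simp
  finally show ?thesis by simp
qed

lemma orbit_sum_mult_refl_diff_nonneg: "0 \<le> orbit_sum (\<lambda>p. f p * refl_diff f p) x"
proof -
  have "orbit_sum (\<lambda>p. f p * refl_diff f p) x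
      = (\<Sum>j<2*k. kappa (int j) * orbit_sum (\<lambda>p. f p * (f p + (-1) * f (rfl (int j) p))) x)"
    unfolding orbit_sum_cmult[symmetric] orbit_sum_sum[symmetric] refl_diff_def
    by (simp add: sum_distrib_left mult_ac)
  then show ?thesis
    by (simp only:) (intro sum_nonneg mult_nonneg_nonneg kappa_nonneg orbit_sum_mult_add_rfl_nonneg, simp)
qed

lemma orbit_sum_mult_refl_sum_nonneg: "0 \<le> orbit_sum (\<lambda>p. f p * refl_sum f p) x"
proof -
  have "orbit_sum (\<lambda>p. f p * refl_sum f p) x
      = (\<Sum>j<2*k. kappa (int j) * orbit_sum (\<lambda>p. f p * (f p + 1 * f (rfl (int j) p))) x)"
    unfolding orbit_sum_cmult[symmetric] orbit_sum_sum[symmetric] refl_sum_def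
    by (simp add: sum_distrib_left mult_ac)
  then show ?thesis
    by (simp only:) (intro sum_nonneg mult_nonneg_nonneg kappa_nonneg orbit_sum_mult_add_rfl_nonneg, simp)
qed

lemma refl_sum_shift_injective:
  assumes "0 < c" and eq_0: "\<And>p. p \<in> orbit x \<Longrightarrow> c * f p + refl_sum f p = 0"
  shows "f x = 0"
proof -
  have "c * orbit_sum (\<lambda>p. (f p)\<^sup>2) x + orbit_sum (\<lambda>p. f p * refl_sum f p) x
      = orbit_sum (\<lambda>p. f p * (c * f p + refl_sum f p)) x"
    unfolding orbit_sum_cmult[symmetric] orbit_sum_add[symmetric]
    by (simp add: power2_eq_square algebra_simps)
  also have "\<dots> = orbit_sum (\<lambda>_. 0) x"
    by (rule orbit_sum_cong) (simp add: eq_0)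
  also have "\<dots> = 0" by (simp add: orbit_sum_def)
  finally have "c * orbit_sum (\<lambda>p. (f p)\<^sup>2) x \<le> 0"
    using orbit_sum_mult_refl_sum_nonneg[of f x] by linarith
  then have "orbit_sum (\<lambda>p. (f p)\<^sup>2) x \<le> 0"
    using \<open>0 < c\<close> by (simp add: mult_le_0_iff)
  then show ?thesis by (rule orbit_sum_sq_nonpos_imp_eq_0)
qed

end

section \<open>An energy estimate on orbits\<close>

lemma gronwall_eq_0:
  fixes V V' :: "real \<Rightarrow> real"
  assumes cont: "continuous_on {0..d} V" and init: "V 0 = 0"
    and nonneg: "\<And>t. 0 \<le> t \<Longrightarrow> t \<le> d \<Longrightarrow> 0 \<le> V t"
    and deriv: "\<And>t. 0 < t \<Longrightarrow> t < d \<Longrightarrow> (V has_real_derivative V' t) (at t)"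
    and bound: "\<And>t. 0 < t \<Longrightarrow> t < d \<Longrightarrow> V' t \<le> C * V t"
    and t_range: "0 \<le> t" "t \<le> d"
  shows "V t = 0"
proof -
  define W where "W s = V s * exp (- C * s)" for s
  have "W t \<le> W 0"
  proof (rule DERIV_nonpos_imp_decreasing_open[OF \<open>0 \<le> t\<close>])
    show "\<exists>y. (W has_real_derivative y) (at s) \<and> y \<le> 0" if "0 < s" "s < t" for s
    proof (intro exI conjI)
      show "(W has_real_derivative (V' s - C * V s) * exp (- C * s)) (at s)"
        unfolding W_def using that t_range
        by (auto intro!: derivative_eq_intros deriv simp: algebra_simps)
      show "(V' s - C * V s) * exp (- C * s) \<le> 0"
        using bound[of s] that t_range by (intro mult_nonpos_nonneg) auto
    qed
    show "continuous_on {0..t} W"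
      unfolding W_def using t_range
      by (intro continuous_intros continuous_on_subset[OF cont]) auto
  qed
  then have "V t \<le> 0" by (simp add: W_def init mult_le_0_iff)
  with nonneg t_range show ?thesis by (simp add: antisym)
qed

context dihedral
begin

text \<open>The Gronwall argument is applied to the orbit sum of $w F^2$: the coefficient \<^term>\<open>e t\<close> may blow up
  at $t = 0$, but the term it multiplies has a favourable sign.\<close>

lemma orbit_ode_solution_eq_0:
  fixes F F' w w' m :: "real \<Rightarrow> complex \<Rightarrow> real" and e :: "real \<Rightarrow> real"
  assumes cont: "\<And>p. p \<in> orbit x \<Longrightarrow> continuous_on {0..d} (\<lambda>t. w t p * (F t p)\<^sup>2)"
    and init: "\<And>p. p \<in> orbit x \<Longrightarrow> F 0 p = 0"
    and w_lower: "\<And>t p. 0 \<le> t \<Longrightarrow> t \<le> d \<Longrightarrow> p \<in> orbit x \<Longrightarrow> c \<le> w t p" and "0 < c"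
    and w_deriv: "\<And>t p. 0 < t \<Longrightarrow> t < d \<Longrightarrow> p \<in> orbit x \<Longrightarrow> ((\<lambda>t. w t p) has_real_derivative w' t p) (at t)"
    and F_deriv: "\<And>t p. 0 < t \<Longrightarrow> t < d \<Longrightarrow> p \<in> orbit x \<Longrightarrow> ((\<lambda>t. F t p) has_real_derivative F' t p) (at t)"
    and ode: "\<And>t p. 0 < t \<Longrightarrow> t < d \<Longrightarrow> p \<in> orbit x \<Longrightarrow> w t p * F' t p = m t p * F t p - e t * refl_diff (F t) p"
    and e_nonneg: "\<And>t. 0 < t \<Longrightarrow> t < d \<Longrightarrow> 0 \<le> e t"
    and growth: "\<And>t p. 0 < t \<Longrightarrow> t < d \<Longrightarrow> p \<in> orbit x \<Longrightarrow> w' t p + 2 * m t p \<le> B" and "0 \<le> B"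
    and t_range: "0 \<le> t" "t \<le> d"
  shows "F t x = 0"
proof -
  define V where "V t = orbit_sum (\<lambda>p. w t p * (F t p)\<^sup>2) x" for t
  define V' where "V' t = orbit_sum (\<lambda>p. w' t p * (F t p)\<^sup>2 + 2 * (F t p * (w t p * F' t p))) x" for t
  have V_lower: "c * orbit_sum (\<lambda>p. (F t p)\<^sup>2) x \<le> V t" if "0 \<le> t" "t \<le> d" for t
    unfolding V_def orbit_sum_cmult[symmetric] using w_lower[OF that]
    by (intro orbit_sum_mono mult_right_mono) auto
  have "V t = 0"
  proof (rule gronwall_eq_0[where V = V and V' = V' and C = "B / c", OF _ _ _ _ _ t_range])
    show "continuous_on {0..d} V"
      unfolding V_def orbit_sum_def by (intro continuous_intros cont rot_in_orbit rfl_in_orbit)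
    show "V 0 = 0" by (simp add: V_def orbit_sum_def init rot_in_orbit rfl_in_orbit)
    show "0 \<le> V t" if "0 \<le> t" "t \<le> d" for t
      using V_lower[OF that] orbit_sum_nonneg[of x "\<lambda>p. (F t p)\<^sup>2"] \<open>0 < c\<close>
      by (meson mult_nonneg_nonneg less_imp_le order.trans zero_le_power2)
    fix t assume t_range: "0 < t" "t < d"
    have energy_deriv:
      "((\<lambda>t. w t p * (F t p)\<^sup>2) has_real_derivative w' t p * (F t p)\<^sup>2 + 2 * (F t p * (w t p * F' t p))) (at t)"
      if "p \<in> orbit x" for p
      using w_deriv[OF t_range that] F_deriv[OF t_range that] by (auto intro!: derivative_eq_intros)
    show "(V has_real_derivative V' t) (at t)"
      unfolding V_def V'_def orbit_sum_def
      by (intro DERIV_sum DERIV_add energy_deriv rot_in_orbit rfl_in_orbit)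
    have "V' t = orbit_sum (\<lambda>p. (w' t p + 2 * m t p) * (F t p)\<^sup>2 + (- 2 * e t) * (F t p * refl_diff (F t) p)) x"
      unfolding V'_def
      by (rule orbit_sum_cong, subst ode[OF t_range]) (simp_all add: power2_eq_square algebra_simps)
    also have "\<dots> \<le> orbit_sum (\<lambda>p. (w' t p + 2 * m t p) * (F t p)\<^sup>2) x"
      unfolding orbit_sum_add orbit_sum_cmult
      using e_nonneg[OF t_range] orbit_sum_mult_refl_diff_nonneg[of "F t" x] by simp
    also have "\<dots> \<le> B * orbit_sum (\<lambda>p. (F t p)\<^sup>2) x"
      unfolding orbit_sum_cmult[symmetric] by (intro orbit_sum_mono mult_right_mono growth[OF t_range]) auto
    also have "\<dots> = B / c * (c * orbit_sum (\<lambda>p. (F t p)\<^sup>2) x)"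
      using \<open>0 < c\<close> by simp
    also have "\<dots> \<le> B / c * V t"
      using V_lower[of t] t_range \<open>0 < c\<close> \<open>0 \<le> B\<close> by (intro mult_left_mono) auto
    finally show "V' t \<le> B / c * V t" .
  qed
  with V_lower[OF t_range] have "c * orbit_sum (\<lambda>p. (F t p)\<^sup>2) x \<le> 0" by simp
  with \<open>0 < c\<close> have "orbit_sum (\<lambda>p. (F t p)\<^sup>2) x \<le> 0" by (simp add: mult_le_0_iff)
  then show ?thesis by (rule orbit_sum_sq_nonpos_imp_eq_0)
qed

end

section \<open>Uniqueness of the Dunkl kernel\<close>

lemma inner_eq_Re_mult_cnj: "(x :: complex) \<bullet> y = Re (x * cnj y)"
  by (simp add: inner_complex_def)

lemma linear_complex_eqI:
  fixes f g :: "complex \<Rightarrow> 'a::real_vector"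
  assumes "linear f" "linear g" "x \<noteq> 0" "f x = g x" "f (\<i> * x) = g (\<i> * x)"
  shows "f e = g e"
proof -
  have "e = (e / x) * x"
    using \<open>x \<noteq> 0\<close> by simp
  also have "\<dots> = Re (e / x) *\<^sub>R x + Im (e / x) *\<^sub>R (\<i> * x)"
    by (subst (1) complex_eq[of "e / x"]) (simp add: scaleR_conv_of_real algebra_simps)
  finally obtain s t where e_eq: "e = s *\<^sub>R x + t *\<^sub>R (\<i> * x)" ..
  show ?thesis
    unfolding e_eq
    by (simp only: linear_add[OF \<open>linear f\<close>] linear_scale[OF \<open>linear f\<close>]
        linear_add[OF \<open>linear g\<close>] linear_scale[OF \<open>linear g\<close>] assms)
qed

context dihedral
begin

definition mirror_normal :: "int \<Rightarrow> complex" where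
  "mirror_normal i = \<i> * cis (real_of_int i * pi / (2 * real k))"

lemma dih_root_eq_mirror_normal: "dih_root k j = mirror_normal (int j)"
  by (simp add: dih_root_def mirror_normal_def)

lemma norm_mirror_normal [simp]: "cmod (mirror_normal i) = 1"
  by (simp add: mirror_normal_def norm_mult)

lemma mirror_normal_neq_0: "mirror_normal i \<noteq> 0"
  using norm_mirror_normal[of i] by force

lemma mirror_normal_power2: "(mirror_normal i)\<^sup>2 = - omega i"
  by (simp add: mirror_normal_def omega_def power_mult_distrib Complex.DeMoivre)

lemma mirror_normal_add: "mirror_normal (i + 2 * j) = mirror_normal i * omega j"
  by (simp add: mirror_normal_def omega_def cis_mult add_divide_distrib ring_distribs)

lemma mirror_normal_period: "mirror_normal (i + 2 * int k) = - mirror_normal i"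
  by (simp add: mirror_normal_add omega_def)

lemma cnj_mirror_normal: "cnj (mirror_normal i) = - mirror_normal (- i)"
  by (simp add: mirror_normal_def cis_cnj)

lemma rfl_eq_reflection: "rfl j x = x - (2 * (mirror_normal j \<bullet> x)) *\<^sub>R mirror_normal j"
proof -
  let ?n = "mirror_normal j"
  have "complex_of_real (2 * (?n \<bullet> x)) = ?n * cnj x + cnj (?n * cnj x)"
    unfolding inner_eq_Re_mult_cnj by (rule complex_add_cnj[symmetric])
  then have "(2 * (?n \<bullet> x)) *\<^sub>R ?n = ?n\<^sup>2 * cnj x + (?n * cnj ?n) * x"
    by (simp add: scaleR_conv_of_real power2_eq_square algebra_simps)
  also have "?n * cnj ?n = 1"
    by (simp add: complex_norm_square[symmetric])
  finally show ?thesis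
    by (simp add: rfl_def mirror_normal_power2)
qed

lemma mirror_normal_inner_rfl: "mirror_normal i \<bullet> rfl j x = - (mirror_normal (2 * j - i) \<bullet> x)"
proof -
  have "mirror_normal i \<bullet> rfl j x = Re (mirror_normal i * omega (- j) * x)"
    by (simp add: inner_eq_Re_mult_cnj rfl_def cnj_omega mult_ac)
  also have "mirror_normal i * omega (- j) = - cnj (mirror_normal (2 * j - i))"
    using mirror_normal_add[of i "- j"] by (simp add: cnj_mirror_normal)
  also have "Re (- cnj (mirror_normal (2 * j - i)) * x) = - (mirror_normal (2 * j - i) \<bullet> x)"
    by (simp add: inner_complex_def)
  finally show ?thesis .
qed

lemma mirror_normal_inner_eq_0_iff: "mirror_normal i \<bullet> x = 0 \<longleftrightarrow> rfl i x = x"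
  by (simp add: rfl_eq_reflection mirror_normal_neq_0)

lemma dih_regular_iff: "dih_regular k x \<longleftrightarrow> (\<forall>i. rfl i x \<noteq> x)"
proof
  assume regular: "dih_regular k x"
  show "\<forall>i. rfl i x \<noteq> x"
  proof
    fix i
    define j where "j = nat (i mod (2 * int k))"
    have j_mod: "j < 2 * k" "int j = i mod (2 * int k)"
      unfolding j_def by (auto simp: nat_less_iff)
    then have "rfl (int j) x = rfl i x"
      by (simp add: rfl_def omega_mod)
    with j_mod regular show "rfl i x \<noteq> x"
      by (auto simp: dih_regular_def dih_root_eq_mirror_normal mirror_normal_inner_eq_0_iff)
  qed
qed (simp add: dih_regular_def dih_root_eq_mirror_normal mirror_normal_inner_eq_0_iff)

lemma dih_regular_scaleR: "dih_regular k x \<Longrightarrow> t \<noteq> 0 \<Longrightarrow> dih_regular k (t *\<^sub>R x)"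
  by (simp add: dih_regular_def)

lemma dih_regular_rfl:
  assumes "dih_regular k x"
  shows "dih_regular k (rfl j x)"
  unfolding dih_regular_iff
proof (intro allI notI)
  fix i assume "rfl i (rfl j x) = rfl j x"
  then have "rfl j (rot (i - j) x) = rot 0 x" by (simp only: rfl_rfl diff_self)
  then have "rfl (2 * j - i) x = x" by (simp add: rfl_rot)
  with assms show False by (simp add: dih_regular_iff)
qed

lemma dih_regular_orbit:
  assumes "dih_regular k x" "p \<in> orbit x"
  shows "dih_regular k p"
proof -
  have "dih_regular k (rot i x)" for i
    using dih_regular_rfl[OF dih_regular_rfl[OF assms(1)], of i 0] by (simp add: rfl_rfl)
  with assms show ?thesis by (auto simp: orbit_def dih_regular_rfl)
qed

lemma closure_dih_regular: "closure {p. dih_regular k p} = UNIV"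
proof -
  define mirrors where "mirrors = (\<Union>j<2*k. {p. mirror_normal (int j) \<bullet> p = 0})"
  have "negligible mirrors"
    unfolding mirrors_def
    by (intro negligible_Union) (auto simp: mirror_normal_neq_0 intro!: negligible_hyperplane)
  moreover have "- closure {p. dih_regular k p} \<subseteq> mirrors"
    using closure_subset[of "{p. dih_regular k p}"]
    by (auto simp: mirrors_def dih_regular_def dih_root_eq_mirror_normal)
  ultimately have "negligible (- closure {p. dih_regular k p})"
    by (rule negligible_subset)
  then have "- closure {p. dih_regular k p} = {}"
    using open_not_negligible[of "- closure {p. dih_regular k p}"] by auto
  then show ?thesis by blast
qed

lemma dunkl_op_eq:
  "dunkl_op k a b e f x = frechet_derivative f (at x) e
     + (\<Sum>j<2*k. kappa (int j) * (mirror_normal (int j) \<bullet> e)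
          * (f x - f (rfl (int j) x)) / (mirror_normal (int j) \<bullet> x))"
  by (simp add: dunkl_op_def dih_mult_eq_kappa dih_refl_eq_rfl dih_root_eq_mirror_normal)

lemma linear_dunkl_op:
  assumes "f differentiable (at x)"
  shows "linear (\<lambda>e. dunkl_op k a b e f x)"
proof -
  have linear_D: "linear (frechet_derivative f (at x))"
    using assms by (rule linear_frechet_derivative)
  show ?thesis
    unfolding dunkl_op_eq
    by (intro linearI)
      (simp_all add: linear_add[OF linear_D] linear_scale[OF linear_D] inner_add_right sum.distrib[symmetric] sum_distrib_left
        ring_distribs add_divide_distrib mult_ac)
qed

lemma dunkl_op_radial:
  assumes "dih_regular k x"
  shows "dunkl_op k a b x f x = frechet_derivative f (at x) x + refl_diff f x"
  using assms unfolding dunkl_op_eq refl_diff_def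
  by (auto simp: dih_regular_def dih_root_eq_mirror_normal intro!: sum.cong)

lemma dunkl_op_add:
  assumes "f differentiable (at x)" "g differentiable (at x)"
  shows "dunkl_op k a b e (\<lambda>x. f x + g x) x = dunkl_op k a b e f x + dunkl_op k a b e g x"
proof -
  have "((\<lambda>x. f x + g x) has_derivative
      (\<lambda>h. frechet_derivative f (at x) h + frechet_derivative g (at x) h)) (at x)"
    using assms by (intro has_derivative_add) (simp_all add: frechet_derivative_works)
  note derivative_add = frechet_derivative_at[OF this, symmetric]
  have "c * (f x + g x - (f p + g p)) / r = c * (f x - f p) / r + c * (g x - g p) / r" for c r p
    by (simp add: add_divide_distrib[symmetric] ring_distribs)
  then show ?thesis
    unfolding dunkl_op_eq derivative_add by (simp add: sum.distrib)
qed

lemma dunkl_op_cmult: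
  assumes "f differentiable (at x)"
  shows "dunkl_op k a b e (\<lambda>x. r * f x) x = r * dunkl_op k a b e f x"
proof -
  have "((\<lambda>x. r * f x) has_derivative (\<lambda>h. r * frechet_derivative f (at x) h)) (at x)"
    using assms by (intro has_derivative_mult_right) (simp add: frechet_derivative_works)
  note derivative_cmult = frechet_derivative_at[OF this, symmetric]
  show ?thesis
    unfolding dunkl_op_eq derivative_cmult right_diff_distrib[of r, symmetric]
    by (simp add: sum_distrib_left distrib_left mult_ac)
qed

definition dunkl_eigen :: "complex \<Rightarrow> (complex \<Rightarrow> real) \<Rightarrow> bool" where
  "dunkl_eigen y f \<longleftrightarrow> (\<forall>p. f differentiable (at p)) \<and>
     (\<forall>p. dih_regular k p \<longrightarrow> (\<forall>e. dunkl_op k a b e f p = (e \<bullet> y) * f p))"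

lemma dunkl_kernel_eq_The: "dunkl_kernel k a b x y = (THE f. dunkl_eigen y f \<and> f 0 = 1) x"
proof -
  have eigen_iff_basis: "(\<forall>e. dunkl_op k a b e f p = (e \<bullet> y) * f p) \<longleftrightarrow>
      dunkl_op k a b 1 f p = Re y * f p \<and> dunkl_op k a b \<i> f p = Im y * f p"
    if "f differentiable (at p)" for f p
  proof (intro iffI allI)
    fix e assume basis: "dunkl_op k a b 1 f p = Re y * f p \<and> dunkl_op k a b \<i> f p = Im y * f p"
    have "linear (\<lambda>e. (e \<bullet> y) * f p)"
      by (intro linearI) (simp_all add: inner_add_left distrib_right)
    from linear_complex_eqI[OF linear_dunkl_op[OF that] this, where x = 1 and e = e]
    show "dunkl_op k a b e f p = (e \<bullet> y) * f p"
      using basis by (simp add: inner_complex_def)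
  qed (auto simp: inner_complex_def)
  show ?thesis
    unfolding dunkl_kernel_def dunkl_eigen_def
    by (intro arg_cong[where f = "\<lambda>P. The P x"] ext) (metis eigen_iff_basis)
qed

lemma continuous_on_dunkl_eigen:
  assumes "dunkl_eigen y f"
  shows "continuous_on UNIV f"
proof -
  have "f differentiable (at p)" for p
    using assms by (simp add: dunkl_eigen_def)
  then have "isCont f p" for p by (rule differentiable_imp_continuous_within)
  then show ?thesis by (simp add: continuous_on_eq_continuous_at)
qed

lemma dunkl_eigen_regular_eq_0:
  assumes f_eigen: "dunkl_eigen y f" and "f 0 = 0" and x_regular: "dih_regular k x"
  shows "f x = 0"
proof -
  let ?D = "\<lambda>p. frechet_derivative f (at p)"
  have diff: "f differentiable (at p)" for p
    using f_eigen by (simp add: dunkl_eigen_def)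
  have linear_D: "linear (?D p)" for p
    by (rule linear_frechet_derivative[OF diff])
  have "f (1 *\<^sub>R x) = 0"
  proof (rule orbit_ode_solution_eq_0[where F = "\<lambda>t p. f (t *\<^sub>R p)" and F' = "\<lambda>t p. ?D (t *\<^sub>R p) p"
        and w = "\<lambda>_ _. 1" and w' = "\<lambda>_ _. 0" and c = 1 and d = 1 and m = "\<lambda>t p. p \<bullet> y" and e = "\<lambda>t. 1 / t"
        and B = "2 * (cmod x * cmod y)"])
    show "continuous_on {0..1} (\<lambda>t. 1 * (f (t *\<^sub>R p))\<^sup>2)" for p
      by (intro continuous_intros continuous_on_compose2[OF continuous_on_dunkl_eigen[OF f_eigen]]) auto
    fix t :: real and q :: complex
    assume t_pos: "0 < t" and q_orbit: "q \<in> orbit x"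
    have "(f has_derivative ?D (t *\<^sub>R q)) (at (t *\<^sub>R q))"
      using diff frechet_derivative_works by blast
    then have "((\<lambda>t. f (t *\<^sub>R q)) has_derivative (\<lambda>h. ?D (t *\<^sub>R q) (h *\<^sub>R q))) (at t)"
      by (rule has_derivative_compose[rotated]) (auto intro!: derivative_eq_intros)
    moreover have "(\<lambda>h. ?D (t *\<^sub>R q) (h *\<^sub>R q)) = (\<lambda>h. ?D (t *\<^sub>R q) q * h)"
      by (simp add: linear_scale[OF linear_D] mult.commute)
    ultimately show "((\<lambda>t. f (t *\<^sub>R q)) has_real_derivative ?D (t *\<^sub>R q) q) (at t)"
      by (simp add: has_field_derivative_def)
    have regular: "dih_regular k (t *\<^sub>R q)"
      using t_pos dih_regular_orbit[OF x_regular q_orbit] by (simp add: dih_regular_scaleR)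
    have "?D (t *\<^sub>R q) (t *\<^sub>R q) + refl_diff f (t *\<^sub>R q) = ((t *\<^sub>R q) \<bullet> y) * f (t *\<^sub>R q)"
      unfolding dunkl_op_radial[OF regular, symmetric] using f_eigen regular by (simp only: dunkl_eigen_def)
    moreover have "refl_diff f (t *\<^sub>R q) = refl_diff (\<lambda>p. f (t *\<^sub>R p)) q"
      by (simp add: refl_diff_def rfl_scaleR)
    ultimately show "1 * ?D (t *\<^sub>R q) q = (q \<bullet> y) * f (t *\<^sub>R q) - 1 / t * refl_diff (\<lambda>p. f (t *\<^sub>R p)) q"
      using t_pos by (simp add: linear_scale[OF linear_D] field_simps)
    show "0 + 2 * (q \<bullet> y) \<le> 2 * (cmod x * cmod y)"
      using norm_cauchy_schwarz[of q y] norm_orbit[OF q_orbit] by simp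
  qed (simp_all add: \<open>f 0 = 0\<close>)
  then show ?thesis by simp
qed

lemma dunkl_eigen_eq_0:
  assumes f_eigen: "dunkl_eigen y f" and "f 0 = 0"
  shows "f x = 0"
proof -
  have "closed {p. f p = 0}"
    by (intro closed_Collect_eq continuous_on_dunkl_eigen[OF f_eigen] continuous_intros)
  then have "closure {p. dih_regular k p} \<subseteq> {p. f p = 0}"
    using dunkl_eigen_regular_eq_0[OF assms] by (intro closure_minimal) auto
  then show ?thesis using closure_dih_regular by auto
qed

lemma dunkl_eigen_unique:
  assumes f_eigen: "dunkl_eigen y f" and g_eigen: "dunkl_eigen y g" and "f 0 = g 0"
  shows "f = g"
proof
  fix x
  have diff: "f differentiable (at p)" "(\<lambda>p. (-1) * g p) differentiable (at p)" "g differentiable (at p)" for p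
    using f_eigen g_eigen by (auto simp: dunkl_eigen_def intro!: differentiable_minus)
  have "dunkl_op k a b e (\<lambda>p. f p - g p) p = dunkl_op k a b e f p - dunkl_op k a b e g p" for e p
    using dunkl_op_add[OF diff(1,2), of e p] dunkl_op_cmult[OF diff(3), of e "- 1" p] by simp
  then have "dunkl_eigen y (\<lambda>p. f p - g p)"
    using f_eigen g_eigen by (auto simp: dunkl_eigen_def right_diff_distrib intro!: differentiable_diff)
  from dunkl_eigen_eq_0[OF this, of x] \<open>f 0 = g 0\<close> show "f x = g x" by simp
qed

lemma dunkl_kernel_eqI:
  assumes "dunkl_eigen y f" "f 0 = 1"
  shows "dunkl_kernel k a b x y = f x"
proof -
  have "(THE f. dunkl_eigen y f \<and> f 0 = 1) = f"
    using assms by (intro the_equality) (auto intro!: dunkl_eigen_unique)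
  then show ?thesis by (simp add: dunkl_kernel_eq_The)
qed

end

section \<open>Functions with a bounded derivative\<close>

definition has_derivative_bound ::
    "('a::real_normed_vector \<Rightarrow> 'b::real_normed_vector) \<Rightarrow> real \<Rightarrow> 'a \<Rightarrow> bool" where
  "has_derivative_bound f M x \<longleftrightarrow> (\<exists>D. (f has_derivative D) (at x) \<and> (\<forall>h. norm (D h) \<le> M * norm h))"

lemma has_derivative_boundI:
  "(f has_derivative D) (at x) \<Longrightarrow> (\<And>h. norm (D h) \<le> M * norm h) \<Longrightarrow> has_derivative_bound f M x"
  by (auto simp: has_derivative_bound_def)

lemma has_derivative_boundE:
  assumes "has_derivative_bound f M x"
  obtains D where "(f has_derivative D) (at x)" "\<And>h. norm (D h) \<le> M * norm h"
  using assms by (auto simp: has_derivative_bound_def)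

lemma has_derivative_bound_const: "has_derivative_bound (\<lambda>_. c) 0 x"
  by (rule has_derivative_boundI[of _ "\<lambda>_. 0"]) auto

lemma has_derivative_bound_add:
  assumes "has_derivative_bound f M x" "has_derivative_bound g N x"
  shows "has_derivative_bound (\<lambda>x. f x + g x) (M + N) x"
proof -
  obtain D D' where "(f has_derivative D) (at x)" "(g has_derivative D') (at x)"
    and bounds: "\<And>h. norm (D h) \<le> M * norm h" "\<And>h. norm (D' h) \<le> N * norm h"
    using assms by (auto elim!: has_derivative_boundE)
  then show ?thesis
    by (intro has_derivative_boundI[OF has_derivative_add])
      (auto simp: ring_distribs intro!: order.trans[OF norm_triangle_ineq] add_mono bounds)
qed

lemma has_derivative_bound_cmult:
  fixes f :: "'a::real_normed_vector \<Rightarrow> 'b::real_normed_algebra"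
  assumes f_bound: "has_derivative_bound f M x" and "norm c \<le> C"
  shows "has_derivative_bound (\<lambda>x. c * f x) (C * M) x"
proof -
  obtain D where f_deriv: "(f has_derivative D) (at x)" and bound: "\<And>h. norm (D h) \<le> M * norm h"
    using f_bound by (auto elim!: has_derivative_boundE)
  have "norm (c * D h) \<le> C * M * norm h" for h
  proof -
    have "norm (c * D h) \<le> norm c * norm (D h)" by (rule norm_mult_ineq)
    also have "\<dots> \<le> C * (M * norm h)"
      using assms(2) bound by (intro mult_mono) (auto intro: order.trans[OF norm_ge_zero])
    finally show ?thesis by (simp add: mult.assoc)
  qed
  with f_deriv show ?thesis
    by (intro has_derivative_boundI[of _ "\<lambda>h. c * D h"]) (auto intro!: derivative_intros)
qed

lemma has_derivative_bound_diff:
  fixes f g :: "'a::real_normed_vector \<Rightarrow> real"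
  assumes "has_derivative_bound f M x" "has_derivative_bound g N x"
  shows "has_derivative_bound (\<lambda>x. f x - g x) (M + N) x"
  using has_derivative_bound_add[OF assms(1) has_derivative_bound_cmult[OF assms(2), of "- 1" 1]] by simp

lemma has_derivative_bound_divide:
  fixes f :: "'a::real_normed_vector \<Rightarrow> real"
  assumes "has_derivative_bound f M x" "0 < r" "r \<le> c"
  shows "has_derivative_bound (\<lambda>x. f x / c) (M / r) x"
  using has_derivative_bound_cmult[OF assms(1), of "1 / c" "1 / r"] assms(2,3) by (simp add: frac_le)

lemma has_derivative_bound_sum:
  assumes "\<And>i. i \<in> I \<Longrightarrow> has_derivative_bound (f i) M x"
  shows "has_derivative_bound (\<lambda>x. \<Sum>i\<in>I. f i x) (real (card I) * M) x"
  using assms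
proof (induction I rule: infinite_finite_induct)
  case (insert i I)
  then show ?case
    using has_derivative_bound_add[of "f i" M x "\<lambda>x. \<Sum>i\<in>I. f i x"] by (simp add: distrib_right)
qed (simp_all add: has_derivative_bound_const)

lemma has_derivative_bound_isometry:
  assumes f_bound: "has_derivative_bound f M (g x)" and linear_g: "bounded_linear g"
    and isometry: "\<And>h. norm (g h) = norm h"
  shows "has_derivative_bound (\<lambda>x. f (g x)) M x"
proof -
  obtain D where "(f has_derivative D) (at (g x))" and bound: "\<And>h. norm (D h) \<le> M * norm h"
    using f_bound by (auto elim!: has_derivative_boundE)
  then have "((\<lambda>x. f (g x)) has_derivative (\<lambda>h. D (g h))) (at x)"
    using bounded_linear_imp_has_derivative[OF linear_g] by (blast intro: has_derivative_compose)
  then show ?thesis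
  proof (rule has_derivative_boundI)
    show "norm (D (g h)) \<le> M * norm h" for h
      using bound[of "g h"] by (simp add: isometry)
  qed
qed

lemma has_derivative_bound_inner_mult:
  fixes f :: "'a::real_inner \<Rightarrow> real"
  assumes f_bound: "has_derivative_bound f M x" and "\<bar>f x\<bar> \<le> B"
  shows "has_derivative_bound (\<lambda>x. (x \<bullet> y) * f x) (norm y * B + norm x * norm y * M) x"
proof -
  obtain D where f_deriv: "(f has_derivative D) (at x)" and bound: "\<And>h. norm (D h) \<le> M * norm h"
    using f_bound by (auto elim!: has_derivative_boundE)
  have "norm ((x \<bullet> y) * D h + (h \<bullet> y) * f x) \<le> (norm y * B + norm x * norm y * M) * norm h" for h
  proof -
    have "\<bar>(x \<bullet> y) * D h\<bar> \<le> (norm x * norm y) * (M * norm h)"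
      unfolding abs_mult using bound[of h] Cauchy_Schwarz_ineq2[of x y] by (intro mult_mono) auto
    moreover have "\<bar>(h \<bullet> y) * f x\<bar> \<le> (norm h * norm y) * B"
      unfolding abs_mult using assms(2) Cauchy_Schwarz_ineq2[of h y] by (intro mult_mono) auto
    ultimately show ?thesis by (simp add: algebra_simps)
  qed
  moreover have "((\<lambda>x. (x \<bullet> y) * f x) has_derivative (\<lambda>h. (x \<bullet> y) * D h + (h \<bullet> y) * f x)) (at x)"
    using f_deriv by (auto intro!: derivative_eq_intros)
  ultimately show ?thesis by (intro has_derivative_boundI)
qed

lemma has_derivative_suminf:
  fixes f :: "nat \<Rightarrow> 'a::real_normed_vector \<Rightarrow> 'b::banach"
  assumes S_convex: "convex S" "open S" "x \<in> S"
    and deriv: "\<And>n p. p \<in> S \<Longrightarrow> (f n has_derivative f' n p) (at p)"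
    and bound: "\<And>n p h. p \<in> S \<Longrightarrow> norm (f' n p h) \<le> B n * norm h" and "summable B"
    and sums: "\<And>p. p \<in> S \<Longrightarrow> summable (\<lambda>n. f n p)"
  shows "summable (\<lambda>n. f' n x h)" and "((\<lambda>p. \<Sum>n. f n p) has_derivative (\<lambda>h. \<Sum>n. f' n x h)) (at x)"
proof -
  have summable_deriv: "summable (\<lambda>n. f' n p h)" if "p \<in> S" for p h
    by (rule summable_comparison_test[OF _ summable_mult2[OF \<open>summable B\<close>]]) (use bound[OF that] in auto)
  show "summable (\<lambda>n. f' n x h)" by (rule summable_deriv[OF \<open>x \<in> S\<close>])
  have tail: "norm ((\<Sum>i<N. f' i p h) - (\<Sum>n. f' n p h)) \<le> (\<Sum>n. B (n + N)) * norm h" if "p \<in> S" for p h N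
  proof -
    have "norm ((\<Sum>i<N. f' i p h) - (\<Sum>n. f' n p h)) = norm (\<Sum>n. f' (n + N) p h)"
      using suminf_split_initial_segment[OF summable_deriv[OF that], of h N] by simp
    also have "\<dots> \<le> (\<Sum>n. B (n + N) * norm h)"
      using bound[OF that]
      by (intro norm_suminf_le summable_mult2 summable_ignore_initial_segment \<open>summable B\<close>) auto
    also have "\<dots> = (\<Sum>n. B (n + N)) * norm h"
      by (intro suminf_mult2[symmetric] summable_ignore_initial_segment \<open>summable B\<close>)
    finally show ?thesis .
  qed
  have "\<exists>g. \<forall>p\<in>S. (\<lambda>n. f n p) sums g p \<and> (g has_derivative (\<lambda>h. \<Sum>n. f' n p h)) (at p within S)"
  proof (rule has_derivative_series[where f = f and f' = f'])
    show "(\<lambda>n. f n x) sums (\<Sum>n. f n x)"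
      by (rule summable_sums[OF sums[OF \<open>x \<in> S\<close>]])
    show "(f n has_derivative f' n p) (at p within S)" if "p \<in> S" for n p
      using deriv[OF that] by (rule has_derivative_at_withinI)
    fix e :: real assume "0 < e"
    with suminf_exist_split2[OF \<open>summable B\<close>] have "\<forall>\<^sub>F N in sequentially. (\<Sum>n. B (n + N)) < e"
      by (rule order_tendstoD(2))
    then show "\<forall>\<^sub>F N in sequentially. \<forall>p\<in>S. \<forall>h.
        norm ((\<Sum>i<N. f' i p h) - (\<Sum>n. f' n p h)) \<le> e * norm h"
      by (rule eventually_mono)
        (intro ballI allI, rule order.trans[OF tail], simp_all add: mult_right_mono)
  qed (rule S_convex)+
  then obtain g where g_sums: "\<And>p. p \<in> S \<Longrightarrow> (\<lambda>n. f n p) sums g p"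
    and "(g has_derivative (\<lambda>h. \<Sum>n. f' n x h)) (at x within S)"
    using \<open>x \<in> S\<close> by blast
  then have "(g has_derivative (\<lambda>h. \<Sum>n. f' n x h)) (at x)"
    by (simp only: at_within_open[OF \<open>x \<in> S\<close> \<open>open S\<close>])
  then show "((\<lambda>p. \<Sum>n. f n p) has_derivative (\<lambda>h. \<Sum>n. f' n x h)) (at x)"
  proof (rule has_derivative_transform_within_open[OF _ \<open>open S\<close> \<open>x \<in> S\<close>])
    show "g p = (\<Sum>n. f n p)" if "p \<in> S" for p
      using g_sums[OF that] by (rule sums_unique)
  qed
qed

section \<open>Inverting the radial operator\<close>

context dihedral
begin

definition rot_mean :: "(complex \<Rightarrow> real) \<Rightarrow> complex \<Rightarrow> real" where
  "rot_mean f x = (\<Sum>i<k. f (rot (2 * int i) x)) / real k"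

lemma rot_mean_rot_even: "rot_mean f (rot (2 * m) x) = rot_mean f x"
proof -
  have "f (rot (2 * (i + int k)) x) = f (rot (2 * i) x)" for i
    using rot_period[of "2 * i" x] by (simp add: algebra_simps)
  from sum_periodic_shift[of "\<lambda>i. f (rot (2 * i) x)", OF this, of m] show ?thesis
    by (simp add: rot_mean_def rot_rot distrib_left)
qed

lemma rot_mean_rot_add_even: "rot_mean f (rot (j + 2 * m) x) = rot_mean f (rot j x)"
  using rot_mean_rot_even[of f m "rot j x"] by (simp add: rot_rot add.commute)

lemma rot_mean_rfl_add_even: "rot_mean f (rfl (j + 2 * m) x) = rot_mean f (rfl j x)"
  using rot_mean_rot_even[of f m "rfl j x"] by (simp add: rot_rfl add.commute)

lemma rot_mean_rot_mean: "rot_mean (rot_mean f) x = rot_mean f x"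
  by (simp add: rot_mean_def[of "rot_mean f"] rot_mean_rot_even)

lemma orbit_sum_eq_rot_mean:
  "orbit_sum f x = real k * (rot_mean f x + rot_mean f (rot 1 x) + rot_mean f (rfl 0 x) + rot_mean f (rfl 1 x))"
  using sum_even_odd[of "\<lambda>i. f (rot i x)" k] sum_even_odd[of "\<lambda>i. f (rfl i x)" k]
  by (simp add: orbit_sum_def rot_mean_def sum.distrib rot_rot rot_rfl distrib_left)

lemma refl_diff_eq_rot_mean:
  "refl_diff f x = real k * ((a + b) * f x - a * rot_mean f (rfl 0 x) - b * rot_mean f (rfl 1 x))"
  unfolding refl_diff_eq sum_kappa_mult[of "\<lambda>j. f (rfl j x)"]
  by (simp add: rot_mean_def rot_rfl algebra_simps)

text \<open>The even rotations form a normal subgroup with quotient the Klein four-group, so the averages over them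
  are spanned by the functions on which each of the two classes of reflections acts by a sign.\<close>

definition klein_part :: "real \<Rightarrow> real \<Rightarrow> (complex \<Rightarrow> real) \<Rightarrow> complex \<Rightarrow> real" where
  "klein_part e d f x =
     (rot_mean f x + e * rot_mean f (rfl 0 x) + d * rot_mean f (rfl 1 x) + e * d * rot_mean f (rot 1 x)) / 4"

lemma klein_part_rfl:
  assumes "e\<^sup>2 = 1" "d\<^sup>2 = 1"
  shows "klein_part e d f (rfl j x) = (if even j then e else d) * klein_part e d f x"
proof -
  have signs: "e * e = 1" "d * d = 1" "e * (e * r) = r" "d * (d * r) = r" for r
    using assms by (simp_all add: power2_eq_square mult.assoc[symmetric])
  show ?thesis
  proof (cases "even j")
    case True
    then obtain m where j_eq: "j = 2 * m" by (elim evenE)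
    show ?thesis
      using rot_mean_rfl_add_even[of f 0 m x] rot_mean_rfl_add_even[of f 1 m x]
        rot_mean_rot_add_even[of f 0 "- m" x] rot_mean_rot_add_even[of f 1 "- m" x]
      by (simp add: j_eq klein_part_def rfl_rfl rot_rfl signs algebra_simps)
  next
    case False
    then obtain m where j_eq: "j = 2 * m + 1" by (elim oddE)
    show ?thesis
      using rot_mean_rfl_add_even[of f 1 m x] rot_mean_rfl_add_even[of f 0 "m + 1" x]
        rot_mean_rot_add_even[of f 0 "- m" x] rot_mean_rot_add_even[of f 1 "- m - 1" x]
      by (simp add: j_eq klein_part_def rfl_rfl rot_rfl signs algebra_simps)
  qed
qed

lemma refl_diff_klein_part:
  assumes "e\<^sup>2 = 1" "d\<^sup>2 = 1"
  shows "refl_diff (klein_part e d f) x = real k * (a * (1 - e) + b * (1 - d)) * klein_part e d f x"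
  unfolding refl_diff_eq klein_part_rfl[OF assms]
    sum_kappa_mult[of "\<lambda>j. (if even j then e else d) * klein_part e d f x"]
  by (simp add: algebra_simps)

lemma refl_diff_minus_rot_mean:
  "refl_diff (\<lambda>x. f x - rot_mean f x) x = real k * (a + b) * (f x - rot_mean f x)"
  unfolding refl_diff_diff refl_diff_eq_rot_mean rot_mean_rot_mean by (simp add: algebra_simps)

lemma sum_klein_part: "(\<Sum>e\<in>{1, -1}. \<Sum>d\<in>{1, -1}. klein_part e d f x) = rot_mean f x"
  by (simp add: klein_part_def field_simps)

definition resolvent :: "real \<Rightarrow> (complex \<Rightarrow> real) \<Rightarrow> complex \<Rightarrow> real" where
  "resolvent n f x = (f x - rot_mean f x) / (n + real k * (a + b))
     + (\<Sum>e\<in>{1, -1}. \<Sum>d\<in>{1, -1}. klein_part e d f x / (n + real k * (a * (1 - e) + b * (1 - d))))"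

lemma resolvent_denom_ge:
  "n \<le> n + real k * (a + b)" "e \<in> {1, -1} \<Longrightarrow> d \<in> {1, -1} \<Longrightarrow> n \<le> n + real k * (a * (1 - e) + b * (1 - d))"
  using a_pos b_pos by auto

lemma refl_diff_eigen_divide:
  assumes "refl_diff h x = c * h x" "n + c \<noteq> 0"
  shows "n * (h x / (n + c)) + refl_diff (\<lambda>x. h x / (n + c)) x = h x"
  using refl_diff_cmult[of "1 / (n + c)" h x] assms by (simp add: field_simps)

lemma resolvent_eq:
  assumes "0 < n"
  shows "n * resolvent n f x + refl_diff (resolvent n f) x = f x"
proof -
  let ?N = "n + real k * (a + b)" and ?L = "\<lambda>e d. n + real k * (a * (1 - e) + b * (1 - d))"
  have "n * ((f x - rot_mean f x) / ?N) + refl_diff (\<lambda>x. (f x - rot_mean f x) / ?N) x = f x - rot_mean f x"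
    using resolvent_denom_ge(1)[of n] assms
    by (intro refl_diff_eigen_divide refl_diff_minus_rot_mean) linarith
  moreover have "n * (klein_part e d f x / ?L e d) + refl_diff (\<lambda>x. klein_part e d f x / ?L e d) x
      = klein_part e d f x" if "e \<in> {1, -1}" "d \<in> {1, -1}" for e d
    using resolvent_denom_ge(2)[OF that, of n] assms that
    by (intro refl_diff_eigen_divide refl_diff_klein_part) auto
  then have "(\<Sum>e\<in>{1, -1}. \<Sum>d\<in>{1, -1}. n * (klein_part e d f x / ?L e d)
      + refl_diff (\<lambda>x. klein_part e d f x / ?L e d) x) = rot_mean f x"
    unfolding sum_klein_part[symmetric] by (intro sum.cong refl) auto
  ultimately show ?thesis
    unfolding resolvent_def[abs_def] refl_diff_add refl_diff_sum
    by (simp only: distrib_left sum_distrib_left sum.distrib)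
qed

lemma abs_rot_mean_le:
  assumes "\<And>p. cmod p = cmod x \<Longrightarrow> \<bar>f p\<bar> \<le> M"
  shows "\<bar>rot_mean f x\<bar> \<le> M"
proof -
  have "\<bar>\<Sum>i<k. f (rot (2 * int i) x)\<bar> \<le> (\<Sum>i<k. M)"
    by (rule order.trans[OF sum_abs]) (intro sum_mono assms, simp)
  then show ?thesis by (simp add: rot_mean_def abs_divide field_simps)
qed

lemma abs_klein_part_le:
  assumes "e \<in> {1, -1}" "d \<in> {1, -1}" "\<And>p. cmod p = cmod x \<Longrightarrow> \<bar>f p\<bar> \<le> M"
  shows "\<bar>klein_part e d f x\<bar> \<le> M"
proof -
  have "\<bar>rot_mean f x\<bar> \<le> M" "\<bar>rot_mean f (rfl 0 x)\<bar> \<le> M"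
    "\<bar>rot_mean f (rfl 1 x)\<bar> \<le> M" "\<bar>rot_mean f (rot 1 x)\<bar> \<le> M"
    by (rule abs_rot_mean_le, rule assms(3), simp)+
  with assms(1,2) show ?thesis
    by (auto simp: klein_part_def abs_le_iff)
qed

lemma abs_resolvent_le:
  assumes "0 < n" and f_bound: "\<And>p. cmod p = cmod x \<Longrightarrow> \<bar>f p\<bar> \<le> M"
  shows "\<bar>resolvent n f x\<bar> \<le> 6 * M / n"
proof -
  have quotient_le: "\<bar>v / c\<bar> \<le> V / n" if "\<bar>v\<bar> \<le> V" "n \<le> c" for v c V
    using that \<open>0 < n\<close> by (simp add: abs_divide frac_le)
  have "\<bar>(f x - rot_mean f x) / (n + real k * (a + b))\<bar> \<le> 2 * M / n"
    using f_bound[of x] abs_rot_mean_le[of x f M, OF f_bound] by (intro quotient_le resolvent_denom_ge) linarith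
  moreover have "\<bar>\<Sum>e\<in>{1, -1}. \<Sum>d\<in>{1, -1}. klein_part e d f x / (n + real k * (a * (1 - e) + b * (1 - d)))\<bar>
      \<le> (\<Sum>e\<in>{1::real, -1}. \<Sum>d\<in>{1::real, -1}. M / n)"
    by (intro order.trans[OF sum_abs] sum_mono quotient_le abs_klein_part_le resolvent_denom_ge f_bound)
  ultimately have "\<bar>resolvent n f x\<bar> \<le> 2 * M / n + (\<Sum>e\<in>{1::real, -1}. \<Sum>d\<in>{1::real, -1}. M / n)"
    unfolding resolvent_def by (intro order.trans[OF abs_triangle_ineq] add_mono)
  then show ?thesis by (simp add: field_simps)
qed

lemma bounded_linear_rot: "bounded_linear (rot i)"
  unfolding rot_def[abs_def] by (rule bounded_linear_mult_left)

lemma bounded_linear_rfl: "bounded_linear (rfl i)"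
  unfolding rfl_def[abs_def] by (rule bounded_linear_mult_const[OF bounded_linear_cnj])

lemma has_derivative_bound_rot: "has_derivative_bound f M (rot i x) \<Longrightarrow> has_derivative_bound (\<lambda>x. f (rot i x)) M x"
  by (rule has_derivative_bound_isometry) (simp_all add: bounded_linear_rot)

lemma has_derivative_bound_rfl: "has_derivative_bound f M (rfl i x) \<Longrightarrow> has_derivative_bound (\<lambda>x. f (rfl i x)) M x"
  by (rule has_derivative_bound_isometry) (simp_all add: bounded_linear_rfl)

lemma has_derivative_bound_rot_mean:
  assumes "\<And>p. cmod p = cmod x \<Longrightarrow> has_derivative_bound f M p"
  shows "has_derivative_bound (rot_mean f) M x"
proof -
  have "has_derivative_bound (\<lambda>x. \<Sum>i<k. f (rot (2 * int i) x)) (real (card {..<k}) * M) x"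
    by (intro has_derivative_bound_sum has_derivative_bound_rot assms) simp
  from has_derivative_bound_divide[OF this, of "real k" "real k"] show ?thesis
    by (simp add: rot_mean_def[abs_def])
qed

lemma has_derivative_bound_klein_part:
  assumes "e \<in> {1, -1}" "d \<in> {1, -1}" "\<And>p. cmod p = cmod x \<Longrightarrow> has_derivative_bound f M p"
  shows "has_derivative_bound (klein_part e d f) M x"
proof -
  have "has_derivative_bound (klein_part e d f) ((M + 1 * M + 1 * M + 1 * M) / 4) x"
    unfolding klein_part_def[abs_def] using assms
    by (intro has_derivative_bound_divide has_derivative_bound_add has_derivative_bound_cmult
        has_derivative_bound_rot has_derivative_bound_rfl has_derivative_bound_rot_mean) auto
  then show ?thesis by simp
qed

lemma has_derivative_bound_resolvent:
  assumes "0 < n" and f_bound: "\<And>p. cmod p = cmod x \<Longrightarrow> has_derivative_bound f M p"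
  shows "has_derivative_bound (resolvent n f) (6 * M / n) x"
proof -
  have "has_derivative_bound (resolvent n f)
      ((M + M) / n + real (card {1::real, -1}) * (real (card {1::real, -1}) * (M / n))) x"
    unfolding resolvent_def[abs_def]
    by (intro has_derivative_bound_add has_derivative_bound_sum has_derivative_bound_divide[OF _ \<open>0 < n\<close>]
        has_derivative_bound_diff has_derivative_bound_klein_part has_derivative_bound_rot_mean
        resolvent_denom_ge f_bound refl)
  then show ?thesis by (simp add: field_simps)
qed

lemma resolvent_scaleR_cong:
  assumes "\<And>p. g (t *\<^sub>R p) = s * f p"
  shows "resolvent n g (t *\<^sub>R x) = s * resolvent n f x"
proof -
  have "rot_mean g (t *\<^sub>R p) = s * rot_mean f p" for p
    by (simp add: rot_mean_def rot_scaleR assms sum_distrib_left)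
  then have "klein_part e d g (t *\<^sub>R x) = s * klein_part e d f x"
    and "g (t *\<^sub>R x) - rot_mean g (t *\<^sub>R x) = s * (f x - rot_mean f x)" for e d
    by (simp_all add: klein_part_def rot_scaleR rfl_scaleR assms algebra_simps)
  then show ?thesis
    by (simp only: resolvent_def distrib_left sum_distrib_left times_divide_eq_right)
qed

end

section \<open>Existence of the Dunkl kernel\<close>

context dihedral
begin

primrec dunkl_component :: "complex \<Rightarrow> nat \<Rightarrow> complex \<Rightarrow> real" where
  "dunkl_component y 0 = (\<lambda>x. 1)"
| "dunkl_component y (Suc n) = resolvent (real (Suc n)) (\<lambda>x. (x \<bullet> y) * dunkl_component y n x)"

declare dunkl_component.simps(2) [simp del]

lemma dunkl_component_Suc_radial:
  "real (Suc n) * dunkl_component y (Suc n) x + refl_diff (dunkl_component y (Suc n)) x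
     = (x \<bullet> y) * dunkl_component y n x"
  unfolding dunkl_component.simps by (rule resolvent_eq) simp

lemma dunkl_component_scaleR: "dunkl_component y n (t *\<^sub>R x) = t ^ n * dunkl_component y n x"
proof (induction n arbitrary: x)
  case (Suc n)
  show ?case
    unfolding dunkl_component.simps by (rule resolvent_scaleR_cong) (simp add: Suc algebra_simps)
qed simp

lemma dunkl_component_scaleR_snd: "dunkl_component (t *\<^sub>R y) n x = t ^ n * dunkl_component y n x"
proof (induction n arbitrary: x)
  case (Suc n)
  have "resolvent (real (Suc n)) (\<lambda>x. (x \<bullet> t *\<^sub>R y) * dunkl_component (t *\<^sub>R y) n x) (1 *\<^sub>R x)
      = t ^ Suc n * resolvent (real (Suc n)) (\<lambda>x. (x \<bullet> y) * dunkl_component y n x) x"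
    by (rule resolvent_scaleR_cong) (simp add: Suc algebra_simps)
  then show ?case by (simp add: dunkl_component.simps)
qed simp

lemma dunkl_component_at_0: "dunkl_component y n 0 = (if n = 0 then 1 else 0)"
  using dunkl_component_scaleR[of y n 0 0] by (cases n) simp_all

lemma abs_dunkl_component_le: "\<bar>dunkl_component y n x\<bar> \<le> (6 * (cmod x * cmod y)) ^ n / fact n"
proof (induction n arbitrary: x)
  case (Suc n)
  let ?M = "(cmod x * cmod y) * ((6 * (cmod x * cmod y)) ^ n / fact n)"
  have "\<bar>(p \<bullet> y) * dunkl_component y n p\<bar> \<le> ?M" if "cmod p = cmod x" for p
    unfolding abs_mult using Suc[of p] Cauchy_Schwarz_ineq2[of p y] that
    by (intro mult_mono) auto
  then have "\<bar>dunkl_component y (Suc n) x\<bar> \<le> 6 * ?M / real (Suc n)"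
    unfolding dunkl_component.simps by (intro abs_resolvent_le) auto
  also have "\<dots> = (6 * (cmod x * cmod y)) ^ Suc n / fact (Suc n)"
    by (simp add: mult_ac)
  finally show ?case .
qed simp

lemma has_derivative_bound_dunkl_component:
  "has_derivative_bound (dunkl_component y n)
     (real n * (6 * cmod y * (6 * (cmod x * cmod y)) ^ (n - 1)) / fact n) x"
proof (induction n arbitrary: x)
  case 0
  show ?case by (simp add: has_derivative_bound_const)
next
  case (Suc n)
  let ?C = "6 * (cmod x * cmod y)"
  have power_step: "real n * (?C * ?C ^ (n - 1)) = real n * ?C ^ n"
    by (cases n) auto
  have product_bound: "has_derivative_bound (\<lambda>x. (x \<bullet> y) * dunkl_component y n x)
      (real (Suc n) * (cmod y * ?C ^ n) / fact n) p" if "cmod p = cmod x" for p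
  proof -
    have "has_derivative_bound (\<lambda>x. (x \<bullet> y) * dunkl_component y n x)
        (cmod y * (?C ^ n / fact n)
         + cmod x * cmod y * (real n * (6 * cmod y * ?C ^ (n - 1)) / fact n)) p"
      using has_derivative_bound_inner_mult[OF Suc.IH[of p] abs_dunkl_component_le[of y n p]] by (simp add: that)
    also have "cmod x * cmod y * (real n * (6 * cmod y * ?C ^ (n - 1)) / fact n)
        = cmod y * (real n * (?C * ?C ^ (n - 1))) / fact n"
      by (simp only: times_divide_eq_right mult_ac)
    finally show ?thesis
      unfolding power_step by (simp add: add_divide_distrib[symmetric] algebra_simps)
  qed
  have "has_derivative_bound (dunkl_component y (Suc n))
      (6 * (real (Suc n) * (cmod y * ?C ^ n) / fact n) / real (Suc n)) x"
    unfolding dunkl_component.simps by (intro has_derivative_bound_resolvent product_bound) simp_all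
  then show ?case by (simp add: field_simps)
qed

lemma dunkl_component_has_derivative:
  "(dunkl_component y n has_derivative frechet_derivative (dunkl_component y n) (at x)) (at x)"
  using has_derivative_bound_dunkl_component[of y n x]
  by (auto simp: frechet_derivative_works[symmetric] elim!: has_derivative_boundE intro: differentiableI)

lemma dunkl_component_differentiable: "dunkl_component y n differentiable (at x)"
  using dunkl_component_has_derivative by (rule differentiableI)

lemma abs_frechet_derivative_dunkl_component_le:
  assumes "cmod x \<le> R"
  shows "\<bar>frechet_derivative (dunkl_component y n) (at x) h\<bar>
    \<le> real n * (6 * cmod y * (6 * (R * cmod y)) ^ (n - 1)) / fact n * cmod h"
proof -
  let ?M = "\<lambda>R. real n * (6 * cmod y * (6 * (R * cmod y)) ^ (n - 1)) / fact n"
  have "\<bar>frechet_derivative (dunkl_component y n) (at x) h\<bar> \<le> ?M (cmod x) * cmod h"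
    using has_derivative_bound_dunkl_component[of y n x]
    by (auto simp: frechet_derivative_at[symmetric] elim!: has_derivative_boundE)
  also have "\<dots> \<le> ?M R * cmod h"
    using assms by (intro mult_right_mono divide_right_mono mult_left_mono power_mono) auto
  finally show ?thesis .
qed

lemma dunkl_component_Euler: "frechet_derivative (dunkl_component y n) (at x) x = real n * dunkl_component y n x"
proof -
  let ?D = "frechet_derivative (dunkl_component y n) (at x)"
  have "((\<lambda>t. dunkl_component y n (t *\<^sub>R x)) has_derivative (\<lambda>h. ?D (h *\<^sub>R x))) (at 1)"
    by (rule has_derivative_compose[where f = "\<lambda>t. t *\<^sub>R x"])
      (auto intro!: derivative_eq_intros dunkl_component_has_derivative)
  then have "((\<lambda>t. t ^ n * dunkl_component y n x) has_derivative (\<lambda>h. ?D (h *\<^sub>R x))) (at 1)"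
    by (simp add: dunkl_component_scaleR)
  moreover have "((\<lambda>t. t ^ n * dunkl_component y n x) has_derivative (\<lambda>h. real n * dunkl_component y n x * h)) (at 1)"
    by (auto intro!: derivative_eq_intros)
  ultimately have "(\<lambda>h. ?D (h *\<^sub>R x)) = (\<lambda>h. real n * dunkl_component y n x * h)"
    by (rule has_derivative_unique)
  from fun_cong[OF this, of 1] show ?thesis by simp
qed

lemma dunkl_op_sum:
  assumes "\<And>j. j \<in> J \<Longrightarrow> f j differentiable (at x)"
  shows "dunkl_op k a b e (\<lambda>x. \<Sum>j\<in>J. f j x) x = (\<Sum>j\<in>J. dunkl_op k a b e (f j) x)"
  using assms
proof (induction J rule: infinite_finite_induct)
  case (insert j J)
  have "(\<lambda>x. \<Sum>j\<in>J. f j x) differentiable (at x)"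
    using insert by (intro differentiable_sum) auto
  with insert show ?case by (simp add: dunkl_op_add)
qed (simp_all add: dunkl_op_eq)

definition angular_op :: "(complex \<Rightarrow> real) \<Rightarrow> complex \<Rightarrow> real" where
  "angular_op f x = dunkl_op k a b (\<i> * x) f x"

definition mirror_cot :: "int \<Rightarrow> complex \<Rightarrow> real" where
  "mirror_cot i x = (mirror_normal i \<bullet> (\<i> * x)) / (mirror_normal i \<bullet> x)"

lemma angular_op_eq:
  "angular_op f x = frechet_derivative f (at x) (\<i> * x)
     + (\<Sum>j<2*k. kappa (int j) * mirror_cot (int j) x * (f x - f (rfl (int j) x)))"
  by (simp add: angular_op_def dunkl_op_eq mirror_cot_def)

lemma i_mult_rfl: "\<i> * rfl j x = - rfl j (\<i> * x)"
  by (simp add: rfl_def)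

lemma mirror_cot_period: "mirror_cot (i + 2 * int k) x = mirror_cot i x"
  by (simp add: mirror_cot_def mirror_normal_period)

lemma mirror_cot_rfl: "mirror_cot (2 * j - i) (rfl j x) = - mirror_cot i x"
  unfolding mirror_cot_def i_mult_rfl inner_minus_right mirror_normal_inner_rfl by simp

lemma differentiable_rfl: "f differentiable (at (rfl j x)) \<Longrightarrow> (\<lambda>p. f (rfl j p)) differentiable (at x)"
  unfolding differentiable_def
  by (elim exE, rule exI)
    (rule has_derivative_compose[OF bounded_linear_imp_has_derivative[OF bounded_linear_rfl]])

text \<open>Reflections reverse the orientation, so they anticommute with the angular operator.\<close>

lemma angular_op_rfl:
  assumes diff: "f differentiable (at (rfl j x))"
  shows "angular_op (\<lambda>p. f (rfl j p)) x = - angular_op f (rfl j x)"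
proof -
  let ?D = "frechet_derivative f (at (rfl j x))"
  have "((\<lambda>p. f (rfl j p)) has_derivative (\<lambda>h. ?D (rfl j h))) (at x)"
    using diff by (intro has_derivative_compose[OF bounded_linear_imp_has_derivative[OF bounded_linear_rfl]])
      (simp add: frechet_derivative_works)
  then have "frechet_derivative (\<lambda>p. f (rfl j p)) (at x) (\<i> * x) = ?D (- (\<i> * rfl j x))"
    by (simp add: frechet_derivative_at[symmetric] i_mult_rfl)
  also have "\<dots> = - ?D (\<i> * rfl j x)"
    by (rule linear_neg[OF linear_frechet_derivative[OF diff]])
  finally have derivative_part: "frechet_derivative (\<lambda>p. f (rfl j p)) (at x) (\<i> * x) = - ?D (\<i> * rfl j x)" .
  let ?h = "\<lambda>i. kappa i * mirror_cot i (rfl j x) * (f (rfl j x) - f (rfl i (rfl j x)))"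
  have "(\<Sum>i<2*k. ?h (int i)) = (\<Sum>i<2*k. ?h (2 * j - int i))"
    by (rule sum_periodic_reflect[where h = ?h, symmetric]) (simp add: mirror_cot_period)
  also have "\<dots> = (\<Sum>i<2*k. - (kappa (int i) * mirror_cot (int i) x * (f (rfl j x) - f (rfl j (rfl (int i) x)))))"
    by (intro sum.cong refl) (simp add: mirror_cot_rfl rfl_rfl kappa_def)
  finally show ?thesis unfolding angular_op_eq derivative_part by (simp add: sum_negf)
qed

lemma angular_op_radial:
  assumes diff: "\<And>p. f differentiable (at p)"
  shows "angular_op (\<lambda>p. c * f p + refl_diff f p) x = c * angular_op f x + refl_sum (angular_op f) x"
proof -
  let ?N = "c + real k * (a + b)"
  have diff_rfl: "(\<lambda>p. f (rfl j p)) differentiable (at p)" for j p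
    by (intro differentiable_rfl diff)
  have diff_term: "(\<lambda>p. (- kappa j) * f (rfl j p)) differentiable (at p)" for j p
    by (intro differentiable_mult differentiable_const diff_rfl)
  have "angular_op (\<lambda>p. c * f p + refl_diff f p) x
      = angular_op (\<lambda>p. ?N * f p + (\<Sum>j<2*k. (- kappa (int j)) * f (rfl (int j) p))) x"
    by (simp add: refl_diff_eq sum_negf algebra_simps)
  also have "\<dots> = dunkl_op k a b (\<i> * x) (\<lambda>p. ?N * f p) x
      + dunkl_op k a b (\<i> * x) (\<lambda>p. \<Sum>j<2*k. (- kappa (int j)) * f (rfl (int j) p)) x"
    unfolding angular_op_def
    by (intro dunkl_op_add differentiable_mult differentiable_const diff differentiable_sum
        finite_lessThan ballI diff_term)
  also have "\<dots> = ?N * angular_op f x + (\<Sum>j<2*k. (- kappa (int j)) * angular_op (\<lambda>p. f (rfl (int j) p)) x)"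
    unfolding angular_op_def dunkl_op_cmult[OF diff] dunkl_op_sum[OF diff_term] dunkl_op_cmult[OF diff_rfl] ..
  also have "\<dots> = c * angular_op f x + refl_sum (angular_op f) x"
    unfolding angular_op_rfl[OF diff]
    by (simp add: refl_sum_eq algebra_simps)
  finally show ?thesis .
qed

lemma mirror_cot_mult_inner:
  assumes "dih_regular k x"
  shows "mirror_cot j x * (x \<bullet> y - rfl j x \<bullet> y) = (\<i> * x) \<bullet> y + (\<i> * rfl j x) \<bullet> y"
proof -
  have "mirror_normal j \<bullet> x \<noteq> 0"
    using assms by (simp add: dih_regular_iff mirror_normal_inner_eq_0_iff)
  moreover have "x \<bullet> y - rfl j x \<bullet> y = 2 * (mirror_normal j \<bullet> x) * (mirror_normal j \<bullet> y)"
    by (simp add: rfl_eq_reflection[of j x] inner_diff_left)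
  moreover have "(\<i> * x) \<bullet> y + (\<i> * rfl j x) \<bullet> y = 2 * (mirror_normal j \<bullet> (\<i> * x)) * (mirror_normal j \<bullet> y)"
    unfolding i_mult_rfl by (simp add: rfl_eq_reflection[of j "\<i> * x"] inner_diff_left)
  ultimately show ?thesis by (simp add: mirror_cot_def)
qed

lemma angular_op_inner_mult:
  assumes regular: "dih_regular k x" and diff: "f differentiable (at x)"
  shows "angular_op (\<lambda>x. (x \<bullet> y) * f x) x = ((\<i> * x) \<bullet> y) * f x + (x \<bullet> y) * angular_op f x
    + (\<Sum>j<2*k. kappa (int j) * (((\<i> * x) \<bullet> y + (\<i> * rfl (int j) x) \<bullet> y) * f (rfl (int j) x)))"
proof -
  have "((\<lambda>x. (x \<bullet> y) * f x) has_derivative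
      (\<lambda>h. (x \<bullet> y) * frechet_derivative f (at x) h + (h \<bullet> y) * f x)) (at x)"
    by (rule derivative_eq_intros diff[unfolded frechet_derivative_works] refl)+ simp
  note derivative_product = frechet_derivative_at[OF this, symmetric]
  have "kappa j * mirror_cot j x * ((x \<bullet> y) * f x - (rfl j x \<bullet> y) * f (rfl j x))
    = (x \<bullet> y) * (kappa j * mirror_cot j x * (f x - f (rfl j x)))
      + kappa j * (((\<i> * x) \<bullet> y + (\<i> * rfl j x) \<bullet> y) * f (rfl j x))" for j
    unfolding mirror_cot_mult_inner[OF regular, symmetric] by (simp add: algebra_simps)
  then show ?thesis
    unfolding angular_op_eq derivative_product by (simp add: sum.distrib sum_distrib_left distrib_left)
qed

lemma refl_sum_diff: "refl_sum (\<lambda>x. f x - g x) x = refl_sum f x - refl_sum g x"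
  by (simp add: refl_sum_def sum_subtractf[symmetric] algebra_simps)

text \<open>By the previous lemmas, the angular operator turns the radial equation for the component of degree
  \<^term>\<open>Suc n\<close> into one for the operator with \<^const>\<open>refl_sum\<close> in place of \<^const>\<open>refl_diff\<close>, which is again injective.\<close>

lemma angular_op_dunkl_component_step:
  assumes previous: "\<And>p. dih_regular k p \<Longrightarrow> (p \<bullet> y) * angular_op (dunkl_component y n) p
      = ((\<i> * p) \<bullet> y) * (real n * dunkl_component y n p + refl_diff (dunkl_component y n) p)"
    and x_regular: "dih_regular k x"
  shows "angular_op (dunkl_component y (Suc n)) x = ((\<i> * x) \<bullet> y) * dunkl_component y n x"
proof -
  let ?E = "dunkl_component y n"
  define h where "h p = ((\<i> * p) \<bullet> y) * ?E p" for p
  have angular_rhs: "angular_op (\<lambda>p. (p \<bullet> y) * ?E p) p = real (Suc n) * h p + refl_sum h p"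
    if p_regular: "dih_regular k p" for p
  proof -
    have "refl_sum h p = ((\<i> * p) \<bullet> y) * refl_diff ?E p
        + (\<Sum>j<2*k. kappa (int j) * (((\<i> * p) \<bullet> y + (\<i> * rfl (int j) p) \<bullet> y) * ?E (rfl (int j) p)))"
      unfolding refl_sum_def refl_diff_def sum_distrib_left sum.distrib[symmetric]
      by (intro sum.cong refl) (simp add: h_def algebra_simps)
    then show ?thesis
      unfolding angular_op_inner_mult[OF p_regular dunkl_component_differentiable] previous[OF p_regular]
      by (simp add: h_def algebra_simps)
  qed
  have "angular_op (dunkl_component y (Suc n)) x - h x = 0"
  proof (rule refl_sum_shift_injective[of "real (Suc n)"])
    fix p assume "p \<in> orbit x"
    with x_regular have p_regular: "dih_regular k p" by (rule dih_regular_orbit)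
    have "real (Suc n) * angular_op (dunkl_component y (Suc n)) p
        + refl_sum (angular_op (dunkl_component y (Suc n))) p = real (Suc n) * h p + refl_sum h p"
      unfolding angular_op_radial[OF dunkl_component_differentiable, symmetric]
        dunkl_component_Suc_radial by (rule angular_rhs[OF p_regular])
    then show "real (Suc n) * (angular_op (dunkl_component y (Suc n)) p - h p)
        + refl_sum (\<lambda>p. angular_op (dunkl_component y (Suc n)) p - h p) p = 0"
      by (simp only: refl_sum_diff right_diff_distrib)
  qed simp
  then show ?thesis by (simp add: h_def)
qed

lemma angular_op_dunkl_component_Suc:
  "dih_regular k x \<Longrightarrow> angular_op (dunkl_component y (Suc n)) x = ((\<i> * x) \<bullet> y) * dunkl_component y n x"
proof (induction n arbitrary: x)
  case 0
  have "angular_op (dunkl_component y 0) p = 0" "refl_diff (dunkl_component y 0) p = 0" for p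
    by (simp_all add: angular_op_eq refl_diff_def)
  then show ?case by (intro angular_op_dunkl_component_step 0) simp
next
  case (Suc n)
  show ?case
    by (rule angular_op_dunkl_component_step[OF _ Suc.prems])
      (simp only: dunkl_component_Suc_radial Suc.IH mult_ac)
qed

lemma dunkl_op_dunkl_component_Suc:
  assumes x_regular: "dih_regular k x"
  shows "dunkl_op k a b e (dunkl_component y (Suc n)) x = (e \<bullet> y) * dunkl_component y n x"
proof (rule linear_complex_eqI[where f = "\<lambda>e. dunkl_op k a b e (dunkl_component y (Suc n)) x" and x = x])
  show "linear (\<lambda>e. dunkl_op k a b e (dunkl_component y (Suc n)) x)"
    by (rule linear_dunkl_op[OF dunkl_component_differentiable])
  show "linear (\<lambda>e. (e \<bullet> y) * dunkl_component y n x)"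
    by (intro linearI) (simp_all add: inner_add_left distrib_right)
  show "x \<noteq> 0"
    using x_regular by (auto simp: dih_regular_iff rfl_def)
  show "dunkl_op k a b x (dunkl_component y (Suc n)) x = (x \<bullet> y) * dunkl_component y n x"
    unfolding dunkl_op_radial[OF x_regular] dunkl_component_Euler by (rule dunkl_component_Suc_radial)
  show "dunkl_op k a b (\<i> * x) (dunkl_component y (Suc n)) x = ((\<i> * x) \<bullet> y) * dunkl_component y n x"
    unfolding angular_op_def[symmetric] by (rule angular_op_dunkl_component_Suc[OF x_regular])
qed

definition dunkl_series :: "complex \<Rightarrow> complex \<Rightarrow> real" where
  "dunkl_series y x = (\<Sum>n. dunkl_component y n x)"

lemma summable_dunkl_component: "summable (\<lambda>n. dunkl_component y n x)"
proof (rule summable_comparison_test[OF _ summable_exp[of "6 * (cmod x * cmod y)"]])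
  show "\<exists>N. \<forall>n\<ge>N. norm (dunkl_component y n x) \<le> inverse (fact n) * (6 * (cmod x * cmod y)) ^ n"
    using abs_dunkl_component_le[of y _ x] by (simp add: field_simps)
qed

lemma dunkl_component_sums: "(\<lambda>n. dunkl_component y n x) sums dunkl_series y x"
  unfolding dunkl_series_def by (rule summable_sums[OF summable_dunkl_component])

lemma dunkl_series_has_derivative:
  shows "summable (\<lambda>n. frechet_derivative (dunkl_component y n) (at x) h)"
    and "(dunkl_series y has_derivative (\<lambda>h. \<Sum>n. frechet_derivative (dunkl_component y n) (at x) h)) (at x)"
proof -
  define R where "R = cmod x + 1"
  let ?B = "\<lambda>n. real n * (6 * cmod y * (6 * (R * cmod y)) ^ (n - 1)) / fact n"
  have "?B (Suc n) = 6 * cmod y * (inverse (fact n) * (6 * (R * cmod y)) ^ n)" for n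
    by (simp add: divide_inverse fact_Suc del: of_nat_Suc)
  then have "summable ?B"
    by (subst summable_Suc_iff[symmetric]) (simp only: summable_mult summable_exp)
  have bound: "norm (frechet_derivative (dunkl_component y n) (at p) h) \<le> ?B n * norm h"
    if "p \<in> ball 0 R" for n p h
    using that abs_frechet_derivative_dunkl_component_le[of p R y n h] by simp
  have "x \<in> ball 0 R" by (simp add: R_def)
  note suminf_rule = has_derivative_suminf[OF convex_ball open_ball this dunkl_component_has_derivative bound
      \<open>summable ?B\<close> summable_dunkl_component]
  show "summable (\<lambda>n. frechet_derivative (dunkl_component y n) (at x) h)"
    by (rule suminf_rule(1))
  show "(dunkl_series y has_derivative (\<lambda>h. \<Sum>n. frechet_derivative (dunkl_component y n) (at x) h)) (at x)"
    unfolding dunkl_series_def[abs_def] by (rule suminf_rule(2))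
qed

lemma dunkl_op_dunkl_series:
  assumes x_regular: "dih_regular k x"
  shows "dunkl_op k a b e (dunkl_series y) x = (e \<bullet> y) * dunkl_series y x"
proof -
  have "frechet_derivative (dunkl_series y) (at x)
      = (\<lambda>h. \<Sum>n. frechet_derivative (dunkl_component y n) (at x) h)"
    by (rule frechet_derivative_at[OF dunkl_series_has_derivative(2), symmetric])
  then have "(\<lambda>n. frechet_derivative (dunkl_component y n) (at x) e) sums
      frechet_derivative (dunkl_series y) (at x) e"
    using dunkl_series_has_derivative(1) by (simp add: summable_sums)
  then have "(\<lambda>n. dunkl_op k a b e (dunkl_component y n) x) sums dunkl_op k a b e (dunkl_series y) x"
    unfolding dunkl_op_eq
    by (intro sums_add sums_sum sums_divide sums_mult sums_diff dunkl_component_sums)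
  moreover have "dunkl_op k a b e (dunkl_component y 0) x = 0"
    by (simp add: dunkl_op_eq)
  ultimately have "(\<lambda>n. (e \<bullet> y) * dunkl_component y n x) sums dunkl_op k a b e (dunkl_series y) x"
    using sums_Suc_iff[of "\<lambda>n. dunkl_op k a b e (dunkl_component y n) x" "dunkl_op k a b e (dunkl_series y) x"]
    by (simp add: dunkl_op_dunkl_component_Suc[OF x_regular])
  moreover have "(\<lambda>n. (e \<bullet> y) * dunkl_component y n x) sums ((e \<bullet> y) * dunkl_series y x)"
    by (intro sums_mult dunkl_component_sums)
  ultimately show ?thesis by (rule sums_unique2)
qed

lemma dunkl_kernel_eq_dunkl_series: "dunkl_kernel k a b x y = dunkl_series y x"
proof (rule dunkl_kernel_eqI)
  show "dunkl_series y 0 = 1"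
    unfolding dunkl_series_def dunkl_component_at_0 by (subst suminf_finite[of "{0}"]) auto
  have "dunkl_series y differentiable (at p)" for p
    using dunkl_series_has_derivative(2) by (rule differentiableI)
  then show "dunkl_eigen y (dunkl_series y)"
    by (simp add: dunkl_eigen_def dunkl_op_dunkl_series)
qed

end

section \<open>The Poisson kernel and roots of unity\<close>

definition poisson_denom :: "real \<Rightarrow> real \<Rightarrow> real" where
  "poisson_denom r c = 1 - 2 * r * c + r\<^sup>2"

definition poisson_subst :: "real \<Rightarrow> real" where
  "poisson_subst r = 2 * r / (1 + r\<^sup>2)"

definition poisson_subst' :: "real \<Rightarrow> real" where
  "poisson_subst' r = 2 * (1 - r\<^sup>2) / (1 + r\<^sup>2)\<^sup>2"

lemma poisson_denom_ge:
  assumes "\<bar>c\<bar> \<le> 1"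
  shows "(1 - \<bar>r\<bar>)\<^sup>2 \<le> poisson_denom r c"
proof -
  have "r * c \<le> \<bar>r\<bar> * \<bar>c\<bar>" by (simp add: abs_mult[symmetric])
  also have "\<dots> \<le> \<bar>r\<bar> * 1" using assms by (intro mult_left_mono) auto
  finally show ?thesis by (simp add: poisson_denom_def power2_diff)
qed

lemma poisson_denom_pos: "\<bar>c\<bar> \<le> 1 \<Longrightarrow> \<bar>r\<bar> < 1 \<Longrightarrow> 0 < poisson_denom r c"
  using poisson_denom_ge[of c r] zero_less_power[of "1 - \<bar>r\<bar>" 2] by linarith

lemma one_plus_power2_pos: "0 < 1 + (r::real)\<^sup>2"
  by (simp add: add_pos_nonneg)

lemma one_minus_poisson_subst_mult: "1 - poisson_subst r * c = poisson_denom r c / (1 + r\<^sup>2)"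
  using one_plus_power2_pos[of r] by (simp add: poisson_subst_def poisson_denom_def field_simps)

lemma poisson_subst_mult_less_1: "\<bar>c\<bar> \<le> 1 \<Longrightarrow> \<bar>r\<bar> < 1 \<Longrightarrow> poisson_subst r * c < 1"
  using one_minus_poisson_subst_mult[of r c] divide_pos_pos[OF poisson_denom_pos[of c r] one_plus_power2_pos[of r]]
  by simp

lemma abs_poisson_subst_less_1: "\<bar>r\<bar> < 1 \<Longrightarrow> \<bar>poisson_subst r\<bar> < 1"
  using poisson_subst_mult_less_1[of 1 r] poisson_subst_mult_less_1[of "- 1" r] by linarith

lemma abs_poisson_subst_le: "\<bar>poisson_subst r\<bar> \<le> 2 * \<bar>r\<bar>"
proof -
  have "2 * \<bar>r\<bar> / (1 + r\<^sup>2) \<le> 2 * \<bar>r\<bar> / 1" by (intro frac_le) auto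
  then show ?thesis by (simp add: poisson_subst_def abs_mult abs_divide)
qed

lemma poisson_subst_pos: "0 < r \<Longrightarrow> 0 < poisson_subst r"
  unfolding poisson_subst_def by (intro divide_pos_pos one_plus_power2_pos) simp

lemma poisson_subst_has_derivative: "(poisson_subst has_real_derivative poisson_subst' r) (at r)"
  using one_plus_power2_pos[of r] unfolding poisson_subst_def[abs_def] poisson_subst'_def
  by (auto intro!: derivative_eq_intros simp: field_simps power2_eq_square)

lemma poisson_subst_mult_eqI:
  assumes "r * (1 + r\<^sup>2) * A = (1 - r\<^sup>2) * B"
  shows "poisson_subst r * A = poisson_subst' r * B"
proof -
  have "poisson_subst r * A = 2 / (1 + r\<^sup>2)\<^sup>2 * (r * (1 + r\<^sup>2) * A)"
    using one_plus_power2_pos[of r] by (simp add: poisson_subst_def power2_eq_square)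
  also have "\<dots> = poisson_subst' r * B"
    unfolding assms by (simp add: poisson_subst'_def)
  finally show ?thesis .
qed

lemma poisson_subst'_bounds:
  assumes "\<bar>r\<bar> \<le> 1"
  shows "0 \<le> poisson_subst' r" "poisson_subst' r \<le> 2"
proof -
  have "r\<^sup>2 \<le> 1" using assms by (simp add: abs_square_le_1)
  moreover have "1 \<le> (1 + r\<^sup>2)\<^sup>2" by (rule one_le_power) simp
  ultimately show "0 \<le> poisson_subst' r"
    unfolding poisson_subst'_def by (intro divide_nonneg_nonneg) auto
  have "2 * (1 - r\<^sup>2) / (1 + r\<^sup>2)\<^sup>2 \<le> 2 / 1"
    using \<open>1 \<le> (1 + r\<^sup>2)\<^sup>2\<close> by (intro frac_le) auto
  then show "poisson_subst' r \<le> 2" by (simp add: poisson_subst'_def)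
qed

lemma norm_one_minus_power2:
  assumes "cmod u = 1"
  shows "(cmod (1 - of_real r * u))\<^sup>2 = poisson_denom r (Re u)"
proof -
  have "(cmod (1 - of_real r * u))\<^sup>2 = 1 - 2 * r * Re u + r\<^sup>2 * ((Re u)\<^sup>2 + (Im u)\<^sup>2)"
    unfolding cmod_power2 by (simp add: power2_eq_square algebra_simps)
  also have "(Re u)\<^sup>2 + (Im u)\<^sup>2 = 1"
    using assms cmod_power2[of u] by simp
  finally show ?thesis by (simp add: poisson_denom_def)
qed

lemma poisson_denom_unit_pos: "cmod u = 1 \<Longrightarrow> \<bar>r\<bar> < 1 \<Longrightarrow> 0 < poisson_denom r (Re u)"
  using abs_Re_le_cmod[of u] by (intro poisson_denom_pos) auto

lemma poisson_kernel_eq: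
  assumes norm_u: "cmod u = 1" and abs_r: "\<bar>r\<bar> < 1"
  shows "2 * Re (1 / (1 - of_real r * u)) - 1 = (1 - r\<^sup>2) / poisson_denom r (Re u)"
proof -
  have "Re (1 / (1 - of_real r * u)) = (1 - r * Re u) / poisson_denom r (Re u)"
    unfolding norm_one_minus_power2[OF norm_u, symmetric] by (simp add: Re_divide cmod_power2)
  then show ?thesis
    using poisson_denom_unit_pos[OF norm_u abs_r] by (simp add: field_simps poisson_denom_def)
qed

lemma cis_root_unity_power: "0 < n \<Longrightarrow> cis (2 * pi * real i / real n) ^ n = 1"
  by (simp add: Complex.DeMoivre cis_multiple_2pi)

lemma sum_powers_cis_root_unity:
  assumes "m < n"
  shows "(\<Sum>i<n. cis (2 * pi * real m / real n) ^ i) = (if m = 0 then of_nat n else 0)"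
proof (cases "m = 0")
  case False
  have n_pos: "0 < n" using assms by simp
  have "cis (2 * pi * real m / real n) \<noteq> cis (2 * pi * real 0 / real n)"
    using inj_onD[OF bij_betw_imp_inj_on[OF Complex.bij_betw_roots_unity[OF n_pos]], of m 0] assms False by auto
  then show ?thesis
    using geometric_sum[of "cis (2 * pi * real m / real n)" n] False
    by (simp add: cis_root_unity_power[OF n_pos])
qed simp

lemma sum_inverse_one_minus_roots_unity:
  assumes n_pos: "0 < n" and norm_z: "cmod z < 1"
  shows "(\<Sum>i<n. 1 / (1 - z * cis (2 * pi * real i / real n))) = of_nat n / (1 - z ^ n)"
proof -
  let ?w = "\<lambda>i. cis (2 * pi * real i / real n)"
  have nonzero: "1 - z ^ n \<noteq> 0"
    using norm_z n_pos power_less_one_iff[of "cmod z" n] by (auto simp: norm_power[symmetric])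
  have "1 / (1 - z * ?w i) = (\<Sum>m<n. z ^ m * ?w m ^ i) / (1 - z ^ n)" for i
  proof -
    have "?w i ^ m = ?w m ^ i" for m by (simp add: Complex.DeMoivre mult_ac)
    moreover have "1 - (z * ?w i) ^ n = (1 - z * ?w i) * (\<Sum>m<n. (z * ?w i) ^ m)"
      by (rule one_diff_power_eq)
    ultimately have "1 - z ^ n = (1 - z * ?w i) * (\<Sum>m<n. z ^ m * ?w m ^ i)"
      by (simp add: power_mult_distrib cis_root_unity_power[OF n_pos])
    with nonzero show ?thesis by (auto simp: field_simps)
  qed
  then have "(\<Sum>i<n. 1 / (1 - z * ?w i)) = (\<Sum>i<n. \<Sum>m<n. z ^ m * ?w m ^ i) / (1 - z ^ n)"
    by (simp only: sum_divide_distrib)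
  also have "(\<Sum>i<n. \<Sum>m<n. z ^ m * ?w m ^ i) = (\<Sum>m<n. z ^ m * (\<Sum>i<n. ?w m ^ i))"
    by (subst sum.swap) (simp add: sum_distrib_left)
  also have "\<dots> = (\<Sum>m<n. if m = 0 then of_nat n else 0)"
    by (intro sum.cong) (auto simp: sum_powers_cis_root_unity)
  also have "\<dots> = of_nat n" using n_pos by simp
  finally show ?thesis .
qed

lemma prod_one_minus_roots_unity:
  assumes n_pos: "0 < n"
  shows "(\<Prod>i<n. 1 - z * cis (2 * pi * real i / real n)) = 1 - z ^ n"
proof -
  define p q :: "complex poly" where "p = (\<Prod>i<n. [:1, - cis (2 * pi * real i / real n):])"
    and "q = 1 - monom 1 n"
  have p_eval: "poly p x = (\<Prod>i<n. 1 - x * cis (2 * pi * real i / real n))"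
    and q_eval: "poly q x = 1 - x ^ n" for x
    by (simp_all add: p_def q_def poly_prod poly_monom)
  let ?A = "insert 0 {x::complex. x ^ n = 1}"
  have "card ?A = Suc n"
    using n_pos finite_roots_unity[of n, where 'a = complex]
    by (subst card_insert_disjoint) (auto simp: card_roots_unity_eq power_0_left)
  moreover have "degree p \<le> n"
    unfolding p_def using degree_prod_sum_le[of "{..<n}" "\<lambda>i. [:1, - cis (2 * pi * real i / real n):]"] by simp
  moreover have "degree q \<le> n"
    unfolding q_def by (intro degree_diff_le) (simp_all add: degree_monom_le)
  moreover have "poly p x = poly q x" if "x \<in> ?A" for x
  proof (cases "x = 0")
    case False
    with that have x_root: "x ^ n = 1" by simp
    then have "1 / x \<in> {x. x ^ n = 1}" by (simp add: power_divide)
    then obtain i where "i < n" "1 / x = cis (2 * pi * real i / real n)"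
      using bij_betw_imp_surj_on[OF Complex.bij_betw_roots_unity[OF n_pos]] by (auto simp: set_eq_iff image_iff)
    with False have "1 - x * cis (2 * pi * real i / real n) = 0"
      by (metis diff_self nonzero_mult_div_cancel_left times_divide_eq_right mult.right_neutral)
    with \<open>i < n\<close> x_root show ?thesis by (auto simp: p_eval q_eval)
  qed (use n_pos in \<open>simp add: p_eval q_eval\<close>)
  ultimately have "p = q"
    by (intro poly_eqI_degree[of ?A]) auto
  then have "poly p z = poly q z" by simp
  then show ?thesis by (simp only: p_eval q_eval)
qed

lemma sum_poisson_roots_unity:
  assumes n_pos: "0 < n" and norm_u: "cmod u = 1" and abs_r: "\<bar>r\<bar> < 1"
  shows "(\<Sum>i<n. 1 / (1 - poisson_subst r * Re (u * cis (2 * pi * real i / real n))))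
    = real n * (1 + r\<^sup>2) * (1 - (r ^ n)\<^sup>2) / ((1 - r\<^sup>2) * poisson_denom (r ^ n) (Re (u ^ n)))"
proof -
  let ?w = "\<lambda>i. cis (2 * pi * real i / real n)"
  have unit: "cmod (u * ?w i) = 1" for i using norm_u by (simp add: norm_mult)
  have "0 < 1 - r\<^sup>2" using abs_r by (simp add: abs_square_less_1)
  have "1 / (1 - poisson_subst r * Re (u * ?w i))
      = (1 + r\<^sup>2) / (1 - r\<^sup>2) * (2 * Re (1 / (1 - of_real r * u * ?w i)) - 1)" for i
    unfolding one_minus_poisson_subst_mult
    using poisson_kernel_eq[OF unit abs_r, of i] \<open>0 < 1 - r\<^sup>2\<close> by (simp add: mult.assoc)
  then have "(\<Sum>i<n. 1 / (1 - poisson_subst r * Re (u * ?w i)))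
      = (1 + r\<^sup>2) / (1 - r\<^sup>2) * (2 * Re (\<Sum>i<n. 1 / (1 - of_real r * u * ?w i)) - real n)"
    by (simp only: sum_distrib_left[symmetric] sum_subtractf Re_sum) simp
  also have "(\<Sum>i<n. 1 / (1 - of_real r * u * ?w i)) = of_nat n * (1 / (1 - of_real (r ^ n) * u ^ n))"
    using sum_inverse_one_minus_roots_unity[OF n_pos, of "of_real r * u"] abs_r norm_u
    by (simp add: norm_mult power_mult_distrib)
  also have "2 * Re (of_nat n * (1 / (1 - of_real (r ^ n) * u ^ n))) - real n
      = real n * (2 * Re (1 / (1 - of_real (r ^ n) * u ^ n)) - 1)"
  proof -
    have "2 * Re (of_nat n * z) - real n = real n * (2 * Re z - 1)" for z :: complex
      by (simp add: algebra_simps)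
    then show ?thesis .
  qed
  also have "\<dots> = real n * ((1 - (r ^ n)\<^sup>2) / poisson_denom (r ^ n) (Re (u ^ n)))"
    using norm_u abs_r n_pos by (subst poisson_kernel_eq) (simp_all add: norm_power power_abs power_less_one_iff)
  finally show ?thesis by simp
qed

lemma prod_poisson_roots_unity:
  assumes n_pos: "0 < n" and norm_u: "cmod u = 1"
  shows "(\<Prod>i<n. 1 - poisson_subst r * Re (u * cis (2 * pi * real i / real n)))
    = poisson_denom (r ^ n) (Re (u ^ n)) / (1 + r\<^sup>2) ^ n"
proof -
  let ?w = "\<lambda>i. cis (2 * pi * real i / real n)"
  have unit: "cmod (u * ?w i) = 1" for i using norm_u by (simp add: norm_mult)
  have "1 - poisson_subst r * Re (u * ?w i) = (cmod (1 - of_real r * u * ?w i))\<^sup>2 / (1 + r\<^sup>2)" for i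
    unfolding one_minus_poisson_subst_mult norm_one_minus_power2[OF unit, symmetric] by (simp only: mult.assoc)
  then have "(\<Prod>i<n. 1 - poisson_subst r * Re (u * ?w i))
      = (cmod (\<Prod>i<n. 1 - of_real r * u * ?w i))\<^sup>2 / (1 + r\<^sup>2) ^ n"
    by (simp only: prod_dividef prod_constant card_lessThan prod_norm prod_power_distrib[symmetric])
  also have "(\<Prod>i<n. 1 - of_real r * u * ?w i) = 1 - of_real (r ^ n) * u ^ n"
    by (simp add: prod_one_minus_roots_unity[OF n_pos] power_mult_distrib)
  finally show ?thesis
    using norm_u by (simp only: norm_one_minus_power2 norm_power power_one)
qed

lemma root_unity_mult_cis:
  "Re (cis (- (\<theta> / real n)) * cis (2 * pi * real j / real n)) = cos ((\<theta> - 2 * real j * pi) / real n)"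
proof -
  have "cis (- (\<theta> / real n)) * cis (2 * pi * real j / real n) = cis (- ((\<theta> - 2 * real j * pi) / real n))"
    by (simp add: cis_mult diff_divide_distrib mult_ac)
  then show ?thesis by simp
qed

lemma Re_cis_divide_power: "0 < n \<Longrightarrow> Re (cis (- (\<theta> / real n)) ^ n) = cos \<theta>"
  by (simp add: Complex.DeMoivre)

lemma sum_poisson_cos:
  assumes n_pos: "0 < n" and abs_r: "\<bar>r\<bar> < 1"
  shows "(\<Sum>j<n. 1 / (1 - poisson_subst r * cos ((\<theta> - 2 * real j * pi) / real n)))
    = real n * (1 + r\<^sup>2) * (1 - (r ^ n)\<^sup>2) / ((1 - r\<^sup>2) * poisson_denom (r ^ n) (cos \<theta>))"
  using sum_poisson_roots_unity[OF n_pos norm_cis abs_r, of "- (\<theta> / real n)"]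
  unfolding root_unity_mult_cis Re_cis_divide_power[OF n_pos] .

lemma prod_poisson_cos:
  assumes n_pos: "0 < n"
  shows "(\<Prod>j<n. 1 - poisson_subst r * cos ((\<theta> - 2 * real j * pi) / real n))
    = poisson_denom (r ^ n) (cos \<theta>) / (1 + r\<^sup>2) ^ n"
  using prod_poisson_roots_unity[OF n_pos norm_cis, of r "- (\<theta> / real n)"]
  unfolding root_unity_mult_cis Re_cis_divide_power[OF n_pos] .

section \<open>The measures on the interval\<close>

lemma abs_difference_quotient_le:
  fixes f f' :: "real \<Rightarrow> real"
  assumes deriv: "\<And>R. \<bar>R - R0\<bar> < d \<Longrightarrow> (f has_real_derivative f' R) (at R) \<and> \<bar>f' R\<bar> \<le> B"
    and h_small: "h \<noteq> 0" "\<bar>h\<bar> < d"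
  shows "\<bar>(f (R0 + h) - f R0) / h\<bar> \<le> B"
proof -
  have "norm (f (R0 + h) - f R0) \<le> B * norm (R0 + h - R0)"
  proof (rule field_differentiable_bound[where S = "ball R0 d"])
    fix R assume "R \<in> ball R0 d"
    then have "\<bar>R - R0\<bar> < d" by (simp add: dist_real_def abs_minus_commute)
    from deriv[OF this] show "(f has_field_derivative f' R) (at R within ball R0 d)" "norm (f' R) \<le> B"
      by (simp_all add: has_field_derivative_at_within)
  qed (use h_small in \<open>auto simp: dist_real_def\<close>)
  then show ?thesis using h_small by (simp add: abs_divide divide_le_eq)
qed

lemma (in finite_measure) LINT_bounded_convergence_at_0:
  fixes g :: "real \<Rightarrow> 'a \<Rightarrow> real"
  assumes "0 < d" and g_meas: "\<And>h. h \<noteq> 0 \<Longrightarrow> \<bar>h\<bar> < d \<Longrightarrow> g h \<in> borel_measurable M"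
    and G_meas: "G \<in> borel_measurable M" and lim: "AE w in M. (\<lambda>h. g h w) \<midarrow>0\<rightarrow> G w"
    and bound: "\<And>h. h \<noteq> 0 \<Longrightarrow> \<bar>h\<bar> < d \<Longrightarrow> AE w in M. \<bar>g h w\<bar> \<le> B"
  shows "(\<lambda>h. LINT w|M. g h w) \<midarrow>0\<rightarrow> (LINT w|M. G w)"
  unfolding tendsto_at_iff_sequentially
proof (intro allI impI)
  fix X :: "nat \<Rightarrow> real"
  assume nonzero: "\<forall>i. X i \<in> UNIV - {0}" and X_lim: "X \<longlonglongrightarrow> 0"
  from X_lim \<open>0 < d\<close> have "\<forall>\<^sub>F i in sequentially. \<bar>X i\<bar> < d"
    by (auto simp: tendsto_iff dist_real_def)
  then obtain N where "\<And>i. N \<le> i \<Longrightarrow> \<bar>X i\<bar> < d"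
    by (auto simp: eventually_sequentially)
  then have small: "\<bar>X (i + N)\<bar> < d" for i by simp
  have tail_lim: "(\<lambda>i. X (i + N)) \<longlonglongrightarrow> 0"
    using X_lim by (rule LIMSEQ_ignore_initial_segment)
  have "(\<lambda>i. LINT w|M. g (X (i + N)) w) \<longlonglongrightarrow> (LINT w|M. G w)"
  proof (rule integral_dominated_convergence[where w = "\<lambda>_. B"])
    show "AE w in M. (\<lambda>i. g (X (i + N)) w) \<longlonglongrightarrow> G w"
      using lim
    proof (rule eventually_mono)
      fix w assume "(\<lambda>h. g h w) \<midarrow>0\<rightarrow> G w"
      then show "(\<lambda>i. g (X (i + N)) w) \<longlonglongrightarrow> G w"
        using nonzero tail_lim unfolding tendsto_at_iff_sequentially
        by (auto simp: comp_def dest: spec[of _ "\<lambda>i. X (i + N)"])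
    qed
  qed (use nonzero small g_meas G_meas bound in auto)
  then show "((\<lambda>h. LINT w|M. g h w) \<circ> X) \<longlonglongrightarrow> (LINT w|M. G w)"
    unfolding comp_def by (rule LIMSEQ_offset)
qed

lemma (in finite_measure) has_real_derivative_LINT:
  fixes f f' :: "real \<Rightarrow> 'a \<Rightarrow> real"
  assumes "0 < d" and integrable: "\<And>R. \<bar>R - R0\<bar> < d \<Longrightarrow> integrable M (f R)"
    and f'_meas: "f' R0 \<in> borel_measurable M"
    and deriv: "AE w in M. \<forall>R. \<bar>R - R0\<bar> < d \<longrightarrow>
      ((\<lambda>R. f R w) has_real_derivative f' R w) (at R) \<and> \<bar>f' R w\<bar> \<le> B"
  shows "((\<lambda>R. LINT w|M. f R w) has_real_derivative (LINT w|M. f' R0 w)) (at R0)"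
proof -
  let ?q = "\<lambda>h w. (f (R0 + h) w - f R0 w) / h"
  have int: "integrable M (f (R0 + h))" "integrable M (f R0)" if "\<bar>h\<bar> < d" for h
    using that \<open>0 < d\<close> by (auto intro!: integrable)
  have "(\<lambda>h. LINT w|M. ?q h w) \<midarrow>0\<rightarrow> (LINT w|M. f' R0 w)"
  proof (rule LINT_bounded_convergence_at_0[OF \<open>0 < d\<close> _ f'_meas])
    show "?q h \<in> borel_measurable M" if "\<bar>h\<bar> < d" for h
      using int[OF that] by measurable
    show "AE w in M. (\<lambda>h. ?q h w) \<midarrow>0\<rightarrow> f' R0 w"
      using deriv by (rule eventually_mono) (use \<open>0 < d\<close> in \<open>auto simp: DERIV_def\<close>)
    show "AE w in M. \<bar>?q h w\<bar> \<le> B" if "h \<noteq> 0" "\<bar>h\<bar> < d" for h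
      using deriv
    proof (rule eventually_mono)
      fix w assume "\<forall>R. \<bar>R - R0\<bar> < d \<longrightarrow> ((\<lambda>R. f R w) has_real_derivative f' R w) (at R) \<and> \<bar>f' R w\<bar> \<le> B"
      then show "\<bar>?q h w\<bar> \<le> B"
        using abs_difference_quotient_le[of R0 d "\<lambda>R. f R w" "\<lambda>R. f' R w" B h] that by simp
    qed
  qed
  moreover have "(LINT w|M. ?q h w) = ((LINT w|M. f (R0 + h) w) - (LINT w|M. f R0 w)) / h" if "\<bar>h\<bar> < d" for h
    by (simp add: Bochner_Integration.integral_diff[OF int[OF that]])
  then have "\<forall>\<^sub>F h in at 0. (LINT w|M. ?q h w) = ((LINT w|M. f (R0 + h) w) - (LINT w|M. f R0 w)) / h"
    unfolding eventually_at using \<open>0 < d\<close> by (intro exI[of _ d]) (auto simp: dist_real_def)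
  ultimately show ?thesis
    unfolding DERIV_def by (rule Lim_transform_eventually)
qed

lemma has_integral_one_minus_power2_powr:
  fixes a :: real
  assumes "0 < a"
  shows "((\<lambda>u. (1 - u\<^sup>2) powr (a - 1)) has_integral (2 * 4 powr (a - 1) * Beta a a)) {-1..1}"
proof -
  let ?x = "\<lambda>u::real. (1/2) *\<^sub>R u + 1/2"
  have "((\<lambda>u. ?x u powr (a - 1) * (1 - ?x u) powr (a - 1)) has_integral (Beta a a /\<^sub>R (1/2) ^ DIM(real)))
      (cbox ((0 - 1/2) /\<^sub>R (1/2)) ((1 - 1/2) /\<^sub>R (1/2)))"
    using has_integral_Beta_real[OF assms assms] by (intro has_integral_affinity') auto
  then have "((\<lambda>u. 4 powr (a - 1) * (?x u powr (a - 1) * (1 - ?x u) powr (a - 1))) has_integral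
      (4 powr (a - 1) * (2 * Beta a a))) {-1..1}"
    by (intro has_integral_mult_right) (simp add: mult.commute)
  moreover have "4 powr (a - 1) * (?x u powr (a - 1) * (1 - ?x u) powr (a - 1)) = (1 - u\<^sup>2) powr (a - 1)"
    if "u \<in> {-1..1}" for u
  proof -
    have "4 powr (a - 1) * (?x u powr (a - 1) * (1 - ?x u) powr (a - 1)) = (4 * (?x u * (1 - ?x u))) powr (a - 1)"
      using that by (subst powr_mult, simp, simp, subst powr_mult) auto
    also have "4 * (?x u * (1 - ?x u)) = 1 - u\<^sup>2"
      by (simp add: field_simps power2_eq_square)
    finally show ?thesis .
  qed
  ultimately show ?thesis
    by (subst has_integral_cong[symmetric]) (auto simp: mult_ac)
qed

lemma Gamma_legendre_duplication_real:
  assumes "0 < (a::real)"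
  shows "Gamma a * Gamma (a + 1/2) = 2 powr (1 - 2 * a) * sqrt pi * Gamma (2 * a)"
proof -
  have "complex_of_real a \<notin> \<int>\<^sub>\<le>\<^sub>0" "complex_of_real a + 1/2 \<notin> \<int>\<^sub>\<le>\<^sub>0"
    using assms by (auto elim!: nonpos_Ints_cases simp: complex_eq_iff)
  from Gamma_legendre_duplication[OF this]
  have "complex_of_real (Gamma a * Gamma (a + 1/2))
      = complex_of_real (exp ((1 - 2 * a) * ln 2) * sqrt pi * Gamma (2 * a))"
    by (simp add: Gamma_complex_of_real[symmetric] exp_of_real[symmetric])
  then show ?thesis by (simp only: of_real_eq_iff powr_def) simp
qed

lemma nu_density_has_integral:
  assumes a_pos: "0 < a"
  shows "(nu_density a has_integral 1) {-1..1}"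
proof -
  have "(4::real) powr (a - 1) = 2 powr (2 * a - 2)"
    using powr_powr[of 2 2 "a - 1"] by (simp add: algebra_simps)
  then have powers: "2 * 4 powr (a - 1) * 2 powr (1 - 2 * a) = (1::real)"
    using powr_add[of "2::real" "2 * a - 2" "1 - 2 * a"] by (simp add: powr_minus)
  have pos: "0 < Gamma a" "0 < Gamma (2 * a)" "0 < sqrt pi"
    using a_pos by auto
  define K where "K = Gamma (a + 1/2) / (sqrt pi * Gamma a)"
  have "K * (2 * 4 powr (a - 1) * Beta a a)
      = (Gamma a * Gamma (a + 1/2)) * (2 * 4 powr (a - 1)) / (sqrt pi * Gamma (2 * a))"
    using pos by (simp add: K_def Beta_def field_simps)
  also have "\<dots> = 2 * 4 powr (a - 1) * 2 powr (1 - 2 * a)"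
    unfolding Gamma_legendre_duplication_real[OF a_pos] using pos by (simp add: field_simps)
  finally have "K * (2 * 4 powr (a - 1) * Beta a a) = 1"
    by (simp only: powers)
  with has_integral_mult_right[OF has_integral_one_minus_power2_powr[OF a_pos], of K] show ?thesis
    unfolding nu_density_def[abs_def] K_def[symmetric] by (simp only:)
qed

definition nu_measure :: "real \<Rightarrow> real measure" where
  "nu_measure a = density lborel (\<lambda>u. ennreal (indicator {-1..1} u * nu_density a u))"

lemma nu_density_measurable [measurable]: "nu_density a \<in> borel_measurable borel"
  unfolding nu_density_def[abs_def] by measurable

lemma nu_density_nonneg: "0 < a \<Longrightarrow> 0 \<le> nu_density a u"
  by (simp add: nu_density_def)

lemma sets_nu_measure [measurable_cong, simp]: "sets (nu_measure a) = sets borel"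
  by (simp add: nu_measure_def)

lemma space_nu_measure [simp]: "space (nu_measure a) = UNIV"
  by (simp add: nu_measure_def)

lemma emeasure_nu_measure:
  assumes "0 < a"
  shows "emeasure (nu_measure a) UNIV = 1"
proof -
  have "emeasure (nu_measure a) UNIV = (\<integral>\<^sup>+u. ennreal (indicator {-1..1} u * nu_density a u) \<partial>lborel)"
    by (simp add: nu_measure_def emeasure_density)
  also have "\<dots> = 1"
    using nn_integral_has_integral_lebesgue[OF _ nu_density_has_integral[OF assms]] nu_density_nonneg[OF assms]
    by simp
  finally show ?thesis .
qed

lemma finite_measure_nu_measure: "0 < a \<Longrightarrow> finite_measure (nu_measure a)"
  by (intro finite_measureI) (simp add: emeasure_nu_measure)

lemma AE_nu_measure: "AE u in nu_measure a. u \<in> {-1..1}"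
  unfolding nu_measure_def by (subst AE_density) (auto simp: indicator_def)

lemma LINT_nu_measure:
  fixes f :: "real \<Rightarrow> real"
  assumes "0 < a" and [measurable]: "f \<in> borel_measurable borel"
  shows "(LINT u|nu_measure a. f u) = (LINT u:{-1..1}|lborel. nu_density a u * f u)"
  unfolding nu_measure_def set_lebesgue_integral_def using nu_density_nonneg[OF \<open>0 < a\<close>]
  by (subst integral_density) (auto simp: mult_ac)

lemma integrable_nu_measure:
  fixes f :: "real \<Rightarrow> real"
  assumes "0 < a" and meas: "f \<in> borel_measurable borel" and bound: "\<And>u. u \<in> {-1..1} \<Longrightarrow> \<bar>f u\<bar> \<le> B"
  shows "integrable (nu_measure a) f"
proof -
  interpret finite_measure "nu_measure a" by (rule finite_measure_nu_measure[OF \<open>0 < a\<close>])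
  show ?thesis
  proof (rule integrable_const_bound[where B = B])
    show "AE u in nu_measure a. norm (f u) \<le> B"
      using AE_nu_measure[of a] by (rule eventually_mono) (use bound in auto)
  qed (use meas in simp)
qed

lemma distr_nu_measure_uminus: "distr (nu_measure a) borel uminus = nu_measure a"
proof -
  let ?f = "\<lambda>u. ennreal (indicator {-1..1} u * nu_density a u)"
  have "?f \<circ> uminus = ?f"
    by (auto simp: fun_eq_iff indicator_def nu_density_def)
  then have "distr (nu_measure a) borel uminus = distr (density lborel (?f \<circ> uminus)) borel uminus"
    by (simp add: nu_measure_def)
  also have "\<dots> = density (distr lborel borel uminus) ?f"
    by (subst density_distr) (auto simp: comp_def)
  also have "\<dots> = nu_measure a"
    unfolding lborel_distr_uminus nu_measure_def ..
  finally show ?thesis .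
qed

lemma LINT_nu_measure_id: "(LINT u|nu_measure a. u) = 0"
proof -
  have "(LINT u|nu_measure a. u) = (LINT u|distr (nu_measure a) borel uminus. u)"
    by (simp only: distr_nu_measure_uminus)
  also have "\<dots> = (LINT u|nu_measure a. - u)"
    by (rule integral_distr) auto
  finally show ?thesis by simp
qed

lemma nu_density_by_parts_has_integral:
  fixes f f' :: "real \<Rightarrow> real"
  assumes a_pos: "0 < a" and deriv: "\<And>u. u \<in> {-1..1} \<Longrightarrow> (f has_real_derivative f' u) (at u)"
  shows "((\<lambda>u. nu_density a u * (- 2 * a * u * f u + (1 - u\<^sup>2) * f' u)) has_integral 0) {-1..1}"
proof -
  define K where "K = Gamma (a + 1/2) / (sqrt pi * Gamma a)"
  have "((\<lambda>u. nu_density a u * (- 2 * a * u * f u + (1 - u\<^sup>2) * f' u)) has_integral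
      (K * ((1 - 1\<^sup>2) powr a * f 1) - K * ((1 - (-1)\<^sup>2) powr a * f (-1)))) {-1..1}"
  proof (rule fundamental_theorem_of_calculus_interior)
    have "continuous_on {-1..1} f"
      using deriv by (meson DERIV_continuous_on has_field_derivative_at_within)
    moreover have "continuous_on {-1..1} (\<lambda>u::real. (1 - u\<^sup>2) powr a)"
      using a_pos by (intro continuous_on_powr') (auto intro!: continuous_intros simp: abs_square_le_1 abs_le_iff)
    ultimately show "continuous_on {-1..1} (\<lambda>u. K * ((1 - u\<^sup>2) powr a * f u))"
      by (intro continuous_on_mult continuous_on_const)
    fix u :: real assume u_in: "u \<in> {-1<..<1}"
    then have pos: "0 < 1 - u\<^sup>2" by (simp add: abs_square_less_1 abs_less_iff)
    have "((\<lambda>u. K * ((1 - u\<^sup>2) powr a * f u)) has_real_derivative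
        K * ((a * (1 - u\<^sup>2) powr (a - 1) * (- (2 * u))) * f u + (1 - u\<^sup>2) powr a * f' u)) (at u)"
      using pos u_in deriv[of u] by (auto intro!: derivative_eq_intros simp: powr_diff field_simps)
    also have "(1 - u\<^sup>2) powr a = (1 - u\<^sup>2) powr (a - 1) * (1 - u\<^sup>2)"
      using pos by (simp add: powr_diff)
    also have "K * ((a * (1 - u\<^sup>2) powr (a - 1) * (- (2 * u))) * f u + (1 - u\<^sup>2) powr (a - 1) * (1 - u\<^sup>2) * f' u)
        = nu_density a u * (- 2 * a * u * f u + (1 - u\<^sup>2) * f' u)"
      unfolding nu_density_def K_def[symmetric] by (simp add: algebra_simps)
    finally show "((\<lambda>u. K * ((1 - u\<^sup>2) powr a * f u)) has_vector_derivative
        nu_density a u * (- 2 * a * u * f u + (1 - u\<^sup>2) * f' u)) (at u)"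
      by (simp add: has_real_derivative_iff_has_vector_derivative)
  qed simp
  then show ?thesis by simp
qed

lemma LINT_nu_measure_by_parts:
  fixes f f' :: "real \<Rightarrow> real"
  assumes a_pos: "0 < a" and [measurable]: "f \<in> borel_measurable borel" "f' \<in> borel_measurable borel"
    and deriv: "\<And>u. u \<in> {-1..1} \<Longrightarrow> (f has_real_derivative f' u) (at u)"
    and cont': "continuous_on {-1..1} f'"
  shows "(LINT u|nu_measure a. - 2 * a * u * f u + (1 - u\<^sup>2) * f' u) = 0"
proof -
  define g where "g u = - 2 * a * u * f u + (1 - u\<^sup>2) * f' u" for u
  have [measurable]: "g \<in> borel_measurable borel" unfolding g_def[abs_def] by measurable
  have "continuous_on {-1..1} f"
    using deriv by (meson DERIV_continuous_on has_field_derivative_at_within)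
  then have "continuous_on {-1..1} g"
    unfolding g_def by (intro continuous_intros cont')
  then have "bounded (g ` {-1..1})"
    by (intro compact_imp_bounded compact_continuous_image) auto
  then obtain B where "\<forall>y\<in>g ` {-1..1}. norm y \<le> B" unfolding bounded_iff by blast
  then have "integrable (nu_measure a) g"
    by (intro integrable_nu_measure[OF a_pos, where B = B]) auto
  then have "set_integrable lborel {-1..1} (\<lambda>u. nu_density a u * g u)"
    unfolding nu_measure_def set_integrable_def using nu_density_nonneg[OF a_pos]
    by (subst (asm) integrable_density) (auto simp: mult_ac)
  then have "(LINT u|nu_measure a. g u) = integral {-1..1} (\<lambda>u. nu_density a u * g u)"
    by (subst LINT_nu_measure[OF a_pos]) (auto intro: set_borel_integral_eq_integral(2))
  also have "\<dots> = 0"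
    unfolding g_def by (rule integral_unique[OF nu_density_by_parts_has_integral[OF a_pos deriv]])
  finally show ?thesis by (simp add: g_def)
qed

section \<open>A two-variable Gegenbauer integral\<close>

definition nu_pair :: "real \<Rightarrow> real \<Rightarrow> (real \<times> real) measure" where
  "nu_pair a b = nu_measure a \<Otimes>\<^sub>M nu_measure b"

definition unit_box :: "(real \<times> real) set" where
  "unit_box = {-1..1} \<times> {-1..1}"

definition xi :: "real \<Rightarrow> real \<Rightarrow> real \<times> real \<Rightarrow> real" where
  "xi p s x = snd x * p + fst x * s"

definition poisson_powr :: "real \<Rightarrow> real \<Rightarrow> real \<Rightarrow> real \<Rightarrow> real \<times> real \<Rightarrow> real" where
  "poisson_powr e p s R x = poisson_denom R (xi p s x) powr e"

definition weight :: "real \<Rightarrow> real \<Rightarrow> real \<times> real \<Rightarrow> real" where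
  "weight e d x = (1 + e * fst x) * (1 + d * snd x)"

lemma sets_nu_pair [measurable_cong, simp]: "sets (nu_pair a b) = sets (borel \<Otimes>\<^sub>M borel)"
  unfolding nu_pair_def by (rule sets_pair_measure_cong) simp_all

lemma unit_box_measurable [measurable]: "unit_box \<in> sets (borel \<Otimes>\<^sub>M borel)"
  unfolding unit_box_def by (intro pair_measureI) auto

lemma xi_measurable [measurable]: "xi p s \<in> borel_measurable (borel \<Otimes>\<^sub>M borel)"
  unfolding xi_def[abs_def] by measurable

lemma poisson_powr_measurable [measurable]: "poisson_powr e p s R \<in> borel_measurable (borel \<Otimes>\<^sub>M borel)"
  unfolding poisson_powr_def[abs_def] poisson_denom_def by measurable

lemma continuous_on_imp_measurable_pair:
  fixes g :: "real \<times> real \<Rightarrow> real"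
  shows "continuous_on UNIV g \<Longrightarrow> g \<in> borel_measurable (borel \<Otimes>\<^sub>M borel)"
  unfolding borel_prod by (rule borel_measurable_continuous_onI)

lemma continuous_on_imp_bounded_unit_box:
  fixes g :: "real \<times> real \<Rightarrow> real"
  assumes "continuous_on unit_box g"
  obtains B where "\<And>x. x \<in> unit_box \<Longrightarrow> \<bar>g x\<bar> \<le> B"
proof -
  have "compact unit_box" unfolding unit_box_def by (intro compact_Times) auto
  with assms have "bounded (g ` unit_box)" by (intro compact_imp_bounded compact_continuous_image)
  then obtain B where "\<forall>y\<in>g ` unit_box. norm y \<le> B" unfolding bounded_iff by blast
  then show thesis by (intro that[of B]) auto
qed

lemma continuous_on_xi: "continuous_on UNIV (xi p s)"
  unfolding xi_def[abs_def] by (intro continuous_intros)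

lemma continuous_on_weight: "continuous_on UNIV (weight e d)"
  unfolding weight_def[abs_def] by (intro continuous_intros)

lemma abs_xi_le:
  assumes "\<bar>p\<bar> + \<bar>s\<bar> \<le> 1" "x \<in> unit_box"
  shows "\<bar>xi p s x\<bar> \<le> 1"
proof -
  have "\<bar>snd x\<bar> \<le> 1" "\<bar>fst x\<bar> \<le> 1" using assms(2) by (auto simp: unit_box_def)
  then have "\<bar>snd x * p\<bar> \<le> \<bar>p\<bar>" "\<bar>fst x * s\<bar> \<le> \<bar>s\<bar>"
    by (simp_all add: abs_mult mult_left_le_one_le)
  with assms(1) show ?thesis unfolding xi_def by linarith
qed

lemma poisson_denom_xi_pos:
  "\<bar>p\<bar> + \<bar>s\<bar> \<le> 1 \<Longrightarrow> \<bar>R\<bar> < 1 \<Longrightarrow> x \<in> unit_box \<Longrightarrow> 0 < poisson_denom R (xi p s x)"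
  by (intro poisson_denom_pos abs_xi_le)

lemma abs_poisson_powr_le:
  assumes "\<bar>p\<bar> + \<bar>s\<bar> \<le> 1" "x \<in> unit_box" "\<bar>R\<bar> \<le> r" "r < 1" "e \<le> 0"
  shows "\<bar>poisson_powr e p s R x\<bar> \<le> ((1 - r)\<^sup>2) powr e"
proof -
  have "(1 - r)\<^sup>2 \<le> (1 - \<bar>R\<bar>)\<^sup>2" using assms by (intro power_mono) auto
  also have "\<dots> \<le> poisson_denom R (xi p s x)"
    using assms by (intro poisson_denom_ge abs_xi_le)
  finally have "poisson_powr e p s R x \<le> ((1 - r)\<^sup>2) powr e"
    using assms unfolding poisson_powr_def by (intro powr_mono2') auto
  then show ?thesis by (simp add: poisson_powr_def)
qed

lemma continuous_on_poisson_powr: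
  assumes "\<bar>p\<bar> + \<bar>s\<bar> \<le> 1" "\<bar>R\<bar> < 1"
  shows "continuous_on unit_box (poisson_powr e p s R)"
proof -
  have "poisson_denom R (xi p s x) \<noteq> 0" if "x \<in> unit_box" for x
    using poisson_denom_xi_pos[OF assms that] by simp
  then show ?thesis
    unfolding poisson_powr_def[abs_def]
    by (intro continuous_intros) (auto simp: poisson_denom_def xi_def intro!: continuous_intros)
qed

lemma poisson_powr_has_derivative:
  assumes "\<bar>p\<bar> + \<bar>s\<bar> \<le> 1" "\<bar>R\<bar> < 1" "x \<in> unit_box"
  shows "((\<lambda>R. poisson_powr e p s R x) has_real_derivative
    e * poisson_powr (e - 1) p s R x * (2 * R - 2 * xi p s x)) (at R)"
proof -
  have "((\<lambda>R. poisson_denom R (xi p s x)) has_real_derivative (2 * R - 2 * xi p s x)) (at R)"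
    unfolding poisson_denom_def by (auto intro!: derivative_eq_intros)
  from DERIV_fun_powr[OF this poisson_denom_xi_pos[OF assms], of e] show ?thesis
    by (simp add: poisson_powr_def)
qed

lemma abs_poisson_powr_derivative_le:
  assumes "\<bar>p\<bar> + \<bar>s\<bar> \<le> 1" "x \<in> unit_box" "\<bar>R\<bar> \<le> r" "r < 1" "e \<le> 0"
  shows "\<bar>e * poisson_powr (e - 1) p s R x * (2 * R - 2 * xi p s x)\<bar> \<le> \<bar>e\<bar> * ((1 - r)\<^sup>2) powr (e - 1) * 4"
proof -
  have "\<bar>2 * R - 2 * xi p s x\<bar> \<le> 4"
    using abs_xi_le[OF assms(1,2)] assms(3,4) by linarith
  moreover have "\<bar>poisson_powr (e - 1) p s R x\<bar> \<le> ((1 - r)\<^sup>2) powr (e - 1)"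
    using assms by (intro abs_poisson_powr_le) auto
  ultimately show ?thesis
    unfolding abs_mult by (intro mult_mono mult_nonneg_nonneg) auto
qed

lemma poisson_powr_eq_denom_mult:
  assumes "\<bar>p\<bar> + \<bar>s\<bar> \<le> 1" "\<bar>R\<bar> < 1" "x \<in> unit_box"
  shows "poisson_powr e p s R x = poisson_denom R (xi p s x) * poisson_powr (e - 1) p s R x"
  using poisson_denom_xi_pos[OF assms] by (simp add: poisson_powr_def powr_diff)

lemma poisson_powr_has_derivative_fst:
  assumes "\<bar>p\<bar> + \<bar>s\<bar> \<le> 1" "\<bar>R\<bar> < 1" "(u, v) \<in> unit_box"
  shows "((\<lambda>u. poisson_powr e p s R (u, v)) has_real_derivative
    (- e * (2 * R * s)) * poisson_powr (e - 1) p s R (u, v)) (at u)"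
proof -
  have "((\<lambda>u. poisson_denom R (xi p s (u, v))) has_real_derivative - (2 * R * s)) (at u)"
    unfolding poisson_denom_def xi_def by (auto intro!: derivative_eq_intros)
  from DERIV_fun_powr[OF this poisson_denom_xi_pos[OF assms], of e] show ?thesis
    by (simp add: poisson_powr_def mult_ac)
qed

lemma poisson_powr_has_derivative_snd:
  assumes "\<bar>p\<bar> + \<bar>s\<bar> \<le> 1" "\<bar>R\<bar> < 1" "(u, v) \<in> unit_box"
  shows "((\<lambda>v. poisson_powr e p s R (u, v)) has_real_derivative
    (- e * (2 * R * p)) * poisson_powr (e - 1) p s R (u, v)) (at v)"
proof -
  have "((\<lambda>v. poisson_denom R (xi p s (u, v))) has_real_derivative - (2 * R * p)) (at v)"
    unfolding poisson_denom_def xi_def by (auto intro!: derivative_eq_intros)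
  from DERIV_fun_powr[OF this poisson_denom_xi_pos[OF assms], of e] show ?thesis
    by (simp add: poisson_powr_def mult_ac)
qed

lemma distr_nu_measure_sign:
  assumes "e \<in> {1, -1}"
  shows "distr (nu_measure a) borel ((*) e) = nu_measure a"
proof (cases "e = 1")
  case True
  have "distr (nu_measure a) (nu_measure a) (\<lambda>u. u) = nu_measure a" by (rule distr_id)
  with True show ?thesis by (simp cong: distr_cong)
next
  case False
  with assms have "(*) e = uminus" by auto
  then show ?thesis by (simp only: distr_nu_measure_uminus)
qed

lemma poisson_radial_identity:
  fixes a b p s u v R P :: real
  defines "c \<equiv> v * p + u * s"
  defines "D \<equiv> poisson_denom R c" and "N \<equiv> poisson_denom R (p + s)"
  shows "((a + b) * N + R * (2 * R - 2 * (p + s))) * ((1 + u) * (1 + v) * (D * P))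
      + R * N * ((1 + u) * (1 + v) * ((- (a + b) - 1) * P * (2 * R - 2 * c)))
    = (1 - R\<^sup>2) * (a * ((1 - u) * (1 + v) * (D * P)) + b * ((1 + u) * (1 - v) * (D * P))
      - (- 2 * a * u * ((1 + v) * (D * P)) + (1 - u\<^sup>2) * ((1 + v) * ((a + b + 1) * (2 * R * s) * P)))
      - (- 2 * b * v * ((1 + u) * (D * P)) + (1 - v\<^sup>2) * ((1 + u) * ((a + b + 1) * (2 * R * p) * P))))"
  unfolding c_def D_def N_def poisson_denom_def by algebra

context positive_weights
begin

sublocale nu_fst: finite_measure "nu_measure a"
  by (rule finite_measure_nu_measure[OF a_pos])

sublocale nu_snd: finite_measure "nu_measure b"
  by (rule finite_measure_nu_measure[OF b_pos])

sublocale nu_factors: pair_sigma_finite "nu_measure a" "nu_measure b" ..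

sublocale nu_pair: finite_measure "nu_pair a b"
proof
  have "emeasure (nu_pair a b) (UNIV \<times> UNIV) = emeasure (nu_measure a) UNIV * emeasure (nu_measure b) UNIV"
    unfolding nu_pair_def by (rule nu_snd.emeasure_pair_measure_Times) auto
  then show "emeasure (nu_pair a b) (space (nu_pair a b)) \<noteq> \<infinity>"
    by (simp add: nu_pair_def space_pair_measure emeasure_nu_measure a_pos b_pos)
qed

lemma AE_nu_pair: "AE x in nu_pair a b. x \<in> unit_box"
  unfolding nu_pair_def
proof (rule nu_factors.AE_pair_measure)
  have "unit_box \<in> sets (nu_measure a \<Otimes>\<^sub>M nu_measure b)"
    using unit_box_measurable by (simp add: nu_pair_def[symmetric])
  then show "{x \<in> space (nu_measure a \<Otimes>\<^sub>M nu_measure b). x \<in> unit_box} \<in> sets (nu_measure a \<Otimes>\<^sub>M nu_measure b)"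
    by (simp add: space_pair_measure)
  show "AE u in nu_measure a. AE v in nu_measure b. (u, v) \<in> unit_box"
    using AE_nu_measure[of a]
    by eventually_elim (use AE_nu_measure[of b] in \<open>eventually_elim, auto simp: unit_box_def\<close>)
qed

lemma integrable_nu_pair:
  fixes f :: "real \<times> real \<Rightarrow> real"
  assumes "f \<in> borel_measurable (borel \<Otimes>\<^sub>M borel)" and bound: "\<And>x. x \<in> unit_box \<Longrightarrow> \<bar>f x\<bar> \<le> B"
  shows "integrable (nu_pair a b) f"
proof (rule nu_pair.integrable_const_bound[where B = B])
  show "AE x in nu_pair a b. norm (f x) \<le> B"
    using AE_nu_pair by (rule eventually_mono) (use bound in auto)
qed (use assms(1) in simp)

lemma integrable_nu_pair_continuous:
  fixes f :: "real \<times> real \<Rightarrow> real"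
  assumes "f \<in> borel_measurable (borel \<Otimes>\<^sub>M borel)" and "continuous_on unit_box f"
  shows "integrable (nu_pair a b) f"
  using continuous_on_imp_bounded_unit_box[OF assms(2)] integrable_nu_pair[OF assms(1)] by blast

lemma LINT_nu_pair_cong:
  assumes "f \<in> borel_measurable (borel \<Otimes>\<^sub>M borel)" "g \<in> borel_measurable (borel \<Otimes>\<^sub>M borel)"
    and "\<And>x. x \<in> unit_box \<Longrightarrow> f x = g x"
  shows "(LINT x|nu_pair a b. f x) = (LINT x|nu_pair a b. g x :: real)"
  using AE_nu_pair assms by (intro integral_cong_AE) (auto elim!: eventually_mono)

lemma LINT_nu_pair_fst:
  assumes "integrable (nu_pair a b) f"
  shows "(LINT x|nu_pair a b. f x) = (LINT u|nu_measure a. LINT v|nu_measure b. f (u, v) :: real)"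
  using nu_factors.integral_fst[of "\<lambda>u v. f (u, v)"] assms by (simp add: nu_pair_def case_prod_eta)

lemma LINT_nu_pair_snd:
  assumes "integrable (nu_pair a b) f"
  shows "(LINT x|nu_pair a b. f x) = (LINT v|nu_measure b. LINT u|nu_measure a. f (u, v) :: real)"
  using nu_factors.integral_snd[of "\<lambda>u v. f (u, v)"] assms by (simp add: nu_pair_def case_prod_eta)

lemma LINT_nu_pair_signs:
  assumes signs: "e \<in> {1, -1}" "d \<in> {1, -1}" and [measurable]: "f \<in> borel_measurable (borel \<Otimes>\<^sub>M borel)"
  shows "(LINT x|nu_pair a b. f (e * fst x, d * snd x)) = (LINT x|nu_pair a b. f x :: real)"
proof -
  have "sigma_finite_measure (distr (nu_measure b) borel ((*) d))"
    unfolding distr_nu_measure_sign[OF signs(2)] by unfold_locales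
  then have "distr (nu_pair a b) (borel \<Otimes>\<^sub>M borel) (\<lambda>(u, v). (e * u, d * v)) = nu_pair a b"
    using pair_measure_distr[of "(*) e" "nu_measure a" borel "(*) d" "nu_measure b" borel]
    by (simp add: distr_nu_measure_sign[OF signs(1)] distr_nu_measure_sign[OF signs(2)] nu_pair_def)
  then have "(LINT x|nu_pair a b. f x)
      = (LINT x|distr (nu_pair a b) (borel \<Otimes>\<^sub>M borel) (\<lambda>(u, v). (e * u, d * v)). f x)"
    by (rule arg_cong[OF sym])
  also have "\<dots> = (LINT x|nu_pair a b. f (e * fst x, d * snd x))"
    by (subst integral_distr) (auto simp: case_prod_beta')
  finally show ?thesis ..
qed

lemma LINT_nu_pair_by_parts_fst:
  fixes f f' :: "real \<times> real \<Rightarrow> real"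
  assumes [measurable]: "f \<in> borel_measurable (borel \<Otimes>\<^sub>M borel)" "f' \<in> borel_measurable (borel \<Otimes>\<^sub>M borel)"
    and cont: "continuous_on unit_box f" "continuous_on unit_box f'"
    and deriv: "\<And>u v. (u, v) \<in> unit_box \<Longrightarrow> ((\<lambda>u. f (u, v)) has_real_derivative f' (u, v)) (at u)"
  shows "(LINT x|nu_pair a b. - 2 * a * fst x * f x + (1 - (fst x)\<^sup>2) * f' x) = 0"
proof -
  let ?F = "\<lambda>x. - 2 * a * fst x * f x + (1 - (fst x)\<^sup>2) * f' x"
  have "integrable (nu_pair a b) ?F"
    by (intro integrable_nu_pair_continuous continuous_intros cont) measurable
  then have "(LINT x|nu_pair a b. ?F x) = (LINT v|nu_measure b. LINT u|nu_measure a. ?F (u, v))"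
    by (rule LINT_nu_pair_snd)
  also have "\<dots> = (LINT v|nu_measure b. 0)"
  proof (rule integral_cong_AE)
    show "AE v in nu_measure b. (LINT u|nu_measure a. ?F (u, v)) = 0"
      using AE_nu_measure[of b]
    proof (rule eventually_mono)
      fix v :: real assume v_in: "v \<in> {-1..1}"
      have "continuous_on {-1..1} (\<lambda>u. f' (u, v))"
        using v_in by (intro continuous_on_compose2[OF cont(2)] continuous_intros) (auto simp: unit_box_def)
      then show "(LINT u|nu_measure a. ?F (u, v)) = 0"
        using v_in LINT_nu_measure_by_parts[OF a_pos, of "\<lambda>u. f (u, v)" "\<lambda>u. f' (u, v)"] deriv
        by (simp add: unit_box_def)
    qed
  qed (use nu_factors.borel_measurable_lebesgue_integral in measurable)
  finally show ?thesis by simp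
qed

lemma LINT_nu_pair_by_parts_snd:
  fixes f f' :: "real \<times> real \<Rightarrow> real"
  assumes [measurable]: "f \<in> borel_measurable (borel \<Otimes>\<^sub>M borel)" "f' \<in> borel_measurable (borel \<Otimes>\<^sub>M borel)"
    and cont: "continuous_on unit_box f" "continuous_on unit_box f'"
    and deriv: "\<And>u v. (u, v) \<in> unit_box \<Longrightarrow> ((\<lambda>v. f (u, v)) has_real_derivative f' (u, v)) (at v)"
  shows "(LINT x|nu_pair a b. - 2 * b * snd x * f x + (1 - (snd x)\<^sup>2) * f' x) = 0"
proof -
  interpret swap: positive_weights b a by unfold_locales (rule b_pos a_pos)+
  let ?F = "\<lambda>x. - 2 * b * snd x * f x + (1 - (snd x)\<^sup>2) * f' x"
  have swap_cont: "continuous_on unit_box (\<lambda>x. g (snd x, fst x))" if "continuous_on unit_box g" for g :: "_ \<Rightarrow> real"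
    by (intro continuous_on_compose2[OF that] continuous_intros) (auto simp: unit_box_def)
  have "(LINT x|nu_pair b a. - 2 * b * fst x * f (snd x, fst x) + (1 - (fst x)\<^sup>2) * f' (snd x, fst x)) = 0"
    by (intro swap.LINT_nu_pair_by_parts_fst swap_cont cont) (auto simp: unit_box_def deriv)
  then have "(LINT x|(nu_measure b \<Otimes>\<^sub>M nu_measure a). (\<lambda>(v, u). ?F (u, v)) x) = 0"
    by (simp add: nu_pair_def case_prod_beta')
  moreover have "(LINT x|(nu_measure b \<Otimes>\<^sub>M nu_measure a). (\<lambda>(v, u). ?F (u, v)) x)
      = (LINT x|(nu_measure a \<Otimes>\<^sub>M nu_measure b). ?F x)"
    by (rule nu_factors.integral_product_swap) measurable
  ultimately show ?thesis by (simp add: nu_pair_def)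
qed

definition gegenbauer_integral :: "(real \<times> real \<Rightarrow> real) \<Rightarrow> real \<Rightarrow> real \<Rightarrow> real \<Rightarrow> real" where
  "gegenbauer_integral g p s R = (LINT x|nu_pair a b. g x * poisson_powr (- (a + b) - 1) p s R x)"

lemma integrable_poisson_powr:
  assumes "\<bar>p\<bar> + \<bar>s\<bar> \<le> 1" "\<bar>R\<bar> < 1" and cont_g: "continuous_on UNIV g"
  shows "integrable (nu_pair a b) (\<lambda>x. g x * poisson_powr e p s R x)"
proof (rule integrable_nu_pair_continuous)
  note [measurable] = continuous_on_imp_measurable_pair[OF cont_g]
  show "(\<lambda>x. g x * poisson_powr e p s R x) \<in> borel_measurable (borel \<Otimes>\<^sub>M borel)" by measurable
  show "continuous_on unit_box (\<lambda>x. g x * poisson_powr e p s R x)"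
    by (intro continuous_intros continuous_on_poisson_powr assms continuous_on_subset[OF cont_g]) simp
qed

lemma gegenbauer_integral_signs:
  assumes "e \<in> {1, -1}" "d \<in> {1, -1}"
  shows "gegenbauer_integral (weight 1 1) (d * p) (e * s) R = gegenbauer_integral (weight e d) p s R"
proof -
  note [measurable] = continuous_on_imp_measurable_pair[OF continuous_on_weight[of e d]]
  have "gegenbauer_integral (weight e d) p s R
      = (LINT x|nu_pair a b. weight e d (e * fst x, d * snd x)
          * poisson_powr (- (a + b) - 1) p s R (e * fst x, d * snd x))"
    unfolding gegenbauer_integral_def by (rule LINT_nu_pair_signs[OF assms, symmetric]) measurable
  also have "\<dots> = gegenbauer_integral (weight 1 1) (d * p) (e * s) R"
    unfolding gegenbauer_integral_def using assms
    by (intro Bochner_Integration.integral_cong refl) (auto simp: weight_def poisson_powr_def xi_def mult_ac)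
  finally show ?thesis ..
qed

lemma sum_gegenbauer_integral_weights:
  assumes "\<bar>p\<bar> + \<bar>s\<bar> \<le> 1" "\<bar>R\<bar> < 1"
  shows "gegenbauer_integral (weight 1 1) p s R + gegenbauer_integral (weight (-1) (-1)) p s R
      + gegenbauer_integral (weight (-1) 1) p s R + gegenbauer_integral (weight 1 (-1)) p s R
    = 4 * gegenbauer_integral (\<lambda>_. 1) p s R"
proof -
  let ?P = "poisson_powr (- (a + b) - 1) p s R"
  have "gegenbauer_integral (weight 1 1) p s R + gegenbauer_integral (weight (-1) (-1)) p s R
      + gegenbauer_integral (weight (-1) 1) p s R + gegenbauer_integral (weight 1 (-1)) p s R
    = (LINT x|nu_pair a b. weight 1 1 x * ?P x + weight (-1) (-1) x * ?P x
        + weight (-1) 1 x * ?P x + weight 1 (-1) x * ?P x)"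
    unfolding gegenbauer_integral_def
    by (simp only: Bochner_Integration.integral_add Bochner_Integration.integrable_add
        integrable_poisson_powr[OF assms continuous_on_weight])
  also have "\<dots> = (LINT x|nu_pair a b. 4 * (1 * ?P x))"
    by (rule Bochner_Integration.integral_cong) (simp_all add: weight_def algebra_simps)
  also have "\<dots> = 4 * gegenbauer_integral (\<lambda>_. 1) p s R"
    unfolding gegenbauer_integral_def by (rule integral_mult_right_zero)
  finally show ?thesis .
qed

lemma gegenbauer_integral_at_0: "gegenbauer_integral (weight 1 1) p s 0 = 1"
proof -
  have unit_mean: "(LINT u|nu_measure c. 1 + u) = 1" if "0 < c" for c
  proof -
    interpret finite_measure "nu_measure c" by (rule finite_measure_nu_measure[OF that])
    have "integrable (nu_measure c) (\<lambda>u. u)" by (rule integrable_nu_measure[OF that, where B = 1]) auto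
    then show ?thesis by (simp add: LINT_nu_measure_id measure_def emeasure_nu_measure[OF that])
  qed
  have "integrable (nu_pair a b) (weight 1 1)"
    using continuous_on_weight
    by (intro integrable_nu_pair_continuous continuous_on_imp_measurable_pair) (auto intro: continuous_on_subset)
  from LINT_nu_pair_fst[OF this]
  have "(LINT x|nu_pair a b. weight 1 1 x) = (LINT u|nu_measure a. LINT v|nu_measure b. (1 + u) * (1 + v))"
    by (simp add: weight_def)
  also have "\<dots> = 1" using unit_mean[OF a_pos] unit_mean[OF b_pos] by simp
  finally show ?thesis by (simp add: gegenbauer_integral_def poisson_powr_def poisson_denom_def)
qed

lemma gegenbauer_integral_has_derivative:
  assumes ps_le: "\<bar>p\<bar> + \<bar>s\<bar> \<le> 1" and abs_R: "\<bar>R\<bar> < 1" and cont_g: "continuous_on UNIV g"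
  defines "e \<equiv> - (a + b) - 1"
  shows "(gegenbauer_integral g p s has_real_derivative
    (LINT x|nu_pair a b. g x * (e * poisson_powr (e - 1) p s R x * (2 * R - 2 * xi p s x)))) (at R)"
proof -
  note [measurable] = continuous_on_imp_measurable_pair[OF cont_g]
  have "e \<le> 0" using weight_sum_pos by (simp add: e_def)
  define r where "r = (1 + \<bar>R\<bar>) / 2"
  obtain G where G_bound: "\<And>x. x \<in> unit_box \<Longrightarrow> \<bar>g x\<bar> \<le> G"
    using continuous_on_imp_bounded_unit_box[OF continuous_on_subset[OF cont_g subset_UNIV]] by blast
  have near: "\<bar>R'\<bar> \<le> r" "r < 1" if "\<bar>R' - R\<bar> < (1 - \<bar>R\<bar>) / 2" for R'
    using that abs_R abs_triangle_ineq[of "R' - R" R] by (auto simp: r_def)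
  show ?thesis
    unfolding gegenbauer_integral_def[abs_def] e_def[symmetric]
  proof (rule nu_pair.has_real_derivative_LINT)
    show "0 < (1 - \<bar>R\<bar>) / 2" using abs_R by simp
    show "integrable (nu_pair a b) (\<lambda>x. g x * poisson_powr e p s R' x)" if "\<bar>R' - R\<bar> < (1 - \<bar>R\<bar>) / 2" for R'
      using near[OF that] by (intro integrable_poisson_powr ps_le cont_g) auto
    show "(\<lambda>x. g x * (e * poisson_powr (e - 1) p s R x * (2 * R - 2 * xi p s x))) \<in> borel_measurable (nu_pair a b)"
      by measurable
    show "AE x in nu_pair a b. \<forall>R'. \<bar>R' - R\<bar> < (1 - \<bar>R\<bar>) / 2 \<longrightarrow>
        ((\<lambda>R. g x * poisson_powr e p s R x) has_real_derivative
          g x * (e * poisson_powr (e - 1) p s R' x * (2 * R' - 2 * xi p s x))) (at R') \<and>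
        \<bar>g x * (e * poisson_powr (e - 1) p s R' x * (2 * R' - 2 * xi p s x))\<bar>
          \<le> G * (\<bar>e\<bar> * ((1 - r)\<^sup>2) powr (e - 1) * 4)"
      using AE_nu_pair
    proof (rule eventually_mono, intro allI impI conjI)
      fix x R' assume x_in: "x \<in> unit_box" and "\<bar>R' - R\<bar> < (1 - \<bar>R\<bar>) / 2"
      note near = near[OF this(2)]
      then show "((\<lambda>R. g x * poisson_powr e p s R x) has_real_derivative
          g x * (e * poisson_powr (e - 1) p s R' x * (2 * R' - 2 * xi p s x))) (at R')"
        by (intro DERIV_cmult poisson_powr_has_derivative ps_le x_in) linarith
      have "0 \<le> G" using G_bound[OF x_in] by linarith
      then show "\<bar>g x * (e * poisson_powr (e - 1) p s R' x * (2 * R' - 2 * xi p s x))\<bar>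
          \<le> G * (\<bar>e\<bar> * ((1 - r)\<^sup>2) powr (e - 1) * 4)"
        unfolding abs_mult[of "g x"]
        by (intro mult_mono G_bound x_in abs_poisson_powr_derivative_le ps_le near \<open>e \<le> 0\<close>) auto
    qed
  qed
qed

text \<open>The two integrands below are derivatives, with respect to the measure, in the first and in the second variable.\<close>

definition exact_fst :: "real \<Rightarrow> real \<Rightarrow> real \<Rightarrow> real \<times> real \<Rightarrow> real" where
  "exact_fst p s R x = - 2 * a * fst x * ((1 + snd x) * poisson_powr (- (a + b) - 1) p s R x)
     + (1 - (fst x)\<^sup>2) * ((1 + snd x) * ((a + b + 1) * (2 * R * s) * poisson_powr (- (a + b) - 2) p s R x))"

definition exact_snd :: "real \<Rightarrow> real \<Rightarrow> real \<Rightarrow> real \<times> real \<Rightarrow> real" where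
  "exact_snd p s R x = - 2 * b * snd x * ((1 + fst x) * poisson_powr (- (a + b) - 1) p s R x)
     + (1 - (snd x)\<^sup>2) * ((1 + fst x) * ((a + b + 1) * (2 * R * p) * poisson_powr (- (a + b) - 2) p s R x))"

lemma exact_measurable [measurable]:
  "exact_fst p s R \<in> borel_measurable (borel \<Otimes>\<^sub>M borel)" "exact_snd p s R \<in> borel_measurable (borel \<Otimes>\<^sub>M borel)"
  unfolding exact_fst_def[abs_def] exact_snd_def[abs_def] by measurable

lemma integrable_exact:
  assumes "\<bar>p\<bar> + \<bar>s\<bar> \<le> 1" "\<bar>R\<bar> < 1"
  shows "integrable (nu_pair a b) (exact_fst p s R)" "integrable (nu_pair a b) (exact_snd p s R)"
proof -
  note cont = continuous_on_poisson_powr[OF assms]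
  have "continuous_on unit_box (exact_fst p s R)" "continuous_on unit_box (exact_snd p s R)"
    unfolding exact_fst_def[abs_def] exact_snd_def[abs_def] by (intro continuous_intros cont)+
  then show "integrable (nu_pair a b) (exact_fst p s R)" "integrable (nu_pair a b) (exact_snd p s R)"
    by (auto intro: integrable_nu_pair_continuous exact_measurable)
qed

lemma LINT_exact_fst:
  assumes "\<bar>p\<bar> + \<bar>s\<bar> \<le> 1" "\<bar>R\<bar> < 1"
  shows "(LINT x|nu_pair a b. exact_fst p s R x) = 0"
  unfolding exact_fst_def
  using poisson_powr_has_derivative_fst[OF assms, of _ _ "- (a + b) - 1"]
  by (intro LINT_nu_pair_by_parts_fst continuous_intros continuous_on_poisson_powr[OF assms])
    (measurable, auto intro!: derivative_eq_intros simp: algebra_simps)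

lemma LINT_exact_snd:
  assumes "\<bar>p\<bar> + \<bar>s\<bar> \<le> 1" "\<bar>R\<bar> < 1"
  shows "(LINT x|nu_pair a b. exact_snd p s R x) = 0"
  unfolding exact_snd_def
  using poisson_powr_has_derivative_snd[OF assms, of _ _ "- (a + b) - 1"]
  by (intro LINT_nu_pair_by_parts_snd continuous_intros continuous_on_poisson_powr[OF assms])
    (measurable, auto intro!: derivative_eq_intros simp: algebra_simps)

lemma gegenbauer_radial_integrand:
  assumes ps_le: "\<bar>p\<bar> + \<bar>s\<bar> \<le> 1" and abs_R: "\<bar>R\<bar> < 1" and "x \<in> unit_box"
  defines "P \<equiv> poisson_powr (- (a + b) - 2) p s R" and "Q \<equiv> poisson_powr (- (a + b) - 1) p s R"
  shows "((a + b) * poisson_denom R (p + s) + R * (2 * R - 2 * (p + s))) * (weight 1 1 x * Q x)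
      + R * poisson_denom R (p + s) * (weight 1 1 x * ((- (a + b) - 1) * P x * (2 * R - 2 * xi p s x)))
    = (1 - R\<^sup>2) * (a * (weight (-1) 1 x * Q x) + b * (weight 1 (-1) x * Q x)
      - exact_fst p s R x - exact_snd p s R x)"
proof -
  have "Q x = poisson_denom R (snd x * p + fst x * s) * P x"
    using poisson_powr_eq_denom_mult[OF ps_le abs_R \<open>x \<in> unit_box\<close>, of "- (a + b) - 1"]
    by (simp add: P_def Q_def xi_def)
  then show ?thesis
    using poisson_radial_identity[of a b R p s "fst x" "snd x" "P x"]
    unfolding P_def Q_def by (simp add: weight_def xi_def exact_fst_def exact_snd_def)
qed

text \<open>For $k = 1$ this is the radial equation of the Dunkl system: its two sides differ by
  exact derivatives in the two variables of integration.\<close>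

lemma gegenbauer_integral_radial:
  assumes ps_le: "\<bar>p\<bar> + \<bar>s\<bar> \<le> 1" and abs_R: "\<bar>R\<bar> < 1"
  defines "G \<equiv> \<lambda>R. poisson_denom R (p + s) * gegenbauer_integral (weight 1 1) p s R"
  shows "\<exists>G'. (G has_real_derivative G') (at R) \<and>
     (a + b) * G R + R * G' = (1 - R\<^sup>2) *
       (a * gegenbauer_integral (weight (-1) 1) p s R + b * gegenbauer_integral (weight 1 (-1)) p s R)"
proof (intro exI conjI)
  let ?P = "poisson_powr (- (a + b) - 2) p s R" and ?Q = "poisson_powr (- (a + b) - 1) p s R"
  let ?N = "poisson_denom R (p + s)" and ?N' = "2 * R - 2 * (p + s)"
  let ?I = "gegenbauer_integral (weight 1 1) p s R"
  let ?dQ = "\<lambda>x. weight 1 1 x * ((- (a + b) - 1) * ?P x * (2 * R - 2 * xi p s x))"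
  let ?I' = "LINT x|nu_pair a b. ?dQ x"
  let ?rhs = "a * gegenbauer_integral (weight (-1) 1) p s R + b * gegenbauer_integral (weight 1 (-1)) p s R"
  note [measurable] = continuous_on_imp_measurable_pair[OF continuous_on_weight]
  have "((\<lambda>R. poisson_denom R (p + s)) has_real_derivative ?N') (at R)"
    unfolding poisson_denom_def by (auto intro!: derivative_eq_intros)
  from DERIV_mult[OF this gegenbauer_integral_has_derivative[OF ps_le abs_R continuous_on_weight]]
  show "(G has_real_derivative ?N' * ?I + ?I' * ?N) (at R)"
    unfolding G_def by simp
  have Q_integrable: "integrable (nu_pair a b) (\<lambda>x. weight e d x * ?Q x)" for e d
    by (rule integrable_poisson_powr[OF ps_le abs_R continuous_on_weight])
  have dQ_integrable: "integrable (nu_pair a b) ?dQ"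
    by (rule integrable_nu_pair_continuous, measurable)
      (intro continuous_intros continuous_on_poisson_powr[OF ps_le abs_R]
        continuous_on_subset[OF continuous_on_weight] continuous_on_subset[OF continuous_on_xi] subset_UNIV)
  have "(a + b) * G R + R * (?N' * ?I + ?I' * ?N) = ((a + b) * ?N + R * ?N') * ?I + R * ?N * ?I'"
    by (simp add: G_def algebra_simps)
  also have "\<dots> = (LINT x|nu_pair a b. ((a + b) * ?N + R * ?N') * (weight 1 1 x * ?Q x) + R * ?N * ?dQ x)"
    unfolding gegenbauer_integral_def
    by (simp only: integral_mult_right_zero Bochner_Integration.integral_add integrable_mult_right Q_integrable dQ_integrable)
  also have "\<dots> = (LINT x|nu_pair a b. (1 - R\<^sup>2) * (a * (weight (-1) 1 x * ?Q x) + b * (weight 1 (-1) x * ?Q x)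
      - exact_fst p s R x - exact_snd p s R x))"
    by (rule LINT_nu_pair_cong) (measurable, rule gegenbauer_radial_integrand[OF ps_le abs_R])
  also have "\<dots> = (1 - R\<^sup>2) * ?rhs"
    unfolding gegenbauer_integral_def
    by (simp only: integral_mult_right_zero Bochner_Integration.integral_add Bochner_Integration.integral_diff
        Bochner_Integration.integrable_add Bochner_Integration.integrable_diff integrable_mult_right Q_integrable
        integrable_exact[OF ps_le abs_R] LINT_exact_fst[OF ps_le abs_R] LINT_exact_snd[OF ps_le abs_R] diff_0_right)
  finally show "(a + b) * G R + R * (?N' * ?I + ?I' * ?N) = (1 - R\<^sup>2) * ?rhs" .
qed

end

section \<open>The generating function in closed form\<close>

context dihedral
begin

definition kernel_cos :: "complex \<Rightarrow> complex \<Rightarrow> real" where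
  "kernel_cos x y = Re (x ^ k) * Re (y ^ k)"

definition kernel_sin :: "complex \<Rightarrow> complex \<Rightarrow> real" where
  "kernel_sin x y = Im (x ^ k) * Im (y ^ k)"

lemma kernel_cos_add_sin: "kernel_cos x y + kernel_sin x y = Re ((x * cnj y) ^ k)"
  by (simp add: kernel_cos_def kernel_sin_def power_mult_distrib flip: complex_cnj_power)

lemma abs_kernel_cos_add_abs_sin_le:
  assumes "cmod x = 1" "cmod y = 1"
  shows "\<bar>kernel_cos x y\<bar> + \<bar>kernel_sin x y\<bar> \<le> 1"
proof -
  define X Y where "X = x ^ k" and "Y = y ^ k"
  have "(Re X)\<^sup>2 + (Im X)\<^sup>2 = 1" "(Re Y)\<^sup>2 + (Im Y)\<^sup>2 = 1"
    using assms cmod_power2[of X] cmod_power2[of Y] by (simp_all add: X_def Y_def norm_power)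
  moreover have "2 * \<bar>Re X\<bar> * \<bar>Re Y\<bar> \<le> \<bar>Re X\<bar>\<^sup>2 + \<bar>Re Y\<bar>\<^sup>2"
    "2 * \<bar>Im X\<bar> * \<bar>Im Y\<bar> \<le> \<bar>Im X\<bar>\<^sup>2 + \<bar>Im Y\<bar>\<^sup>2"
    by (rule sum_squares_bound)+
  ultimately have "\<bar>Re X\<bar> * \<bar>Re Y\<bar> + \<bar>Im X\<bar> * \<bar>Im Y\<bar> \<le> 1"
    unfolding power2_abs by linarith
  then show ?thesis by (simp add: kernel_cos_def kernel_sin_def X_def Y_def abs_mult)
qed

lemma abs_power_k_less_1: "\<bar>t\<bar> < 1 \<Longrightarrow> \<bar>t ^ k\<bar> < (1 :: real)"
  by (simp add: power_abs power_less_one_iff)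

definition gf_numerator :: "complex \<Rightarrow> complex \<Rightarrow> real \<Rightarrow> real" where
  "gf_numerator y x t = (1 + t\<^sup>2) powr (real k * (a + b)) *
     (poisson_denom (t ^ k) (kernel_cos x y + kernel_sin x y)
        * gegenbauer_integral (weight 1 1) (kernel_cos x y) (kernel_sin x y) (t ^ k))"

text \<open>Up to elementary factors this is the Poisson kernel of the case $k = 1$ at $(x^k, y^k)$. The argument is the
  Poisson radius $t$, not the variable \<^term>\<open>poisson_subst t\<close> of the generating function.\<close>

definition gf_closed :: "complex \<Rightarrow> real \<Rightarrow> complex \<Rightarrow> real" where
  "gf_closed y t x = gf_numerator y x t / (1 - poisson_subst t * (x \<bullet> y))"

definition gf_scale :: "real \<Rightarrow> real" where
  "gf_scale t = (1 + t\<^sup>2) powr (real k * (a + b)) * ((1 + t\<^sup>2) * (1 - (t ^ k)\<^sup>2) / (1 - t\<^sup>2))"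

lemma gf_closed_commute: "gf_closed y t x = gf_closed x t y"
  by (simp add: gf_closed_def gf_numerator_def kernel_cos_def kernel_sin_def mult.commute inner_commute)

lemma gf_denom_pos:
  assumes "cmod x = 1" "cmod y = 1" "\<bar>t\<bar> < 1"
  shows "0 < 1 - poisson_subst t * (x \<bullet> y)"
  using poisson_subst_mult_less_1[of "x \<bullet> y" t] Cauchy_Schwarz_ineq2[of x y] assms by simp

lemma rot_mean_gf_closed:
  assumes norm_x: "cmod x = 1" and norm_y: "cmod y = 1" and abs_t: "\<bar>t\<bar> < 1"
  shows "rot_mean (gf_closed y t) x
    = gf_scale t * gegenbauer_integral (weight 1 1) (kernel_cos x y) (kernel_sin x y) (t ^ k)"
proof -
  define u where "u = x * cnj y"
  define D where "D = poisson_denom (t ^ k) (Re (u ^ k))"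
  have norm_u: "cmod u = 1" using norm_x norm_y by (simp add: u_def norm_mult)
  then have "cmod (u ^ k) = 1" by (simp add: norm_power)
  from poisson_denom_unit_pos[OF this abs_power_k_less_1[OF abs_t]] have "0 < D" by (simp add: D_def)
  have "gf_numerator y (rot (2 * int i) x) t = gf_numerator y x t" for i
    by (simp add: gf_numerator_def kernel_cos_def kernel_sin_def rot_power)
  moreover have "rot (2 * int i) x \<bullet> y = Re (u * cis (2 * pi * real i / real k))" for i
    by (simp only: inner_eq_Re_mult_cnj rot_def omega_even) (simp only: u_def mult_ac)
  ultimately have "gf_closed y t (rot (2 * int i) x)
      = gf_numerator y x t * (1 / (1 - poisson_subst t * Re (u * cis (2 * pi * real i / real k))))" for i
    by (simp add: gf_closed_def)
  then have "rot_mean (gf_closed y t) x = gf_numerator y x t *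
      (\<Sum>i<k. 1 / (1 - poisson_subst t * Re (u * cis (2 * pi * real i / real k)))) / real k"
    by (simp only: rot_mean_def sum_distrib_left)
  also have "\<dots> = gf_numerator y x t * ((1 + t\<^sup>2) * (1 - (t ^ k)\<^sup>2) / ((1 - t\<^sup>2) * D))"
    unfolding sum_poisson_roots_unity[OF k_pos norm_u abs_t] D_def by simp
  also have "gf_numerator y x t = (1 + t\<^sup>2) powr (real k * (a + b)) *
      (D * gegenbauer_integral (weight 1 1) (kernel_cos x y) (kernel_sin x y) (t ^ k))"
    unfolding gf_numerator_def kernel_cos_add_sin D_def u_def ..
  finally show ?thesis
    using \<open>0 < D\<close> by (simp add: gf_scale_def)
qed

lemma rot_mean_gf_closed_cosets:
  assumes norm_x: "cmod x = 1" and norm_y: "cmod y = 1" and abs_t: "\<bar>t\<bar> < 1"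
  shows "rot_mean (gf_closed y t) (rot 1 x)
      = gf_scale t * gegenbauer_integral (weight (-1) (-1)) (kernel_cos x y) (kernel_sin x y) (t ^ k)"
    and "rot_mean (gf_closed y t) (rfl 0 x)
      = gf_scale t * gegenbauer_integral (weight (-1) 1) (kernel_cos x y) (kernel_sin x y) (t ^ k)"
    and "rot_mean (gf_closed y t) (rfl 1 x)
      = gf_scale t * gegenbauer_integral (weight 1 (-1)) (kernel_cos x y) (kernel_sin x y) (t ^ k)"
proof -
  have "kernel_cos (rot 1 x) y = (-1) * kernel_cos x y" "kernel_sin (rot 1 x) y = (-1) * kernel_sin x y"
    "kernel_cos (rfl 0 x) y = 1 * kernel_cos x y" "kernel_sin (rfl 0 x) y = (-1) * kernel_sin x y"
    "kernel_cos (rfl 1 x) y = (-1) * kernel_cos x y" "kernel_sin (rfl 1 x) y = 1 * kernel_sin x y"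
    by (simp_all add: kernel_cos_def kernel_sin_def rot_power rfl_power del: complex_cnj_power)
  note kernel_signs = this
  show "rot_mean (gf_closed y t) (rot 1 x)
      = gf_scale t * gegenbauer_integral (weight (-1) (-1)) (kernel_cos x y) (kernel_sin x y) (t ^ k)"
    by (subst rot_mean_gf_closed)
      (simp_all only: norm_rot norm_x norm_y abs_t kernel_signs gegenbauer_integral_signs insertI1 insertI2)
  show "rot_mean (gf_closed y t) (rfl 0 x)
      = gf_scale t * gegenbauer_integral (weight (-1) 1) (kernel_cos x y) (kernel_sin x y) (t ^ k)"
    by (subst rot_mean_gf_closed)
      (simp_all only: norm_rfl norm_x norm_y abs_t kernel_signs gegenbauer_integral_signs insertI1 insertI2)
  show "rot_mean (gf_closed y t) (rfl 1 x)
      = gf_scale t * gegenbauer_integral (weight 1 (-1)) (kernel_cos x y) (kernel_sin x y) (t ^ k)"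
    by (subst rot_mean_gf_closed)
      (simp_all only: norm_rfl norm_x norm_y abs_t kernel_signs gegenbauer_integral_signs insertI1 insertI2)
qed

lemma orbit_sum_gf_closed:
  assumes norm_x: "cmod x = 1" and norm_y: "cmod y = 1" and abs_t: "\<bar>t\<bar> < 1"
  shows "orbit_sum (gf_closed y t) x
    = 4 * real k * (gf_scale t * gegenbauer_integral (\<lambda>_. 1) (kernel_cos x y) (kernel_sin x y) (t ^ k))"
  using sum_gegenbauer_integral_weights[OF abs_kernel_cos_add_abs_sin_le[OF norm_x norm_y] abs_power_k_less_1[OF abs_t]]
  by (simp add: orbit_sum_eq_rot_mean rot_mean_gf_closed[OF assms] rot_mean_gf_closed_cosets[OF assms]
      distrib_left[symmetric])

lemma gf_numerator_ode:
  assumes norm_x: "cmod x = 1" and norm_y: "cmod y = 1" and abs_t: "\<bar>t\<bar> < 1"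
  shows "\<exists>Q'. (gf_numerator y x has_real_derivative Q') (at t) \<and>
    poisson_subst t * Q' = poisson_subst' t * (real k * (gf_scale t *
      (a * gegenbauer_integral (weight (-1) 1) (kernel_cos x y) (kernel_sin x y) (t ^ k)
       + b * gegenbauer_integral (weight 1 (-1)) (kernel_cos x y) (kernel_sin x y) (t ^ k)))
      - real k * (a + b) * gf_numerator y x t)"
proof -
  let ?p = "kernel_cos x y" and ?s = "kernel_sin x y" and ?R = "t ^ k" and ?n = "real k * (a + b)"
  define G where "G R = poisson_denom R (?p + ?s) * gegenbauer_integral (weight 1 1) ?p ?s R" for R
  define H where "H = a * gegenbauer_integral (weight (-1) 1) ?p ?s ?R + b * gegenbauer_integral (weight 1 (-1)) ?p ?s ?R"
  define W where "W = (1 + t\<^sup>2) powr ?n"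
  obtain G' where G_deriv: "(G has_real_derivative G') (at ?R)" and radial: "(a + b) * G ?R + ?R * G' = (1 - ?R\<^sup>2) * H"
    using gegenbauer_integral_radial[OF abs_kernel_cos_add_abs_sin_le[OF norm_x norm_y] abs_power_k_less_1[OF abs_t]]
    unfolding G_def[abs_def] H_def by blast
  have numerator_eq: "gf_numerator y x = (\<lambda>t. (1 + t\<^sup>2) powr ?n * G (t ^ k))"
    by (simp add: fun_eq_iff gf_numerator_def G_def)
  have "((\<lambda>t. (1 + t\<^sup>2) powr ?n) has_real_derivative ?n * (2 * t) * W / (1 + t\<^sup>2)) (at t)"
    using one_plus_power2_pos[of t] unfolding W_def
    by (auto intro!: derivative_eq_intros simp: powr_diff)
  moreover have "((\<lambda>t. G (t ^ k)) has_real_derivative G' * (real k * t ^ (k - 1))) (at t)"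
    by (rule DERIV_chain2[where f = G and g = "\<lambda>t. t ^ k", OF G_deriv]) (auto intro!: derivative_eq_intros)
  ultimately have deriv: "(gf_numerator y x has_real_derivative
      (?n * (2 * t) * W / (1 + t\<^sup>2)) * G ?R + (G' * (real k * t ^ (k - 1))) * W) (at t)"
    (is "(_ has_real_derivative ?Q') _")
    unfolding numerator_eq W_def by (rule DERIV_mult)
  have nonzero: "1 + t\<^sup>2 \<noteq> 0" "1 - t\<^sup>2 \<noteq> 0"
    using one_plus_power2_pos[of t] abs_t by (auto simp: abs_square_eq_1)
  have "t * t ^ (k - 1) = ?R"
    using k_pos by (simp add: power_eq_if[of t k])
  then have "t * (1 + t\<^sup>2) * ?Q' = ?n * 2 * t\<^sup>2 * W * G ?R + (1 + t\<^sup>2) * W * real k * (?R * G')"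
    using nonzero(1) by (simp add: field_simps power2_eq_square)
  also have "?R * G' = (1 - ?R\<^sup>2) * H - (a + b) * G ?R"
    using radial by simp
  also have "?n * 2 * t\<^sup>2 * W * G ?R + (1 + t\<^sup>2) * W * real k * ((1 - ?R\<^sup>2) * H - (a + b) * G ?R)
      = (1 - t\<^sup>2) * (real k * (gf_scale t * H) - ?n * gf_numerator y x t)"
    using nonzero(2) unfolding gf_scale_def numerator_eq W_def[symmetric] by (simp add: field_simps)
  finally have "t * (1 + t\<^sup>2) * ?Q' = (1 - t\<^sup>2) * (real k * (gf_scale t * H) - ?n * gf_numerator y x t)" .
  then have "poisson_subst t * ?Q' = poisson_subst' t * (real k * (gf_scale t * H) - ?n * gf_numerator y x t)"
    by (rule poisson_subst_mult_eqI)
  with deriv show ?thesis unfolding H_def by blast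
qed

abbreviation gf_order :: real where
  "gf_order \<equiv> real k * (a + b) + 1"

lemma gf_order_pos: "0 < gf_order"
  using weight_sum_pos by (simp add: add_nonneg_pos)

lemma gf_closed_ode:
  assumes "cmod x = 1" and "cmod y = 1" and "\<bar>t\<bar> < 1"
  shows "\<exists>S'. ((\<lambda>t. gf_closed y t x) has_real_derivative S') (at t) \<and>
    poisson_subst t * (1 - poisson_subst t * (x \<bullet> y)) * S' = poisson_subst' t *
      (gf_order * poisson_subst t * (x \<bullet> y) * gf_closed y t x - refl_diff (gf_closed y t) x)"
proof -
  let ?r = "poisson_subst t" and ?r' = "poisson_subst' t" and ?c = "x \<bullet> y" and ?S = "gf_closed y t x"
  define w where "w = 1 - ?r * ?c"
  define M where "M = real k * (gf_scale t *
      (a * gegenbauer_integral (weight (-1) 1) (kernel_cos x y) (kernel_sin x y) (t ^ k)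
       + b * gegenbauer_integral (weight 1 (-1)) (kernel_cos x y) (kernel_sin x y) (t ^ k)))"
  obtain Q' where numerator_deriv: "(gf_numerator y x has_real_derivative Q') (at t)"
    and numerator_ode: "?r * Q' = ?r' * (M - real k * (a + b) * gf_numerator y x t)"
    using gf_numerator_ode[OF assms] unfolding M_def by blast
  have w_pos: "0 < w" unfolding w_def by (rule gf_denom_pos[OF assms])
  have numerator: "gf_numerator y x t = w * ?S" using w_pos by (simp add: gf_closed_def w_def)
  have "refl_diff (gf_closed y t) x = real k * (a + b) * ?S - M"
    unfolding refl_diff_eq_rot_mean rot_mean_gf_closed_cosets[OF assms] M_def by (simp add: algebra_simps)
  then have refl_part: "M = real k * (a + b) * ?S - refl_diff (gf_closed y t) x" by simp
  have "((\<lambda>t. gf_closed y t x) has_real_derivative (Q' * w - gf_numerator y x t * (- (?r' * ?c))) / (w * w)) (at t)"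
    unfolding gf_closed_def w_def using w_pos[unfolded w_def]
    by (auto intro!: derivative_eq_intros numerator_deriv poisson_subst_has_derivative)
  also have "(Q' * w - gf_numerator y x t * (- (?r' * ?c))) / (w * w) = (Q' + ?r' * ?c * ?S) / w"
    unfolding numerator using w_pos by (simp add: field_simps)
  finally have deriv: "((\<lambda>t. gf_closed y t x) has_real_derivative (Q' + ?r' * ?c * ?S) / w) (at t)" .
  have "?r * w * ((Q' + ?r' * ?c * ?S) / w) = ?r * Q' + ?r' * (?r * ?c * ?S)"
    using w_pos by (simp add: field_simps)
  also have "\<dots> = ?r' * (gf_order * ?r * ?c * ?S - refl_diff (gf_closed y t) x)"
    unfolding numerator_ode numerator refl_part w_def by (simp add: algebra_simps)
  finally show ?thesis using deriv unfolding w_def by blast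
qed

lemma gf_closed_at_0: "gf_closed y 0 x = 1"
  using k_pos
  by (simp add: gf_closed_def gf_numerator_def gegenbauer_integral_at_0 poisson_denom_def poisson_subst_def power_0_left)

end

section \<open>The generating function as a power series\<close>

lemma pochhammer_binomial_sums:
  fixes z q :: real
  assumes "\<bar>z\<bar> < 1"
  shows "(\<lambda>n. pochhammer q n / fact n * z ^ n) sums (1 - z) powr (- q)"
proof -
  have "((- q) gchoose n) * (- z) ^ n = pochhammer q n / fact n * z ^ n" for n
    by (cases "even n") (simp_all add: gbinomial_pochhammer)
  then show ?thesis using gen_binomial_real[of "- z" "- q"] assms by simp
qed

lemma power_series_has_derivative_sums:
  fixes c :: "nat \<Rightarrow> real"
  assumes sums: "\<And>z. \<bar>z\<bar> < K \<Longrightarrow> (\<lambda>n. c n * z ^ n) sums f z" and abs_r: "\<bar>r\<bar> < K"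
  obtains f' where "(f has_real_derivative f') (at r)" "(\<lambda>n. real n * c n * r ^ n) sums (r * f')"
proof -
  define K' where "K' = (\<bar>r\<bar> + K) / 2"
  have abs_K': "\<bar>K'\<bar> < K" "\<bar>r\<bar> < \<bar>K'\<bar>" using abs_r by (auto simp: K'_def)
  have "((\<lambda>z. \<Sum>n. c n * z ^ n) has_real_derivative (\<Sum>n. diffs c n * r ^ n)) (at r)"
    using abs_K' by (intro termdiffs_strong[OF sums_summable[OF sums[of K']]]) auto
  then have deriv: "(f has_real_derivative (\<Sum>n. diffs c n * r ^ n)) (at r)"
  proof (rule has_field_derivative_transform_within_open)
    show "open {-K<..<K}" "r \<in> {-K<..<K}" using abs_r by auto
    show "(\<Sum>n. c n * z ^ n) = f z" if "z \<in> {-K<..<K}" for z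
      using sums[of z] that by (simp add: sums_iff abs_less_iff)
  qed
  have "(\<lambda>n. diffs c n * r ^ n) sums (\<Sum>n. diffs c n * r ^ n)"
    using termdiffs_sums_strong[OF sums deriv, of K] abs_r by simp
  then have "(\<lambda>n. r * (diffs c n * r ^ n)) sums (r * (\<Sum>n. diffs c n * r ^ n))"
    by (rule sums_mult)
  then have "(\<lambda>n. real (Suc n) * c (Suc n) * r ^ Suc n) sums (r * (\<Sum>n. diffs c n * r ^ n))"
    by (simp only: diffs_def power_Suc mult_ac)
  then have "(\<lambda>n. real n * c n * r ^ n) sums (r * (\<Sum>n. diffs c n * r ^ n))"
    using sums_Suc_iff[of "\<lambda>n. real n * c n * r ^ n"] by simp
  with deriv show ?thesis by (rule that)
qed

context dihedral
begin

definition gf_coeff :: "complex \<Rightarrow> nat \<Rightarrow> complex \<Rightarrow> real" where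
  "gf_coeff y n x = pochhammer gf_order n * dunkl_component y n x"

definition gf_series :: "complex \<Rightarrow> real \<Rightarrow> complex \<Rightarrow> real" where
  "gf_series y r x = (\<Sum>n. gf_coeff y n x * r ^ n)"

lemma abs_gf_coeff_le:
  assumes "cmod x = 1" "cmod y = 1"
  shows "\<bar>gf_coeff y n x\<bar> \<le> pochhammer gf_order n / fact n * 6 ^ n"
proof -
  have "0 \<le> pochhammer gf_order n" using gf_order_pos by (simp add: pochhammer_nonneg)
  moreover have "\<bar>dunkl_component y n x\<bar> \<le> 6 ^ n / fact n" using abs_dunkl_component_le[of y n x] assms by simp
  ultimately have "\<bar>gf_coeff y n x\<bar> \<le> pochhammer gf_order n * (6 ^ n / fact n)"
    unfolding gf_coeff_def abs_mult by (intro mult_mono) auto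
  then show ?thesis by simp
qed

lemma gf_series_sums:
  assumes norm_x: "cmod x = 1" and norm_y: "cmod y = 1" and abs_r: "\<bar>r\<bar> < 1/6"
  shows "(\<lambda>n. gf_coeff y n x * r ^ n) sums gf_series y r x"
proof -
  have "summable (\<lambda>n. pochhammer gf_order n / fact n * (6 * \<bar>r\<bar>) ^ n)"
    using pochhammer_binomial_sums[of "6 * \<bar>r\<bar>" gf_order] abs_r by (auto simp: sums_iff)
  then have "summable (\<lambda>n. gf_coeff y n x * r ^ n)"
  proof (rule summable_comparison_test')
    show "norm (gf_coeff y n x * r ^ n) \<le> pochhammer gf_order n / fact n * (6 * \<bar>r\<bar>) ^ n" for n
      using mult_right_mono[OF abs_gf_coeff_le[OF norm_x norm_y, of n], of "\<bar>r\<bar> ^ n"]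
      by (simp add: abs_mult power_abs power_mult_distrib mult_ac)
  qed
  then show ?thesis unfolding gf_series_def by (rule summable_sums)
qed

lemma gf_coeff_rec:
  "real (Suc n) * gf_coeff y (Suc n) x + refl_diff (gf_coeff y (Suc n)) x
     = (gf_order + real n) * (x \<bullet> y) * gf_coeff y n x"
proof -
  have "real (Suc n) * gf_coeff y (Suc n) x + refl_diff (gf_coeff y (Suc n)) x
      = pochhammer gf_order (Suc n) *
        (real (Suc n) * dunkl_component y (Suc n) x + refl_diff (dunkl_component y (Suc n)) x)"
    unfolding gf_coeff_def[abs_def] refl_diff_cmult by (simp only: algebra_simps)
  also have "\<dots> = (gf_order + real n) * (x \<bullet> y) * gf_coeff y n x"
    unfolding dunkl_component_Suc_radial gf_coeff_def by (simp only: pochhammer_Suc mult_ac)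
  finally show ?thesis .
qed

lemma refl_diff_gf_series_sums:
  assumes norm_x: "cmod x = 1" and norm_y: "cmod y = 1" and abs_r: "\<bar>r\<bar> < 1/6"
  shows "(\<lambda>n. refl_diff (gf_coeff y n) x * r ^ n) sums refl_diff (gf_series y r) x"
proof -
  have "(\<lambda>n. \<Sum>j<2*k. kappa (int j) * (gf_coeff y n x * r ^ n - gf_coeff y n (rfl (int j) x) * r ^ n))
      sums refl_diff (gf_series y r) x"
    unfolding refl_diff_def using norm_x norm_y abs_r by (intro sums_sum sums_mult sums_diff gf_series_sums) auto
  then show ?thesis by (simp only: refl_diff_def sum_distrib_right left_diff_distrib mult.assoc)
qed

lemma gf_series_ode:
  assumes norm_x: "cmod x = 1" and norm_y: "cmod y = 1" and abs_r: "\<bar>r\<bar> < 1/6"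
  shows "\<exists>S'. ((\<lambda>r. gf_series y r x) has_real_derivative S') (at r) \<and>
    r * (1 - r * (x \<bullet> y)) * S' = gf_order * r * (x \<bullet> y) * gf_series y r x - refl_diff (gf_series y r) x"
proof -
  let ?S = "gf_series y r x"
  obtain S' where deriv: "((\<lambda>r. gf_series y r x) has_real_derivative S') (at r)"
    and euler: "(\<lambda>n. real n * gf_coeff y n x * r ^ n) sums (r * S')"
    using power_series_has_derivative_sums[OF gf_series_sums[OF norm_x norm_y] abs_r] by blast
  have "(\<lambda>n. real n * gf_coeff y n x * r ^ n + refl_diff (gf_coeff y n) x * r ^ n) sums
      (r * S' + refl_diff (gf_series y r) x)"
    by (intro sums_add euler refl_diff_gf_series_sums[OF norm_x norm_y abs_r])
  moreover have "refl_diff (gf_coeff y 0) x = 0"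
    by (simp add: refl_diff_def gf_coeff_def)
  ultimately have "(\<lambda>n. real (Suc n) * gf_coeff y (Suc n) x * r ^ Suc n + refl_diff (gf_coeff y (Suc n)) x * r ^ Suc n)
      sums (r * S' + refl_diff (gf_series y r) x)"
    by (subst sums_Suc_iff) simp
  moreover have "real (Suc n) * gf_coeff y (Suc n) x * r ^ Suc n + refl_diff (gf_coeff y (Suc n)) x * r ^ Suc n
      = (r * (x \<bullet> y)) * (gf_order * (gf_coeff y n x * r ^ n) + real n * gf_coeff y n x * r ^ n)" for n
    unfolding distrib_right[symmetric] gf_coeff_rec by (simp add: algebra_simps)
  moreover have "(\<lambda>n. (r * (x \<bullet> y)) * (gf_order * (gf_coeff y n x * r ^ n) + real n * gf_coeff y n x * r ^ n))
      sums ((r * (x \<bullet> y)) * (gf_order * ?S + r * S'))"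
    by (intro sums_mult sums_add euler gf_series_sums[OF norm_x norm_y abs_r])
  ultimately have "r * S' + refl_diff (gf_series y r) x = (r * (x \<bullet> y)) * (gf_order * ?S + r * S')"
    by (simp only: sums_unique2)
  then have "r * (1 - r * (x \<bullet> y)) * S' = gf_order * r * (x \<bullet> y) * ?S - refl_diff (gf_series y r) x"
    by (simp add: algebra_simps)
  with deriv show ?thesis by blast
qed

definition gf_error :: "complex \<Rightarrow> real \<Rightarrow> complex \<Rightarrow> real" where
  "gf_error y t x = gf_series y (poisson_subst t) x - gf_closed y t x"

lemma gf_error_ode:
  assumes norm_x: "cmod x = 1" and norm_y: "cmod y = 1" and abs_t: "\<bar>t\<bar> < 1/12"
  defines "F' \<equiv> deriv (\<lambda>t. gf_error y t x) t"
  shows "((\<lambda>t. gf_error y t x) has_real_derivative F') (at t)"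
    and "poisson_subst t * (1 - poisson_subst t * (x \<bullet> y)) * F' = poisson_subst' t *
      (gf_order * poisson_subst t * (x \<bullet> y) * gf_error y t x - refl_diff (gf_error y t) x)"
proof -
  let ?r = "poisson_subst t" and ?r' = "poisson_subst' t"
  have "\<bar>?r\<bar> < 1/6" using abs_poisson_subst_le[of t] abs_t by linarith
  then obtain S' where series_deriv: "((\<lambda>r. gf_series y r x) has_real_derivative S') (at ?r)"
    and series: "?r * (1 - ?r * (x \<bullet> y)) * S' = gf_order * ?r * (x \<bullet> y) * gf_series y ?r x - refl_diff (gf_series y ?r) x"
    using gf_series_ode[OF norm_x norm_y] by blast
  have "\<bar>t\<bar> < 1" using abs_t by simp
  then obtain C' where closed_deriv: "((\<lambda>t. gf_closed y t x) has_real_derivative C') (at t)"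
    and closed: "?r * (1 - ?r * (x \<bullet> y)) * C' = ?r' *
      (gf_order * ?r * (x \<bullet> y) * gf_closed y t x - refl_diff (gf_closed y t) x)"
    using gf_closed_ode[OF norm_x norm_y] by blast
  have deriv: "((\<lambda>t. gf_error y t x) has_real_derivative S' * ?r' - C') (at t)"
    unfolding gf_error_def
    by (intro DERIV_diff closed_deriv DERIV_chain2[where f = "\<lambda>r. gf_series y r x"] series_deriv poisson_subst_has_derivative)
  then have F'_eq: "F' = S' * ?r' - C'"
    unfolding F'_def by (rule DERIV_imp_deriv)
  with deriv show "((\<lambda>t. gf_error y t x) has_real_derivative F') (at t)" by simp
  have refl: "refl_diff (gf_error y t) x = refl_diff (gf_series y ?r) x - refl_diff (gf_closed y t) x"
    unfolding gf_error_def[abs_def] by (rule refl_diff_diff)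
  have "?r * (1 - ?r * (x \<bullet> y)) * F' = ?r' * (?r * (1 - ?r * (x \<bullet> y)) * S') - ?r * (1 - ?r * (x \<bullet> y)) * C'"
    unfolding F'_eq by (simp only: algebra_simps)
  also have "\<dots> = ?r' * (gf_order * ?r * (x \<bullet> y) * gf_error y t x - refl_diff (gf_error y t) x)"
    unfolding series closed refl unfolding gf_error_def by (simp add: algebra_simps)
  finally show "?r * (1 - ?r * (x \<bullet> y)) * F' = ?r' *
      (gf_order * ?r * (x \<bullet> y) * gf_error y t x - refl_diff (gf_error y t) x)" .
qed

lemma gf_series_at_0: "gf_series y 0 x = 1"
  by (simp add: gf_series_def gf_coeff_def)

lemma gf_denom_ge_half:
  assumes "\<bar>t\<bar> \<le> 1/13" "\<bar>c\<bar> \<le> 1"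
  shows "1/2 \<le> 1 - poisson_subst t * c"
proof -
  have "\<bar>poisson_subst t * c\<bar> \<le> (2 * \<bar>t\<bar>) * 1"
    unfolding abs_mult using abs_poisson_subst_le[of t] assms(2) by (intro mult_mono) auto
  with assms(1) show ?thesis by linarith
qed

lemma gf_energy_growth_le:
  assumes "\<bar>t\<bar> \<le> 1" "\<bar>c\<bar> \<le> 1"
  shows "- (poisson_subst' t * c) + 2 * (gf_order * poisson_subst' t * c) \<le> 2 * (2 * gf_order + 1)"
proof -
  have "\<bar>poisson_subst' t * c\<bar> \<le> 2 * 1"
    unfolding abs_mult using poisson_subst'_bounds[OF assms(1)] assms(2) by (intro mult_mono) auto
  then have "\<bar>(2 * gf_order - 1) * (poisson_subst' t * c)\<bar> \<le> (2 * gf_order + 1) * (2 * 1)"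
    unfolding abs_mult[of "2 * gf_order - 1"] using gf_order_pos by (intro mult_mono) auto
  moreover have "- (poisson_subst' t * c) + 2 * (gf_order * poisson_subst' t * c)
      = (2 * gf_order - 1) * (poisson_subst' t * c)"
    by (simp add: algebra_simps)
  ultimately show ?thesis by linarith
qed

lemma gf_series_eq_gf_closed:
  assumes norm_x: "cmod x = 1" and norm_y: "cmod y = 1" and t_range: "0 \<le> t" "t \<le> 1/13"
  shows "gf_series y (poisson_subst t) x = gf_closed y t x"
proof -
  have abs_inner_le: "\<bar>p \<bullet> y\<bar> \<le> 1" if "p \<in> orbit x" for p
    using Cauchy_Schwarz_ineq2[of p y] norm_orbit[OF that] norm_x norm_y by simp
  have "gf_error y t x = 0"
  proof (rule orbit_ode_solution_eq_0[where F = "gf_error y" and F' = "\<lambda>t p. deriv (\<lambda>t. gf_error y t p) t"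
        and w = "\<lambda>t p. 1 - poisson_subst t * (p \<bullet> y)" and w' = "\<lambda>t p. - (poisson_subst' t * (p \<bullet> y))"
        and m = "\<lambda>t p. gf_order * poisson_subst' t * (p \<bullet> y)" and e = "\<lambda>t. poisson_subst' t / poisson_subst t"
        and c = "1/2" and B = "2 * (2 * gf_order + 1)" and d = "1/13", OF _ _ _ _ _ _ _ _ _ _ t_range])
    fix p assume p_orbit: "p \<in> orbit x"
    then have unit: "cmod p = 1" using norm_orbit norm_x by simp
    show "gf_error y 0 p = 0"
      by (simp add: gf_error_def poisson_subst_def gf_series_at_0 gf_closed_at_0)
    have "isCont (\<lambda>t. (1 - poisson_subst t * (p \<bullet> y)) * (gf_error y t p)\<^sup>2) t" if "t \<in> {0..1/13}" for t
      using that gf_error_ode(1)[OF unit norm_y, of t] poisson_subst_has_derivative[of t]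
      by (intro continuous_intros DERIV_isCont) auto
    then show "continuous_on {0..1/13} (\<lambda>t. (1 - poisson_subst t * (p \<bullet> y)) * (gf_error y t p)\<^sup>2)"
      by (intro continuous_at_imp_continuous_on) blast
    show "1/2 \<le> 1 - poisson_subst t * (p \<bullet> y)" if "0 \<le> t" "t \<le> 1/13" for t
      using that abs_inner_le[OF p_orbit] by (intro gf_denom_ge_half) auto
    fix t :: real assume t_range: "0 < t" "t < 1/13"
    then have small: "\<bar>t\<bar> < 1/12" by simp
    show "((\<lambda>t. 1 - poisson_subst t * (p \<bullet> y)) has_real_derivative - (poisson_subst' t * (p \<bullet> y))) (at t)"
      by (auto intro!: derivative_eq_intros poisson_subst_has_derivative)
    show "((\<lambda>t. gf_error y t p) has_real_derivative deriv (\<lambda>t. gf_error y t p) t) (at t)"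
      by (rule gf_error_ode(1)[OF unit norm_y small])
    show "(1 - poisson_subst t * (p \<bullet> y)) * deriv (\<lambda>t. gf_error y t p) t
        = gf_order * poisson_subst' t * (p \<bullet> y) * gf_error y t p
          - poisson_subst' t / poisson_subst t * refl_diff (gf_error y t) p"
      using gf_error_ode(2)[OF unit norm_y small] poisson_subst_pos[OF t_range(1)] by (simp add: field_simps)
    show "- (poisson_subst' t * (p \<bullet> y)) + 2 * (gf_order * poisson_subst' t * (p \<bullet> y)) \<le> 2 * (2 * gf_order + 1)"
      using t_range abs_inner_le[OF p_orbit] by (intro gf_energy_growth_le) auto
  next
    show "0 \<le> poisson_subst' t / poisson_subst t" if "0 < t" "t < 1/13" for t
      using that poisson_subst'_bounds(1)[of t] poisson_subst_pos[of t] by simp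
  qed (use gf_order_pos in auto)
  then show ?thesis by (simp add: gf_error_def)
qed

end

section \<open>Integrals over the simplex\<close>

lemma PiM_lborel_scale:
  assumes finite_I: "finite I" and r_pos: "0 < (r::real)"
  defines "P \<equiv> PiM I (\<lambda>_. lborel :: real measure)"
  shows "density (distr P P (\<lambda>x. \<lambda>i\<in>I. r * x i)) (\<lambda>_. ennreal (r ^ card I)) = P"
  unfolding P_def
proof (rule product_sigma_finite.PiM_eqI[OF _ finite_I])
  show factors: "product_sigma_finite (\<lambda>_. lborel :: real measure)" by standard
  let ?P = "PiM I (\<lambda>_. lborel :: real measure)" and ?T = "\<lambda>x. \<lambda>i\<in>I. r * x i"
  have [measurable]: "?T \<in> ?P \<rightarrow>\<^sub>M ?P" by measurable
  fix A :: "'a \<Rightarrow> real set" assume A_sets: "\<And>i. i \<in> I \<Longrightarrow> A i \<in> sets lborel"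
  have scaled: "(\<lambda>y. r * y) -` A i \<in> sets lborel" if "i \<in> I" for i
    using measurable_sets[of "\<lambda>y. r * y" borel borel "A i"] A_sets[OF that] by simp
  have factor: "emeasure lborel (A i) = ennreal r * emeasure lborel ((\<lambda>y. r * y) -` A i)" if "i \<in> I" for i
    using nn_integral_real_affine[of "indicator (A i)" r 0] A_sets[OF that] scaled[OF that] r_pos
    by (simp add: indicator_vimage[symmetric] comp_def)
  have "?T -` Pi\<^sub>E I A \<inter> space ?P = Pi\<^sub>E I (\<lambda>i. (\<lambda>y. r * y) -` A i)"
    by (auto simp: space_PiM PiE_iff)
  then have "emeasure (density (distr ?P ?P ?T) (\<lambda>_. ennreal (r ^ card I))) (Pi\<^sub>E I A)
      = ennreal (r ^ card I) * emeasure ?P (Pi\<^sub>E I (\<lambda>i. (\<lambda>y. r * y) -` A i))"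
    using A_sets finite_I by (simp add: emeasure_density nn_integral_cmult_indicator emeasure_distr sets_PiM_I_finite)
  also have "emeasure ?P (Pi\<^sub>E I (\<lambda>i. (\<lambda>y. r * y) -` A i)) = (\<Prod>i\<in>I. emeasure lborel ((\<lambda>y. r * y) -` A i))"
    by (rule product_sigma_finite.emeasure_PiM[OF factors finite_I scaled])
  also have "ennreal (r ^ card I) * \<dots> = (\<Prod>i\<in>I. emeasure lborel (A i))"
    using r_pos by (simp add: factor prod.distrib ennreal_power)
  finally show "emeasure (density (distr ?P ?P ?T) (\<lambda>_. ennreal (r ^ card I))) (Pi\<^sub>E I A)
      = (\<Prod>i\<in>I. emeasure lborel (A i))" .
qed simp

lemma nn_integral_PiM_lborel_scale:
  fixes f :: "('i \<Rightarrow> real) \<Rightarrow> ennreal"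
  assumes "finite I" "0 < r" and [measurable]: "f \<in> borel_measurable (PiM I (\<lambda>_. lborel))"
  shows "(\<integral>\<^sup>+x. f x \<partial>PiM I (\<lambda>_. lborel))
    = ennreal (r ^ card I) * (\<integral>\<^sup>+x. f (\<lambda>i\<in>I. r * x i) \<partial>PiM I (\<lambda>_. lborel))"
  by (subst PiM_lborel_scale[OF assms(1,2), symmetric])
    (simp add: nn_integral_density nn_integral_distr nn_integral_cmult)

definition gamma_weight :: "real \<Rightarrow> real \<Rightarrow> real \<Rightarrow> real" where
  "gamma_weight l c y = indicator {0<..} y * (y powr (l - 1) * exp (- (c * y)))"

lemma gamma_weight_measurable [measurable]: "gamma_weight l c \<in> borel_measurable borel"
  unfolding gamma_weight_def[abs_def] by measurable

lemma nn_integral_gamma_weight: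
  assumes "0 < l" and c_pos: "0 < c"
  shows "(\<integral>\<^sup>+y. ennreal (gamma_weight l c y) \<partial>lborel) = ennreal (Gamma l * c powr (- l))"
proof -
  have "(\<integral>\<^sup>+y. ennreal (gamma_weight l c y) \<partial>lborel)
      = ennreal (1 / c) * (\<integral>\<^sup>+y. ennreal (indicator {0<..} (y / c) * ((y / c) powr (l - 1) * exp (- y))) \<partial>lborel)"
    unfolding gamma_weight_def
    using c_pos by (subst nn_integral_real_affine[where c = "1 / c" and t = 0]) (auto simp: abs_divide)
  also have "(\<integral>\<^sup>+y. ennreal (indicator {0<..} (y / c) * ((y / c) powr (l - 1) * exp (- y))) \<partial>lborel)
      = (\<integral>\<^sup>+y. ennreal (c powr (1 - l)) * ennreal (indicator {0..} y * (y powr (l - 1) / exp y)) \<partial>lborel)"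
    using c_pos
    by (intro nn_integral_cong)
      (auto simp: indicator_def powr_divide powr_diff exp_minus field_simps zero_less_divide_iff ennreal_mult'[symmetric])
  also have "\<dots> = ennreal (c powr (1 - l)) * ennreal (Gamma l)"
    using nn_integral_has_integral_lebesgue[OF _ Gamma_integral_real[OF \<open>0 < l\<close>]]
    by (subst nn_integral_cmult) (auto simp: mult_ac)
  also have "ennreal (1 / c) * (ennreal (c powr (1 - l)) * ennreal (Gamma l)) = ennreal (Gamma l * c powr (- l))"
    using assms by (simp add: ennreal_mult[symmetric] powr_diff powr_minus field_simps)
  finally show ?thesis .
qed

lemma simplex_ext_measurable [measurable]:
  "(\<lambda>t. simplex_ext n t j) \<in> borel_measurable (PiM {1..n} (\<lambda>_. lborel))" if "j \<le> n"
proof (cases "j = 0")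
  case False
  then have "j \<in> {1..n}" using that by auto
  then show ?thesis using False by (simp add: simplex_ext_def)
qed (simp add: simplex_ext_def)

lemma unit_simplex_measurable [measurable]: "unit_simplex n \<in> sets (PiM {1..n} (\<lambda>_. lborel))"
proof -
  have "unit_simplex n = {t \<in> space (PiM {1..n} (\<lambda>_. lborel :: real measure)).
      (\<forall>j\<in>{1..n}. 0 < t j) \<and> (\<Sum>j=1..n. t j) < 1}"
    by (auto simp: unit_simplex_def space_PiM)
  then show ?thesis by simp
qed

lemma prod_Suc_simplex_ext:
  fixes g :: "nat \<Rightarrow> real \<Rightarrow> 'a::comm_monoid_mult"
  shows "(\<Prod>j<Suc n. g j (simplex_ext n t j)) = (\<Prod>j=1..n. g j (t j)) * g 0 (1 - (\<Sum>j=1..n. t j))"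
proof -
  have "(\<Prod>j=1..n. g j (simplex_ext n t j)) = (\<Prod>j=1..n. g j (t j))"
    by (intro prod.cong) (auto simp: simplex_ext_def)
  moreover have "(\<Prod>j<Suc n. g j (simplex_ext n t j)) = g 0 (simplex_ext n t 0) * (\<Prod>j=1..n. g j (simplex_ext n t j))"
    by (simp add: prod.atLeast1_atMost_eq prod.lessThan_Suc_shift del: prod.lessThan_Suc)
  ultimately show ?thesis by (simp add: simplex_ext_def mult.commute)
qed

lemma sum_simplex_ext: "(\<Sum>j<Suc n. simplex_ext n t j) = 1"
proof -
  have "(\<Sum>j=1..n. simplex_ext n t j) = (\<Sum>j=1..n. t j)"
    by (intro sum.cong) (auto simp: simplex_ext_def)
  moreover have "(\<Sum>j<Suc n. simplex_ext n t j) = simplex_ext n t 0 + (\<Sum>j=1..n. simplex_ext n t j)"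
    by (simp add: sum.atLeast1_atMost_eq sum.lessThan_Suc_shift del: sum.lessThan_Suc)
  ultimately show ?thesis by (simp add: simplex_ext_def)
qed

lemma unit_simplex_iff_simplex_ext_pos:
  assumes "t \<in> space (PiM {1..n} (\<lambda>_. lborel :: real measure))"
  shows "t \<in> unit_simplex n \<longleftrightarrow> (\<forall>j<Suc n. 0 < simplex_ext n t j)"
proof
  assume pos: "\<forall>j<Suc n. 0 < simplex_ext n t j"
  have "0 < t j" if "j \<in> {1..n}" for j
    using pos[rule_format, of j] that by (auto simp: simplex_ext_def split: if_splits)
  moreover have "(\<Sum>j=1..n. t j) < 1"
    using pos[rule_format, of 0] by (simp add: simplex_ext_def)
  ultimately show "t \<in> unit_simplex n"
    using assms by (simp add: unit_simplex_def space_PiM)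
qed (auto simp: unit_simplex_def simplex_ext_def)

lemma simplex_ext_pos: "t \<in> unit_simplex n \<Longrightarrow> j < Suc n \<Longrightarrow> 0 < simplex_ext n t j"
  by (auto simp: unit_simplex_def simplex_ext_def)

lemma nn_integral_prod_sum_coordinate:
  fixes f :: "nat \<Rightarrow> real \<Rightarrow> ennreal"
  assumes [measurable]: "\<And>j. f j \<in> borel_measurable borel"
  shows "(\<Prod>j<Suc n. \<integral>\<^sup>+y. f j y \<partial>lborel)
    = (\<integral>\<^sup>+r. (\<integral>\<^sup>+x. (\<Prod>j=1..n. f j (x j)) * f 0 (r - (\<Sum>j=1..n. x j)) \<partial>PiM {1..n} (\<lambda>_. lborel)) \<partial>lborel)"
proof -
  interpret product_sigma_finite "\<lambda>_. lborel :: real measure" by standard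
  let ?X = "PiM {1..n} (\<lambda>_. lborel :: real measure)"
  interpret X: sigma_finite_measure ?X by (rule sigma_finite) simp
  interpret pair: pair_sigma_finite ?X "lborel :: real measure" by standard
  have "(\<Prod>j<Suc n. \<integral>\<^sup>+y. f j y \<partial>lborel) = (\<integral>\<^sup>+y. f 0 y \<partial>lborel) * (\<Prod>j=1..n. \<integral>\<^sup>+y. f j y \<partial>lborel)"
    by (simp add: prod.atLeast1_atMost_eq prod.lessThan_Suc_shift del: prod.lessThan_Suc)
  also have "(\<Prod>j=1..n. \<integral>\<^sup>+y. f j y \<partial>lborel) = (\<integral>\<^sup>+x. (\<Prod>j=1..n. f j (x j)) \<partial>?X)"
    by (rule product_nn_integral_prod[symmetric]) auto
  also have "(\<integral>\<^sup>+y. f 0 y \<partial>lborel) * \<dots> = (\<integral>\<^sup>+x. (\<Prod>j=1..n. f j (x j)) * (\<integral>\<^sup>+y. f 0 y \<partial>lborel) \<partial>?X)"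
    by (subst nn_integral_multc) (auto simp: mult.commute)
  also have "\<dots> = (\<integral>\<^sup>+x. (\<integral>\<^sup>+r. (\<Prod>j=1..n. f j (x j)) * f 0 (r - (\<Sum>j=1..n. x j)) \<partial>lborel) \<partial>?X)"
  proof (intro nn_integral_cong)
    fix x :: "nat \<Rightarrow> real"
    have "(\<integral>\<^sup>+y. f 0 y \<partial>lborel) = (\<integral>\<^sup>+r. f 0 (r - (\<Sum>j=1..n. x j)) \<partial>lborel)"
      by (subst nn_integral_real_affine[where c = 1 and t = "- (\<Sum>j=1..n. x j)"]) (auto simp: algebra_simps)
    then show "(\<Prod>j=1..n. f j (x j)) * (\<integral>\<^sup>+y. f 0 y \<partial>lborel)
        = (\<integral>\<^sup>+r. (\<Prod>j=1..n. f j (x j)) * f 0 (r - (\<Sum>j=1..n. x j)) \<partial>lborel)"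
      by (simp add: nn_integral_cmult)
  qed
  also have "\<dots> = (\<integral>\<^sup>+r. (\<integral>\<^sup>+x. (\<Prod>j=1..n. f j (x j)) * f 0 (r - (\<Sum>j=1..n. x j)) \<partial>?X) \<partial>lborel)"
    by (rule pair.Fubini'[symmetric]) measurable
  finally show ?thesis .
qed

lemma prod_simplex_ext_eq_0:
  fixes f :: "nat \<Rightarrow> real \<Rightarrow> 'a::comm_semiring_1"
  assumes support: "\<And>j y. y \<le> 0 \<Longrightarrow> f j y = 0" and "0 < r"
    and "t \<in> space (PiM {1..n} (\<lambda>_. lborel))" "t \<notin> unit_simplex n"
  shows "(\<Prod>j<Suc n. f j (r * simplex_ext n t j)) = 0"
proof -
  obtain j where "j < Suc n" "simplex_ext n t j \<le> 0"
    using assms(3,4) unit_simplex_iff_simplex_ext_pos[of t n] by (auto simp: not_less)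
  moreover from this have "f j (r * simplex_ext n t j) = 0"
    using \<open>0 < r\<close> by (intro support) (simp add: mult_nonneg_nonpos)
  ultimately show ?thesis by (intro prod_zero) auto
qed

lemma nn_integral_cone_slice:
  fixes f :: "nat \<Rightarrow> real \<Rightarrow> ennreal"
  assumes [measurable]: "\<And>j. f j \<in> borel_measurable borel" and support: "\<And>j y. y \<le> 0 \<Longrightarrow> f j y = 0"
  shows "(\<integral>\<^sup>+x. (\<Prod>j=1..n. f j (x j)) * f 0 (r - (\<Sum>j=1..n. x j)) \<partial>PiM {1..n} (\<lambda>_. lborel))
    = (\<integral>\<^sup>+t. indicator (unit_simplex n) t * (indicator {0<..} r * (ennreal (r ^ n)
        * (\<Prod>j<Suc n. f j (r * simplex_ext n t j)))) \<partial>PiM {1..n} (\<lambda>_. lborel))"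
proof (cases "0 < r")
  case True
  let ?X = "PiM {1..n} (\<lambda>_. lborel :: real measure)"
  have "(\<integral>\<^sup>+x. (\<Prod>j=1..n. f j (x j)) * f 0 (r - (\<Sum>j=1..n. x j)) \<partial>?X)
      = ennreal (r ^ n) * (\<integral>\<^sup>+t. (\<Prod>j=1..n. f j ((\<lambda>i\<in>{1..n}. r * t i) j))
          * f 0 (r - (\<Sum>j=1..n. (\<lambda>i\<in>{1..n}. r * t i) j)) \<partial>?X)"
    by (subst nn_integral_PiM_lborel_scale[OF _ True]) simp_all
  also have "\<dots> = (\<integral>\<^sup>+t. ennreal (r ^ n) * (\<Prod>j<Suc n. f j (r * simplex_ext n t j)) \<partial>?X)"
    by (subst nn_integral_cmult[symmetric])
      (simp_all add: prod_Suc_simplex_ext[of "\<lambda>j y. f j (r * y)"] right_diff_distrib sum_distrib_left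
        del: prod.lessThan_Suc)
  also have "\<dots> = (\<integral>\<^sup>+t. indicator (unit_simplex n) t * (indicator {0<..} r * (ennreal (r ^ n)
        * (\<Prod>j<Suc n. f j (r * simplex_ext n t j)))) \<partial>?X)"
  proof (intro nn_integral_cong)
    fix t assume t_in: "t \<in> space ?X"
    have "(\<Prod>j<Suc n. f j (r * simplex_ext n t j)) = 0" if "t \<notin> unit_simplex n"
      by (rule prod_simplex_ext_eq_0[OF support True t_in that])
    then show "ennreal (r ^ n) * (\<Prod>j<Suc n. f j (r * simplex_ext n t j)) = indicator (unit_simplex n) t *
        (indicator {0<..} r * (ennreal (r ^ n) * (\<Prod>j<Suc n. f j (r * simplex_ext n t j))))"
      using True by (cases "t \<in> unit_simplex n") simp_all
  qed
  finally show ?thesis .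
next
  case False
  have "(\<Prod>j=1..n. f j (x j)) * f 0 (r - (\<Sum>j=1..n. x j)) = 0" for x
  proof (cases "\<forall>j\<in>{1..n}. 0 < x j")
    case True
    then have "0 \<le> (\<Sum>j=1..n. x j)" by (intro sum_nonneg) (simp add: less_imp_le)
    with False show ?thesis by (simp add: support)
  next
    case False
    then obtain j where "j \<in> {1..n}" "f j (x j) = 0" using support by (auto simp: not_less)
    then have "(\<Prod>j=1..n. f j (x j)) = 0" by (intro prod_zero) auto
    then show ?thesis by simp
  qed
  with False show ?thesis by (simp only:) simp
qed

lemma nn_integral_prod_simplex_polar:
  fixes f :: "nat \<Rightarrow> real \<Rightarrow> ennreal"
  assumes [measurable]: "\<And>j. f j \<in> borel_measurable borel" and "\<And>j y. y \<le> 0 \<Longrightarrow> f j y = 0"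
  shows "(\<Prod>j<Suc n. \<integral>\<^sup>+y. f j y \<partial>lborel)
    = (\<integral>\<^sup>+t. indicator (unit_simplex n) t * (\<integral>\<^sup>+r. indicator {0<..} r * (ennreal (r ^ n)
        * (\<Prod>j<Suc n. f j (r * simplex_ext n t j))) \<partial>lborel) \<partial>PiM {1..n} (\<lambda>_. lborel))"
proof -
  interpret product_sigma_finite "\<lambda>_. lborel :: real measure" by standard
  let ?X = "PiM {1..n} (\<lambda>_. lborel :: real measure)"
  interpret X: sigma_finite_measure ?X by (rule sigma_finite) simp
  interpret pair: pair_sigma_finite ?X "lborel :: real measure" by standard
  let ?g = "\<lambda>t r. indicator {0<..} r * (ennreal (r ^ n) * (\<Prod>j<Suc n. f j (r * simplex_ext n t j)))"
  have [measurable]: "(\<lambda>(t, r). ?g t r) \<in> borel_measurable (?X \<Otimes>\<^sub>M lborel)"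
    by measurable
  have "(\<Prod>j<Suc n. \<integral>\<^sup>+y. f j y \<partial>lborel) = (\<integral>\<^sup>+r. (\<integral>\<^sup>+t. indicator (unit_simplex n) t * ?g t r \<partial>?X) \<partial>lborel)"
    unfolding nn_integral_prod_sum_coordinate[of f, OF assms(1)]
    by (intro nn_integral_cong nn_integral_cone_slice assms)
  also have "\<dots> = (\<integral>\<^sup>+t. (\<integral>\<^sup>+r. indicator (unit_simplex n) t * ?g t r \<partial>lborel) \<partial>?X)"
    by (rule pair.Fubini') measurable
  also have "\<dots> = (\<integral>\<^sup>+t. indicator (unit_simplex n) t * (\<integral>\<^sup>+r. ?g t r \<partial>lborel) \<partial>?X)"
    by (intro nn_integral_cong nn_integral_cmult) measurable
  finally show ?thesis .
qed

lemma prod_gamma_weight_on_ray: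
  fixes l c s :: "nat \<Rightarrow> real"
  assumes s_pos: "\<And>j. j < Suc n \<Longrightarrow> 0 < s j" and r_pos: "0 < r"
  defines "A \<equiv> \<Sum>j<Suc n. l j"
  shows "r ^ n * (\<Prod>j<Suc n. gamma_weight (l j) (c j) (r * s j))
    = (\<Prod>j<Suc n. s j powr (l j - 1)) * gamma_weight A (\<Sum>j<Suc n. c j * s j) r"
proof -
  have "(\<Prod>j<Suc n. gamma_weight (l j) (c j) (r * s j))
      = (\<Prod>j<Suc n. r powr (l j - 1) * s j powr (l j - 1) * exp (- (c j * s j * r)))"
    using s_pos r_pos by (intro prod.cong refl) (auto simp: gamma_weight_def powr_mult mult_ac less_imp_le)
  also have "\<dots> = (\<Prod>j<Suc n. r powr (l j - 1)) * (\<Prod>j<Suc n. s j powr (l j - 1)) * (\<Prod>j<Suc n. exp (- (c j * s j * r)))"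
    by (simp only: prod.distrib)
  also have "(\<Prod>j<Suc n. exp (- (c j * s j * r))) = exp (- ((\<Sum>j<Suc n. c j * s j) * r))"
    by (simp only: exp_sum[symmetric] finite_lessThan sum_negf sum_distrib_right)
  also have "(\<Prod>j<Suc n. r powr (l j - 1)) = r powr (\<Sum>j<Suc n. l j - 1)"
    using r_pos by (simp only: powr_sum)
  also have "(\<Sum>j<Suc n. l j - 1) = A - 1 - real n"
    by (simp add: A_def sum_subtractf)
  finally have "r ^ n * (\<Prod>j<Suc n. gamma_weight (l j) (c j) (r * s j))
      = (r ^ n * r powr (A - 1 - real n)) * ((\<Prod>j<Suc n. s j powr (l j - 1)) * exp (- ((\<Sum>j<Suc n. c j * s j) * r)))"
    by (simp only: mult_ac)
  also have "r ^ n * r powr (A - 1 - real n) = r powr (A - 1)"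
    using r_pos by (simp add: powr_realpow[symmetric] powr_add[symmetric])
  finally show ?thesis using r_pos by (simp add: gamma_weight_def mult_ac)
qed

lemma nn_integral_gamma_weight_on_ray:
  fixes l c s :: "nat \<Rightarrow> real"
  assumes l_pos: "\<And>j. j < Suc n \<Longrightarrow> 0 < l j" and c_pos: "\<And>j. j < Suc n \<Longrightarrow> 0 < c j"
    and s_pos: "\<And>j. j < Suc n \<Longrightarrow> 0 < s j"
  defines "A \<equiv> \<Sum>j<Suc n. l j"
  shows "(\<integral>\<^sup>+r. indicator {0<..} r * (ennreal (r ^ n)
        * (\<Prod>j<Suc n. ennreal (gamma_weight (l j) (c j) (r * s j)))) \<partial>lborel)
    = ennreal (Gamma A) * ennreal ((\<Prod>j<Suc n. s j powr (l j - 1)) * (\<Sum>j<Suc n. c j * s j) powr (- A))"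
proof -
  let ?W = "\<Prod>j<Suc n. s j powr (l j - 1)" and ?S = "\<Sum>j<Suc n. c j * s j"
  have A_pos: "0 < A" unfolding A_def by (intro sum_pos) (use l_pos in auto)
  have S_pos: "0 < ?S" by (intro sum_pos) (use c_pos s_pos in auto)
  have W_nonneg: "0 \<le> ?W" by (intro prod_nonneg) simp
  have "indicator {0<..} r * (ennreal (r ^ n) * (\<Prod>j<Suc n. ennreal (gamma_weight (l j) (c j) (r * s j))))
      = ennreal ?W * ennreal (gamma_weight A ?S r)" for r
  proof (cases "0 < r")
    case True
    have "(\<Prod>j<Suc n. ennreal (gamma_weight (l j) (c j) (r * s j)))
        = ennreal (\<Prod>j<Suc n. gamma_weight (l j) (c j) (r * s j))"
      by (rule prod_ennreal) (simp add: gamma_weight_def)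
    with True prod_gamma_weight_on_ray[OF s_pos True, where l = l and c = c] W_nonneg show ?thesis
      by (simp add: A_def ennreal_mult'[symmetric] del: prod.lessThan_Suc sum.lessThan_Suc)
  qed (simp add: gamma_weight_def)
  then have "(\<integral>\<^sup>+r. indicator {0<..} r * (ennreal (r ^ n)
        * (\<Prod>j<Suc n. ennreal (gamma_weight (l j) (c j) (r * s j)))) \<partial>lborel)
      = (\<integral>\<^sup>+r. ennreal ?W * ennreal (gamma_weight A ?S r) \<partial>lborel)"
    by (simp only:)
  also have "\<dots> = ennreal ?W * (\<integral>\<^sup>+r. ennreal (gamma_weight A ?S r) \<partial>lborel)"
    by (rule nn_integral_cmult) measurable
  also have "\<dots> = ennreal ?W * ennreal (Gamma A * ?S powr (- A))"
    by (simp only: nn_integral_gamma_weight[OF A_pos S_pos])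
  finally show ?thesis
    using W_nonneg A_pos by (simp add: ennreal_mult[symmetric] mult_ac less_imp_le del: prod.lessThan_Suc sum.lessThan_Suc)
qed

text \<open>Polar coordinates on the orthant, with the sum of the coordinates as radius, turn a product of Gamma
  integrals into a Gamma integral over the simplex.\<close>

lemma nn_integral_simplex_feynman:
  fixes l c :: "nat \<Rightarrow> real"
  assumes l_pos: "\<And>j. j < Suc n \<Longrightarrow> 0 < l j" and c_pos: "\<And>j. j < Suc n \<Longrightarrow> 0 < c j"
  shows "(\<integral>\<^sup>+t. ennreal (indicator (unit_simplex n) t * ((\<Prod>j<Suc n. simplex_ext n t j powr (l j - 1))
      * (\<Sum>j<Suc n. c j * simplex_ext n t j) powr (- (\<Sum>j<Suc n. l j)))) \<partial>PiM {1..n} (\<lambda>_. lborel))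
    = ennreal ((\<Prod>j<Suc n. Gamma (l j) * c j powr (- l j)) / Gamma (\<Sum>j<Suc n. l j))"
proof -
  let ?X = "PiM {1..n} (\<lambda>_. lborel :: real measure)"
  define A where "A = (\<Sum>j<Suc n. l j)"
  let ?F = "\<lambda>t. ennreal (indicator (unit_simplex n) t * ((\<Prod>j<Suc n. simplex_ext n t j powr (l j - 1))
      * (\<Sum>j<Suc n. c j * simplex_ext n t j) powr (- A)))"
  have F_meas: "?F \<in> borel_measurable ?X" by measurable
  have "0 < A" unfolding A_def by (intro sum_pos) (use l_pos in auto)
  then have Gamma_A: "0 < Gamma A" by simp
  have "ennreal (\<Prod>j<Suc n. Gamma (l j) * c j powr (- l j))
      = (\<Prod>j<Suc n. ennreal (Gamma (l j) * c j powr (- l j)))"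
    by (rule prod_ennreal[symmetric]) (use l_pos in \<open>auto intro!: mult_nonneg_nonneg less_imp_le\<close>)
  also have "\<dots> = (\<Prod>j<Suc n. \<integral>\<^sup>+y. ennreal (gamma_weight (l j) (c j) y) \<partial>lborel)"
    by (intro prod.cong refl nn_integral_gamma_weight[symmetric]) (use l_pos c_pos in auto)
  also have "\<dots> = (\<integral>\<^sup>+t. indicator (unit_simplex n) t * (\<integral>\<^sup>+r. indicator {0<..} r * (ennreal (r ^ n)
        * (\<Prod>j<Suc n. ennreal (gamma_weight (l j) (c j) (r * simplex_ext n t j)))) \<partial>lborel) \<partial>?X)"
    by (rule nn_integral_prod_simplex_polar) (measurable, simp add: gamma_weight_def)
  also have "\<dots> = (\<integral>\<^sup>+t. ennreal (Gamma A) * ?F t \<partial>?X)"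
  proof (intro nn_integral_cong)
    fix t
    show "indicator (unit_simplex n) t * (\<integral>\<^sup>+r. indicator {0<..} r * (ennreal (r ^ n)
        * (\<Prod>j<Suc n. ennreal (gamma_weight (l j) (c j) (r * simplex_ext n t j)))) \<partial>lborel) = ennreal (Gamma A) * ?F t"
    proof (cases "t \<in> unit_simplex n")
      case True
      then show ?thesis
        using nn_integral_gamma_weight_on_ray[OF l_pos c_pos simplex_ext_pos[OF True]]
        by (simp add: A_def del: prod.lessThan_Suc sum.lessThan_Suc)
    qed simp
  qed
  also have "\<dots> = ennreal (Gamma A) * (\<integral>\<^sup>+t. ?F t \<partial>?X)"
    by (rule nn_integral_cmult[OF F_meas])
  finally have "ennreal (1 / Gamma A) * ennreal (\<Prod>j<Suc n. Gamma (l j) * c j powr (- l j))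
      = ennreal (1 / Gamma A) * ennreal (Gamma A) * (\<integral>\<^sup>+t. ?F t \<partial>?X)"
    by (simp only: mult.assoc)
  then show ?thesis
    using Gamma_A by (simp add: ennreal_mult'[symmetric] A_def del: prod.lessThan_Suc sum.lessThan_Suc)
qed

definition dirichlet_measure :: "nat \<Rightarrow> real \<Rightarrow> (nat \<Rightarrow> real) measure" where
  "dirichlet_measure n l = density (PiM {1..n} (\<lambda>_. lborel))
     (\<lambda>t. ennreal (indicator (unit_simplex n) t * (\<Prod>j<Suc n. simplex_ext n t j powr (l - 1))))"

lemma dirichlet_density_measurable [measurable]:
  "(\<lambda>t. indicator (unit_simplex n) t * (\<Prod>j<Suc n. simplex_ext n t j powr (l - 1)))
    \<in> borel_measurable (PiM {1..n} (\<lambda>_. lborel))"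
  by measurable

lemma sets_dirichlet_measure [measurable_cong, simp]:
  "sets (dirichlet_measure n l) = sets (PiM {1..n} (\<lambda>_. lborel))"
  by (simp add: dirichlet_measure_def)

lemma AE_dirichlet_measure: "AE t in dirichlet_measure n l. t \<in> unit_simplex n"
  unfolding dirichlet_measure_def by (subst AE_density) (measurable, auto simp: indicator_def)

lemma LINT_dirichlet_measure:
  fixes f :: "(nat \<Rightarrow> real) \<Rightarrow> real"
  assumes "f \<in> borel_measurable (PiM {1..n} (\<lambda>_. lborel))"
  shows "(LINT t|dirichlet_measure n l. f t)
    = (LINT t:unit_simplex n|PiM {1..n} (\<lambda>_. lborel). f t * (\<Prod>j<Suc n. simplex_ext n t j powr (l - 1)))"
  unfolding dirichlet_measure_def set_lebesgue_integral_def
  by (subst integral_density[OF assms dirichlet_density_measurable]) (simp_all add: prod_nonneg mult_ac)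

lemma nn_integral_simplex_feynman_coordinate:
  fixes c :: "nat \<Rightarrow> real"
  assumes l_pos: "0 < l" and c_pos: "\<And>j. j < Suc n \<Longrightarrow> 0 < c j" and i_less: "i < Suc n"
  defines "K \<equiv> real (Suc n) * l"
  shows "(\<integral>\<^sup>+t. ennreal (indicator (unit_simplex n) t * (simplex_ext n t i
        * ((\<Prod>j<Suc n. simplex_ext n t j powr (l - 1)) * (\<Sum>j<Suc n. c j * simplex_ext n t j) powr (- (K + 1)))))
      \<partial>PiM {1..n} (\<lambda>_. lborel))
    = ennreal (Gamma l ^ Suc n / Gamma K * ((\<Prod>j<Suc n. c j) powr (- l) * ((1 / c i) / real (Suc n))))"
proof -
  define m where "m j = l + (if j = i then 1 else 0)" for j
  have K_pos: "0 < K" using l_pos by (simp add: K_def)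
  have Gamma_Suc_l: "Gamma (l + 1) = l * Gamma l"
    using l_pos by (intro Gamma_plus1) (auto elim: nonpos_Ints_cases)
  have sum_m: "(\<Sum>j<Suc n. m j) = K + 1"
    using i_less by (simp add: m_def sum.distrib K_def del: sum.lessThan_Suc)
  have prod_at_i: "(\<Prod>j<Suc n. g j * (if j = i then h j else 1)) = (\<Prod>j<Suc n. g j) * h i" for g h :: "nat \<Rightarrow> real"
    using i_less by (simp add: prod.distrib prod.delta del: prod.lessThan_Suc)
  have "(\<Prod>j<Suc n. simplex_ext n t j powr (m j - 1)) = (\<Prod>j<Suc n. simplex_ext n t j powr (l - 1)) * simplex_ext n t i"
    if "t \<in> unit_simplex n" for t
    unfolding prod_at_i[symmetric] using simplex_ext_pos[OF that]
    by (intro prod.cong refl) (auto simp: m_def powr_diff powr_add less_imp_le)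
  then have "(\<integral>\<^sup>+t. ennreal (indicator (unit_simplex n) t * (simplex_ext n t i
        * ((\<Prod>j<Suc n. simplex_ext n t j powr (l - 1)) * (\<Sum>j<Suc n. c j * simplex_ext n t j) powr (- (K + 1)))))
      \<partial>PiM {1..n} (\<lambda>_. lborel))
    = (\<integral>\<^sup>+t. ennreal (indicator (unit_simplex n) t * ((\<Prod>j<Suc n. simplex_ext n t j powr (m j - 1))
        * (\<Sum>j<Suc n. c j * simplex_ext n t j) powr (- (\<Sum>j<Suc n. m j)))) \<partial>PiM {1..n} (\<lambda>_. lborel))"
    unfolding sum_m by (intro nn_integral_cong arg_cong[where f = ennreal]) (simp add: indicator_def mult_ac)
  also have "\<dots> = ennreal ((\<Prod>j<Suc n. Gamma (m j) * c j powr (- m j)) / Gamma (\<Sum>j<Suc n. m j))"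
    by (rule nn_integral_simplex_feynman) (use l_pos c_pos in \<open>auto simp: m_def\<close>)
  also have "(\<Prod>j<Suc n. Gamma (m j) * c j powr (- m j)) = (\<Prod>j<Suc n. Gamma l * c j powr (- l)) * (l / c i)"
  proof -
    have "Gamma (m j) * c j powr (- m j) = (Gamma l * c j powr (- l)) * (if j = i then l / c j else 1)"
      if "j < Suc n" for j
      using c_pos[OF that] by (auto simp: m_def powr_diff Gamma_Suc_l)
    then show ?thesis
      unfolding prod_at_i[where h = "\<lambda>j. l / c j", symmetric] by (intro prod.cong refl) simp
  qed
  also have "(\<Prod>j<Suc n. Gamma l * c j powr (- l)) = Gamma l ^ Suc n * (\<Prod>j<Suc n. c j) powr (- l)"
    by (simp only: prod.distrib prod_constant card_lessThan prod_powr_distrib)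
  also have "Gamma (\<Sum>j<Suc n. m j) = K * Gamma K"
    unfolding sum_m using K_pos by (subst Gamma_plus1) auto
  also have "Gamma l ^ Suc n * (\<Prod>j<Suc n. c j) powr (- l) * (l / c i) / (K * Gamma K)
      = Gamma l ^ Suc n / Gamma K * ((\<Prod>j<Suc n. c j) powr (- l) * ((1 / c i) / real (Suc n)))"
    using l_pos by (simp add: K_def mult_ac del: of_nat_Suc prod.lessThan_Suc)
  finally show ?thesis .
qed

text \<open>Summing the coordinates, whose sum is 1, raises the exponent by one.\<close>

lemma nn_integral_dirichlet_feynman:
  fixes c :: "nat \<Rightarrow> real"
  assumes l_pos: "0 < l" and c_pos: "\<And>j. j < Suc n \<Longrightarrow> 0 < c j"
  defines "K \<equiv> real (Suc n) * l"
  shows "(\<integral>\<^sup>+t. ennreal ((\<Sum>j<Suc n. c j * simplex_ext n t j) powr (- (K + 1))) \<partial>dirichlet_measure n l)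
    = ennreal (Gamma l ^ Suc n / Gamma K * ((\<Prod>j<Suc n. c j) powr (- l) * ((\<Sum>j<Suc n. 1 / c j) / real (Suc n))))"
proof -
  let ?X = "PiM {1..n} (\<lambda>_. lborel :: real measure)" and ?I = "indicator (unit_simplex n) :: _ \<Rightarrow> real"
  let ?P = "\<lambda>t. \<Prod>j<Suc n. simplex_ext n t j powr (l - 1)"
  let ?S = "\<lambda>t. (\<Sum>j<Suc n. c j * simplex_ext n t j) powr (- (K + 1))"
  let ?C = "Gamma l ^ Suc n / Gamma K" and ?D = "(\<Prod>j<Suc n. c j) powr (- l)"
  have K_pos: "0 < K" using l_pos by (simp add: K_def)
  have density_meas: "(\<lambda>t. ennreal (?I t * ?P t)) \<in> borel_measurable ?X"
    and S_meas: "(\<lambda>t. ennreal (?S t)) \<in> borel_measurable ?X"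
    by measurable
  have nonneg: "0 \<le> ?I t * (simplex_ext n t i * (?P t * ?S t))" if "i < Suc n" for i t
    using simplex_ext_pos[of t n i] that
    by (cases "t \<in> unit_simplex n") (auto intro!: mult_nonneg_nonneg prod_nonneg simp: less_imp_le)
  have "ennreal (?I t * ?P t) * ennreal (?S t)
      = (\<Sum>i<Suc n. ennreal (?I t * (simplex_ext n t i * (?P t * ?S t))))" for t
  proof -
    have "(\<Sum>i<Suc n. ennreal (?I t * (simplex_ext n t i * (?P t * ?S t))))
        = ennreal (\<Sum>i<Suc n. ?I t * (simplex_ext n t i * (?P t * ?S t)))"
      using nonneg by (intro sum_ennreal) simp
    also have "(\<Sum>i<Suc n. ?I t * (simplex_ext n t i * (?P t * ?S t))) = (?I t * ?P t) * ?S t"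
      by (simp only: sum_distrib_left[symmetric] sum_distrib_right[symmetric] sum_simplex_ext mult_1 mult.assoc)
    finally show ?thesis by (simp only: ennreal_mult''[OF powr_ge_zero])
  qed
  then have "(\<integral>\<^sup>+t. ennreal (?S t) \<partial>dirichlet_measure n l)
      = (\<integral>\<^sup>+t. (\<Sum>i<Suc n. ennreal (?I t * (simplex_ext n t i * (?P t * ?S t)))) \<partial>?X)"
    unfolding dirichlet_measure_def by (simp only: nn_integral_density[OF density_meas S_meas])
  also have "\<dots> = (\<Sum>i<Suc n. \<integral>\<^sup>+t. ennreal (?I t * (simplex_ext n t i * (?P t * ?S t))) \<partial>?X)"
  proof (rule nn_integral_sum)
    fix i assume "i \<in> {..<Suc n}"
    then have [measurable]: "(\<lambda>t. simplex_ext n t i) \<in> borel_measurable ?X" by (intro simplex_ext_measurable) auto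
    show "(\<lambda>t. ennreal (?I t * (simplex_ext n t i * (?P t * ?S t)))) \<in> borel_measurable ?X" by measurable
  qed
  also have "\<dots> = (\<Sum>i<Suc n. ennreal (?C * (?D * ((1 / c i) / real (Suc n)))))"
    unfolding K_def by (intro sum.cong refl nn_integral_simplex_feynman_coordinate l_pos c_pos) auto
  also have "\<dots> = ennreal (\<Sum>i<Suc n. ?C * (?D * ((1 / c i) / real (Suc n))))"
    using l_pos K_pos c_pos by (intro sum_ennreal mult_nonneg_nonneg divide_nonneg_nonneg) (auto simp: less_imp_le)
  also have "(\<Sum>i<Suc n. ?C * (?D * ((1 / c i) / real (Suc n)))) = ?C * (?D * ((\<Sum>j<Suc n. 1 / c j) / real (Suc n)))"
    by (simp only: sum_distrib_left sum_divide_distrib)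
  finally show ?thesis .
qed

lemma finite_measure_dirichlet_measure:
  assumes "0 < l"
  shows "finite_measure (dirichlet_measure n l)"
proof
  have "emeasure (dirichlet_measure n l) (space (dirichlet_measure n l))
      = (\<integral>\<^sup>+t. 1 \<partial>dirichlet_measure n l)" by simp
  also have "\<dots> = (\<integral>\<^sup>+t. ennreal ((\<Sum>j<Suc n. 1 * simplex_ext n t j) powr (- (real (Suc n) * l + 1)))
      \<partial>dirichlet_measure n l)"
    by (simp only: mult_1 sum_simplex_ext powr_one_eq_one ennreal_1)
  also have "\<dots> < \<infinity>"
    by (subst nn_integral_dirichlet_feynman[OF assms]) simp_all
  finally show "emeasure (dirichlet_measure n l) (space (dirichlet_measure n l)) \<noteq> \<infinity>" by simp
qed

section \<open>Power series of moments\<close>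

lemma borel_measurable_arccos [measurable]: "arccos \<in> borel_measurable borel"
proof -
  have outside: "arccos y = (THE x. False)" if "y \<notin> {-1..1}" for y
  proof -
    have "(\<lambda>x. 0 \<le> x \<and> x \<le> pi \<and> cos x = y) = (\<lambda>x. False)"
      using that by (auto simp: fun_eq_iff)
    then show ?thesis unfolding arccos_def by (rule arg_cong)
  qed
  have "(\<lambda>y. indicator {-1..1} y *\<^sub>R arccos y) \<in> borel_measurable borel"
    by (intro borel_measurable_continuous_on_indicator continuous_on_arccos') auto
  then have "(\<lambda>y. indicator {-1..1} y *\<^sub>R arccos y + indicator (- {-1..1}) y * (THE x. False)) \<in> borel_measurable borel"
    by measurable
  also have "(\<lambda>y. indicator {-1..1} y *\<^sub>R arccos y + indicator (- {-1..1}) y * (THE x. False)) = arccos"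
    using outside by (auto simp: fun_eq_iff indicator_def)
  finally show ?thesis .
qed

lemma (in finite_measure) LINT_power_series_sums:
  fixes L :: "'a \<Rightarrow> real" and c :: "nat \<Rightarrow> real"
  assumes [measurable]: "L \<in> borel_measurable M" and bound: "AE w in M. \<bar>L w\<bar> \<le> 1"
    and summable: "summable (\<lambda>n. \<bar>c n\<bar>)"
  shows "(\<lambda>n. c n * (LINT w|M. L w ^ n)) sums (LINT w|M. (\<Sum>n. c n * L w ^ n))"
proof -
  have bound_term: "AE w in M. norm (c n * L w ^ n) \<le> \<bar>c n\<bar>" for n
    using bound
  proof (rule eventually_mono)
    fix w assume "\<bar>L w\<bar> \<le> 1"
    then have "\<bar>L w\<bar> ^ n \<le> 1" by (intro power_le_one) auto
    then show "norm (c n * L w ^ n) \<le> \<bar>c n\<bar>" by (simp add: abs_mult power_abs mult_left_le)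
  qed
  have integrable: "integrable M (\<lambda>w. c n * L w ^ n)" for n
    by (rule integrable_const_bound[OF bound_term]) measurable
  have "(\<lambda>n. LINT w|M. c n * L w ^ n) sums (LINT w|M. (\<Sum>n. c n * L w ^ n))"
  proof (rule sums_integral[OF integrable])
    have "AE w in M. \<forall>n. norm (c n * L w ^ n) \<le> \<bar>c n\<bar>"
      unfolding AE_all_countable using bound_term by blast
    then show "AE w in M. summable (\<lambda>n. norm (c n * L w ^ n))"
      by eventually_elim (rule summable_comparison_test[OF _ summable], auto)
    have "(LINT w|M. norm (c n * L w ^ n)) \<le> \<bar>c n\<bar> * measure M (space M)" for n
      using integral_mono_AE[OF integrable_norm[OF integrable] _ bound_term, of n] by (simp add: mult.commute)
    then show "summable (\<lambda>n. LINT w|M. norm (c n * L w ^ n))"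
      by (intro summable_comparison_test'[OF summable_mult2[OF summable, of "measure M (space M)"]]) auto
  qed
  then show ?thesis by simp
qed

lemma (in finite_measure) LINT_powr_sums:
  fixes L :: "'a \<Rightarrow> real"
  assumes L_meas [measurable]: "L \<in> borel_measurable M" and bound: "AE w in M. \<bar>L w\<bar> \<le> 1"
    and q_pos: "0 < q" and abs_r: "\<bar>r\<bar> < 1"
  shows "(\<lambda>n. pochhammer q n / fact n * r ^ n * (LINT w|M. L w ^ n)) sums (LINT w|M. (1 - r * L w) powr (- q))"
proof -
  have "(\<lambda>n. \<bar>pochhammer q n / fact n * r ^ n\<bar>) = (\<lambda>n. pochhammer q n / fact n * \<bar>r\<bar> ^ n)"
    using q_pos by (simp add: abs_mult power_abs pochhammer_nonneg)
  then have "summable (\<lambda>n. \<bar>pochhammer q n / fact n * r ^ n\<bar>)"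
    using pochhammer_binomial_sums[of "\<bar>r\<bar>" q] abs_r by (simp add: sums_iff)
  then have "(\<lambda>n. pochhammer q n / fact n * r ^ n * (LINT w|M. L w ^ n)) sums
      (LINT w|M. (\<Sum>n. pochhammer q n / fact n * r ^ n * L w ^ n))"
    by (rule LINT_power_series_sums[OF L_meas bound])
  also have "(LINT w|M. (\<Sum>n. pochhammer q n / fact n * r ^ n * L w ^ n)) = (LINT w|M. (1 - r * L w) powr (- q))"
  proof (rule integral_cong_AE)
    show "AE w in M. (\<Sum>n. pochhammer q n / fact n * r ^ n * L w ^ n) = (1 - r * L w) powr (- q)"
      using bound
    proof (rule eventually_mono)
      fix w assume "\<bar>L w\<bar> \<le> 1"
      then have "\<bar>r * L w\<bar> < 1" using abs_r by (simp add: abs_mult order.strict_trans1[OF mult_left_le])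
      then show "(\<Sum>n. pochhammer q n / fact n * r ^ n * L w ^ n) = (1 - r * L w) powr (- q)"
        using pochhammer_binomial_sums[of "r * L w" q] by (simp add: sums_iff power_mult_distrib mult.assoc)
    qed
  qed measurable
  finally show ?thesis .
qed

lemma (in finite_measure) LINT_exp_sums:
  fixes L :: "'a \<Rightarrow> real"
  assumes L_meas: "L \<in> borel_measurable M" and bound: "AE w in M. \<bar>L w\<bar> \<le> 1"
  shows "(\<lambda>n. r ^ n / fact n * (LINT w|M. L w ^ n)) sums (LINT w|M. exp (r * L w))"
proof -
  have "summable (\<lambda>n. \<bar>r ^ n / fact n\<bar>)"
    using summable_exp[of "\<bar>r\<bar>"] by (simp add: abs_mult power_abs divide_inverse mult.commute)
  then have "(\<lambda>n. r ^ n / fact n * (LINT w|M. L w ^ n)) sums (LINT w|M. (\<Sum>n. r ^ n / fact n * L w ^ n))"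
    by (rule LINT_power_series_sums[OF L_meas bound])
  moreover have "(\<Sum>n. r ^ n / fact n * L w ^ n) = exp (r * L w)" for w
    by (simp add: exp_def power_mult_distrib divide_inverse mult_ac)
  ultimately show ?thesis by simp
qed

lemma frequently_eq_imp_power_series_eq:
  fixes c d :: "nat \<Rightarrow> real"
  assumes R_pos: "0 < R" and f_sums: "\<And>x. \<bar>x\<bar> < R \<Longrightarrow> (\<lambda>n. c n * x ^ n) sums f x"
    and g_sums: "\<And>x. \<bar>x\<bar> < R \<Longrightarrow> (\<lambda>n. d n * x ^ n) sums g x"
    and freq: "\<exists>\<^sub>F x in at 0. f x = g x"
  shows "c n = d n"
proof (rule ccontr)
  assume "c n \<noteq> d n"
  have sums: "(\<lambda>n. (c n - d n) * x ^ n) sums (f x - g x)" if "\<bar>x\<bar> < R" for x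
    unfolding left_diff_distrib by (intro sums_diff f_sums g_sums that)
  have "eventually (\<lambda>x. f x - g x \<noteq> 0) (at 0)"
  proof (cases "c 0 = d 0")
    case False
    then show ?thesis
      using tendsto_imp_eventually_ne[OF powser_limit_0[OF R_pos, of "\<lambda>n. c n - d n" "\<lambda>x. f x - g x"], of 0] sums
      by simp
  next
    case True
    moreover from True have "f 0 - g 0 = 0"
      using sums_unique2[OF sums[of 0] powser_sums_zero[of "\<lambda>n. c n - d n"]] R_pos by simp
    moreover have "0 < n" using \<open>c n \<noteq> d n\<close> True by (cases n) auto
    ultimately obtain e where "0 < e" "\<And>x. x \<in> cball 0 e - {0} \<Longrightarrow> f x - g x \<noteq> 0"
      using powser_0_nonzero[of R 0 "\<lambda>n. c n - d n" "\<lambda>x. f x - g x" n] sums R_pos \<open>c n \<noteq> d n\<close> by auto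
    then show ?thesis
      unfolding eventually_at by (intro exI[of _ e]) (auto simp: dist_real_def)
  qed
  with freq show False
    by (simp add: frequently_def)
qed

section \<open>Averaging over the simplex\<close>

lemma mult_le_abs: "\<bar>c\<bar> \<le> 1 \<Longrightarrow> r * c \<le> \<bar>r :: real\<bar>"
  using abs_ge_self[of "r * c"] mult_left_le[of "\<bar>c\<bar>" "\<bar>r\<bar>"] by (simp add: abs_mult)

context dihedral
begin

definition cos_average :: "real \<Rightarrow> (nat \<Rightarrow> real) \<Rightarrow> real" where
  "cos_average \<theta> t = (\<Sum>j<k. cos ((\<theta> - 2 * real j * pi) / real k) * simplex_ext (k - 1) t j)"

abbreviation simplex_measure :: "(nat \<Rightarrow> real) measure" where
  "simplex_measure \<equiv> dirichlet_measure (k - 1) (a + b)"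

definition bessel_measure :: "((real \<times> real) \<times> (nat \<Rightarrow> real)) measure" where
  "bessel_measure = nu_pair a b \<Otimes>\<^sub>M simplex_measure"

definition bessel_phase :: "real \<Rightarrow> real \<Rightarrow> (real \<times> real) \<times> (nat \<Rightarrow> real) \<Rightarrow> real" where
  "bessel_phase p s X = cos_average (arccos (xi p s (fst X))) (snd X)"

sublocale dirichlet: finite_measure "simplex_measure"
  by (rule finite_measure_dirichlet_measure[OF weight_sum_pos])

sublocale bessel_factors: pair_sigma_finite "nu_pair a b" "simplex_measure" ..

sublocale bessel: finite_measure bessel_measure
  unfolding bessel_measure_def
  by (intro finite_measure_pair_measure dirichlet.finite_measure_axioms nu_pair.finite_measure_axioms)

lemma sets_bessel_measure [measurable_cong]:
  "sets bessel_measure = sets ((borel \<Otimes>\<^sub>M borel) \<Otimes>\<^sub>M PiM {1..k - 1} (\<lambda>_. lborel))"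
  unfolding bessel_measure_def by (rule sets_pair_measure_cong) simp_all

lemma AE_bessel_measure:
  "AE X in bessel_measure. fst X \<in> unit_box \<and> snd X \<in> unit_simplex (k - 1)"
  unfolding bessel_measure_def
proof (rule bessel_factors.AE_pair_measure)
  show "{X \<in> space (nu_pair a b \<Otimes>\<^sub>M simplex_measure).
      fst X \<in> unit_box \<and> snd X \<in> unit_simplex (k - 1)} \<in> sets (nu_pair a b \<Otimes>\<^sub>M simplex_measure)"
    by measurable
  show "AE x in nu_pair a b. AE t in simplex_measure.
      fst (x, t) \<in> unit_box \<and> snd (x, t) \<in> unit_simplex (k - 1)"
    using AE_nu_pair by eventually_elim (use AE_dirichlet_measure[of "k - 1" "a + b"] in \<open>eventually_elim, auto\<close>)
qed

lemma abs_cos_average_le: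
  assumes "t \<in> unit_simplex (k - 1)"
  shows "\<bar>cos_average \<theta> t\<bar> \<le> 1"
proof -
  have "0 \<le> simplex_ext (k - 1) t j" if "j < k" for j
    using simplex_ext_pos[OF assms, of j] that by simp
  then have "\<bar>cos_average \<theta> t\<bar> \<le> (\<Sum>j<k. simplex_ext (k - 1) t j)"
    unfolding cos_average_def
    by (intro order_trans[OF sum_abs] sum_mono) (auto simp: abs_mult mult_left_le_one_le)
  also have "\<dots> = 1" using sum_simplex_ext[of "k - 1" t] by simp
  finally show ?thesis .
qed

lemma AE_abs_bessel_phase_le: "AE X in bessel_measure. \<bar>bessel_phase p s X\<bar> \<le> 1"
  using AE_bessel_measure by (rule eventually_mono) (simp add: bessel_phase_def abs_cos_average_le)

lemma cos_average_measurable [measurable (raw)]: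
  assumes [measurable]: "f \<in> borel_measurable M" "g \<in> M \<rightarrow>\<^sub>M PiM {1..k - 1} (\<lambda>_. lborel)"
  shows "(\<lambda>w. cos_average (f w) (g w)) \<in> borel_measurable M"
  unfolding cos_average_def
proof (intro borel_measurable_sum borel_measurable_times)
  fix j assume "j \<in> {..<k}"
  then have "j \<le> k - 1" by auto
  show "(\<lambda>w. simplex_ext (k - 1) (g w) j) \<in> borel_measurable M"
    by (rule measurable_compose[OF assms(2) simplex_ext_measurable[OF \<open>j \<le> k - 1\<close>]])
qed measurable

lemma bessel_phase_measurable [measurable]: "bessel_phase p s \<in> borel_measurable bessel_measure"
  unfolding bessel_phase_def[abs_def] by measurable

lemma
  fixes f :: "(real \<times> real) \<times> (nat \<Rightarrow> real) \<Rightarrow> real"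
  assumes "integrable bessel_measure f"
  shows LINT_bessel_measure: "(LINT X|bessel_measure. f X) = (LINT x|nu_pair a b. LINT t|simplex_measure. f (x, t))"
    and integrable_LINT_simplex: "integrable (nu_pair a b) (\<lambda>x. LINT t|simplex_measure. f (x, t))"
proof -
  have "integrable (nu_pair a b \<Otimes>\<^sub>M simplex_measure) (\<lambda>(x, t). f (x, t))"
    using assms by (simp only: bessel_measure_def case_prod_eta)
  from bessel_factors.integral_fst[OF this] bessel_factors.integrable_fst[OF this]
  show "(LINT X|bessel_measure. f X) = (LINT x|nu_pair a b. LINT t|simplex_measure. f (x, t))"
    and "integrable (nu_pair a b) (\<lambda>x. LINT t|simplex_measure. f (x, t))"
    by (simp_all only: bessel_measure_def case_prod_eta)
qed

definition dirichlet_const :: real where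
  "dirichlet_const = Gamma (a + b) ^ k / Gamma (real k * (a + b))"

lemma dirichlet_const_pos: "0 < dirichlet_const"
  using weight_sum_pos by (simp add: dirichlet_const_def)

lemma nn_integral_dirichlet_feynman_k:
  assumes "\<And>j. j < k \<Longrightarrow> 0 < c j"
  shows "(\<integral>\<^sup>+t. ennreal ((\<Sum>j<k. c j * simplex_ext (k - 1) t j) powr (- gf_order)) \<partial>simplex_measure)
    = ennreal (dirichlet_const * ((\<Prod>j<k. c j) powr (- (a + b)) * ((\<Sum>j<k. 1 / c j) / real k)))"
  using nn_integral_dirichlet_feynman[OF weight_sum_pos, of "k - 1" c] assms
  by (simp add: dirichlet_const_def del: sum.lessThan_Suc prod.lessThan_Suc)

text \<open>Both the sum and the product over the $k$ angles are given by the Poisson kernel at the $k$-th power, so the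
  Feynman integral collapses to a single power.\<close>

lemma LINT_dirichlet_poisson:
  assumes abs_t: "\<bar>t\<bar> < 1"
  shows "(LINT u|simplex_measure. (1 - poisson_subst t * cos_average \<theta> u) powr (- gf_order))
    = dirichlet_const * (gf_scale t * poisson_denom (t ^ k) (cos \<theta>) powr (- (a + b) - 1))"
proof -
  define c where "c j = 1 - poisson_subst t * cos ((\<theta> - 2 * real j * pi) / real k)" for j
  define D where "D = poisson_denom (t ^ k) (cos \<theta>)"
  have D_pos: "0 < D"
    unfolding D_def using abs_power_k_less_1[OF abs_t] by (intro poisson_denom_pos) auto
  have c_pos: "0 < c j" for j
    using poisson_subst_mult_less_1[OF abs_cos_le_one abs_t] by (simp add: c_def)
  have prod_c: "(\<Prod>j<k. c j) = D / (1 + t\<^sup>2) ^ k"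
    unfolding c_def D_def by (rule prod_poisson_cos[OF k_pos])
  have sum_c: "(\<Sum>j<k. 1 / c j) = real k * (1 + t\<^sup>2) * (1 - (t ^ k)\<^sup>2) / ((1 - t\<^sup>2) * D)"
    unfolding c_def D_def by (rule sum_poisson_cos[OF k_pos abs_t])
  have linear: "1 - poisson_subst t * cos_average \<theta> u = (\<Sum>j<k. c j * simplex_ext (k - 1) u j)" for u
    using sum_simplex_ext[of "k - 1" u]
    by (simp add: c_def cos_average_def left_diff_distrib sum_subtractf sum_distrib_left mult.assoc)
  have meas: "(\<lambda>u. (1 - poisson_subst t * cos_average \<theta> u) powr (- gf_order)) \<in> borel_measurable simplex_measure"
    by measurable
  have "0 \<le> dirichlet_const * ((\<Prod>j<k. c j) powr (- (a + b)) * ((\<Sum>j<k. 1 / c j) / real k))"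
    using dirichlet_const_pos c_pos
    by (intro mult_nonneg_nonneg divide_nonneg_nonneg sum_nonneg) (auto simp: less_imp_le)
  then have "(LINT u|simplex_measure. (1 - poisson_subst t * cos_average \<theta> u) powr (- gf_order))
      = dirichlet_const * ((\<Prod>j<k. c j) powr (- (a + b)) * ((\<Sum>j<k. 1 / c j) / real k))"
    using nn_integral_dirichlet_feynman_k[of c] c_pos unfolding linear[symmetric]
    by (subst integral_eq_nn_integral[OF meas]) auto
  also have "(\<Prod>j<k. c j) powr (- (a + b)) = (1 + t\<^sup>2) powr (real k * (a + b)) * D powr (- (a + b))"
  proof -
    have "((1 + t\<^sup>2) ^ k) powr (- (a + b)) = (1 + t\<^sup>2) powr - (real k * (a + b))"
      using one_plus_power2_pos[of t] by (simp add: powr_realpow[symmetric] powr_powr algebra_simps)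
    then show ?thesis
      unfolding prod_c powr_divide by (simp add: powr_minus divide_inverse mult.commute)
  qed
  also have "(1 + t\<^sup>2) powr (real k * (a + b)) * D powr (- (a + b)) * ((\<Sum>j<k. 1 / c j) / real k)
      = gf_scale t * D powr (- (a + b) - 1)"
    unfolding sum_c gf_scale_def using D_pos by (simp add: powr_diff mult_ac)
  finally show ?thesis unfolding D_def .
qed

lemma LINT_bessel_measure_poisson:
  assumes ps_le: "\<bar>p\<bar> + \<bar>s\<bar> \<le> 1" and abs_t: "\<bar>t\<bar> < 1"
  shows "(LINT X|bessel_measure. (1 - poisson_subst t * bessel_phase p s X) powr (- gf_order))
    = dirichlet_const * (gf_scale t * gegenbauer_integral (\<lambda>_. 1) p s (t ^ k))"
proof -
  let ?r = "poisson_subst t" and ?P = "poisson_powr (- (a + b) - 1) p s (t ^ k)"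
  let ?f = "\<lambda>X. (1 - ?r * bessel_phase p s X) powr (- gf_order)"
  have int: "integrable bessel_measure ?f"
  proof (rule bessel.integrable_const_bound)
    show "AE X in bessel_measure. norm (?f X) \<le> (1 - \<bar>?r\<bar>) powr (- gf_order)"
      using AE_abs_bessel_phase_le[of p s]
    proof (rule eventually_mono)
      fix X assume "\<bar>bessel_phase p s X\<bar> \<le> 1"
      then have "?r * bessel_phase p s X \<le> \<bar>?r\<bar>" by (rule mult_le_abs)
      then show "norm (?f X) \<le> (1 - \<bar>?r\<bar>) powr (- gf_order)"
        using abs_poisson_subst_less_1[OF abs_t] gf_order_pos by (simp add: powr_mono2')
    qed
  qed measurable
  have "(LINT X|bessel_measure. ?f X) = (LINT x|nu_pair a b. LINT u|simplex_measure. ?f (x, u))"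
    by (rule LINT_bessel_measure[OF int])
  also have "(LINT x|nu_pair a b. LINT u|simplex_measure. ?f (x, u))
      = (LINT x|nu_pair a b. (dirichlet_const * gf_scale t) * (1 * ?P x))"
  proof (rule LINT_nu_pair_cong)
    fix x assume "x \<in> unit_box"
    then have "cos (arccos (xi p s x)) = xi p s x"
      using abs_xi_le[OF ps_le] by (intro cos_arccos_abs)
    then show "(LINT u|simplex_measure. ?f (x, u)) = dirichlet_const * gf_scale t * (1 * ?P x)"
      by (simp only: bessel_phase_def fst_conv snd_conv LINT_dirichlet_poisson[OF abs_t] poisson_powr_def mult.assoc mult_1)
  qed (use borel_measurable_integrable[OF integrable_LINT_simplex[OF int]] in simp, measurable)
  also have "\<dots> = dirichlet_const * (gf_scale t * gegenbauer_integral (\<lambda>_. 1) p s (t ^ k))"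
    unfolding gegenbauer_integral_def by (simp only: integral_mult_right_zero mult.assoc)
  finally show ?thesis .
qed

end

section \<open>The generalized Bessel function\<close>

context dihedral
begin

definition bessel_coeff :: "complex \<Rightarrow> complex \<Rightarrow> nat \<Rightarrow> real" where
  "bessel_coeff x y n = orbit_sum (\<lambda>p. dunkl_component p n x) y / (4 * real k)"

lemma orbit_sum_sums:
  assumes "\<And>p. p \<in> orbit x \<Longrightarrow> (\<lambda>n. f n p) sums g p"
  shows "(\<lambda>n. orbit_sum (f n) x) sums orbit_sum g x"
  unfolding orbit_sum_def using assms by (intro sums_sum sums_add) (auto simp: rot_in_orbit rfl_in_orbit)

lemma gen_bessel_sums: "(\<lambda>n. bessel_coeff x y n * (r * t) ^ n) sums gen_bessel k a b (r *\<^sub>R x) (t *\<^sub>R y)"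
proof -
  have "(\<lambda>n. orbit_sum (\<lambda>p. dunkl_component p n (r *\<^sub>R x)) (t *\<^sub>R y) / (4 * real k))
      sums (orbit_sum (\<lambda>p. dunkl_series p (r *\<^sub>R x)) (t *\<^sub>R y) / (4 * real k))"
    by (intro sums_divide orbit_sum_sums dunkl_component_sums)
  moreover have "orbit_sum (\<lambda>p. dunkl_component p n (r *\<^sub>R x)) (t *\<^sub>R y) / (4 * real k)
      = bessel_coeff x y n * (r * t) ^ n" for n
    by (simp add: bessel_coeff_def orbit_sum_def rot_scaleR rfl_scaleR dunkl_component_scaleR
        dunkl_component_scaleR_snd power_mult_distrib sum_distrib_left sum_distrib_right algebra_simps)
  ultimately show ?thesis
    by (simp add: gen_bessel_def orbit_sum_def dunkl_kernel_eq_dunkl_series dih_rot_eq_rot dih_refl_eq_rfl)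
qed

lemma bessel_coeff_generating_sums:
  assumes norm_x: "cmod x = 1" and norm_y: "cmod y = 1" and abs_r: "\<bar>r\<bar> < 1/6"
  shows "(\<lambda>n. pochhammer gf_order n * bessel_coeff x y n * r ^ n)
    sums (orbit_sum (\<lambda>p. gf_series p r x) y / (4 * real k))"
proof -
  have "(\<lambda>n. orbit_sum (\<lambda>p. gf_coeff p n x * r ^ n) y / (4 * real k))
      sums (orbit_sum (\<lambda>p. gf_series p r x) y / (4 * real k))"
    using norm_x norm_y abs_r by (intro sums_divide orbit_sum_sums gf_series_sums) (simp_all add: norm_orbit)
  moreover have "orbit_sum (\<lambda>p. gf_coeff p n x * r ^ n) y
      = pochhammer gf_order n * r ^ n * orbit_sum (\<lambda>p. dunkl_component p n x) y" for n
    unfolding orbit_sum_cmult[symmetric] gf_coeff_def by (simp only: mult_ac)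
  ultimately show ?thesis by (simp add: bessel_coeff_def mult_ac)
qed

lemma orbit_sum_gf_series:
  assumes norm_x: "cmod x = 1" and norm_y: "cmod y = 1" and t_range: "0 \<le> t" "t \<le> 1/13"
  shows "orbit_sum (\<lambda>p. gf_series p (poisson_subst t) x) y / (4 * real k)
    = gf_scale t * gegenbauer_integral (\<lambda>_. 1) (kernel_cos x y) (kernel_sin x y) (t ^ k)"
proof -
  have "orbit_sum (\<lambda>p. gf_series p (poisson_subst t) x) y = orbit_sum (gf_closed x t) y"
    using norm_x norm_y t_range gf_closed_commute[of _ t x]
    by (intro orbit_sum_cong) (simp add: gf_series_eq_gf_closed norm_orbit)
  also have "\<dots> = 4 * real k * (gf_scale t * gegenbauer_integral (\<lambda>_. 1) (kernel_cos x y) (kernel_sin x y) (t ^ k))"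
    using t_range by (subst orbit_sum_gf_closed[OF norm_y norm_x]) (simp_all add: kernel_cos_def kernel_sin_def mult.commute)
  finally show ?thesis by simp
qed

lemma frequently_at_0_poisson_subst:
  assumes holds: "\<And>t. 0 \<le> t \<Longrightarrow> t \<le> d \<Longrightarrow> P (poisson_subst t)" and "0 < d"
  shows "\<exists>\<^sub>F r in at 0. P r"
proof -
  have "\<exists>r. r \<noteq> 0 \<and> dist r 0 < e \<and> P r" if "0 < e" for e
  proof (intro exI conjI)
    define t where "t = min d (e / 3)"
    have t_range: "0 < t" "t \<le> d" "3 * t \<le> e" using that \<open>0 < d\<close> by (auto simp: t_def)
    show "poisson_subst t \<noteq> 0" using poisson_subst_pos[OF t_range(1)] by simp
    show "dist (poisson_subst t) 0 < e" using abs_poisson_subst_le[of t] t_range by simp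
    show "P (poisson_subst t)" using t_range by (intro holds) auto
  qed
  then show ?thesis unfolding frequently_def eventually_at by blast
qed

lemma bessel_coeff_eq_moment:
  assumes norm_x: "cmod x = 1" and norm_y: "cmod y = 1"
  shows "bessel_coeff x y n
    = (LINT X|bessel_measure. bessel_phase (kernel_cos x y) (kernel_sin x y) X ^ n) / (dirichlet_const * fact n)"
proof -
  let ?L = "bessel_phase (kernel_cos x y) (kernel_sin x y)"
  let ?f = "\<lambda>r. orbit_sum (\<lambda>p. gf_series p r x) y / (4 * real k)"
  let ?g = "\<lambda>r. (LINT X|bessel_measure. (1 - r * ?L X) powr (- gf_order)) / dirichlet_const"
  let ?c = "\<lambda>n. pochhammer gf_order n * bessel_coeff x y n"
  let ?d = "\<lambda>n. pochhammer gf_order n / fact n * (LINT X|bessel_measure. ?L X ^ n) / dirichlet_const"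
  have "?c n = ?d n"
  proof (rule frequently_eq_imp_power_series_eq[where R = "1/6" and c = ?c and d = ?d and f = ?f and g = ?g])
    show "(\<lambda>n. ?c n * r ^ n) sums ?f r" if "\<bar>r\<bar> < 1/6" for r
      by (rule bessel_coeff_generating_sums[OF norm_x norm_y that])
    show "(\<lambda>n. ?d n * r ^ n) sums ?g r" if "\<bar>r\<bar> < 1/6" for r
      using sums_divide[OF bessel.LINT_powr_sums[where L = ?L and r = r,
          OF bessel_phase_measurable AE_abs_bessel_phase_le gf_order_pos], of dirichlet_const] that
      by (simp add: mult_ac)
    show "\<exists>\<^sub>F r in at 0. ?f r = ?g r"
    proof (rule frequently_at_0_poisson_subst[where d = "1/13"])
      fix t :: real assume t_range: "0 \<le> t" "t \<le> 1/13"
      then have "\<bar>t\<bar> < 1" by simp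
      then show "?f (poisson_subst t) = ?g (poisson_subst t)"
        unfolding orbit_sum_gf_series[OF norm_x norm_y t_range]
        using LINT_bessel_measure_poisson[OF abs_kernel_cos_add_abs_sin_le[OF norm_x norm_y]] dirichlet_const_pos by simp
    qed simp
  qed simp
  also have "?d n = pochhammer gf_order n * ((LINT X|bessel_measure. ?L X ^ n) / (dirichlet_const * fact n))"
    by (simp add: mult.commute)
  finally show ?thesis
    using pochhammer_pos[OF gf_order_pos, of n] by (simp only: mult_cancel_left) auto
qed

lemma gen_bessel_eq_LINT_exp:
  assumes "cmod x = 1" "cmod y = 1"
  shows "gen_bessel k a b (r *\<^sub>R x) (t *\<^sub>R y)
    = (LINT X|bessel_measure. exp (r * t * bessel_phase (kernel_cos x y) (kernel_sin x y) X)) / dirichlet_const"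
proof (rule sums_unique2)
  let ?L = "bessel_phase (kernel_cos x y) (kernel_sin x y)"
  show "(\<lambda>n. bessel_coeff x y n * (r * t) ^ n) sums gen_bessel k a b (r *\<^sub>R x) (t *\<^sub>R y)"
    by (rule gen_bessel_sums)
  show "(\<lambda>n. bessel_coeff x y n * (r * t) ^ n) sums ((LINT X|bessel_measure. exp (r * t * ?L X)) / dirichlet_const)"
    using sums_divide[OF bessel.LINT_exp_sums[where L = ?L and r = "r * t", OF bessel_phase_measurable AE_abs_bessel_phase_le],
        of dirichlet_const]
    by (simp add: bessel_coeff_eq_moment[OF assms] mult_ac)
qed

definition simplex_exp :: "real \<Rightarrow> real \<Rightarrow> real" where
  "simplex_exp r \<theta> = (LINT t|simplex_measure. exp (r * cos_average \<theta> t))"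

lemma integrable_exp_cos_average: "integrable simplex_measure (\<lambda>t. exp (r * cos_average \<theta> t))"
proof (rule dirichlet.integrable_const_bound)
  show "AE t in simplex_measure. norm (exp (r * cos_average \<theta> t)) \<le> exp \<bar>r\<bar>"
    using AE_dirichlet_measure by (rule eventually_mono) (simp add: mult_le_abs abs_cos_average_le)
qed measurable

lemma simplex_exp_measurable [measurable]: "simplex_exp r \<in> borel_measurable borel"
  unfolding simplex_exp_def[abs_def] by (rule dirichlet.borel_measurable_lebesgue_integral) measurable

lemma abs_simplex_exp_le: "\<bar>simplex_exp r \<theta>\<bar> \<le> exp \<bar>r\<bar> * measure simplex_measure (space simplex_measure)"
proof -
  have "\<bar>simplex_exp r \<theta>\<bar> \<le> (LINT t|simplex_measure. exp (r * cos_average \<theta> t))"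
    unfolding simplex_exp_def using integral_norm_bound[of simplex_measure "\<lambda>t. exp (r * cos_average \<theta> t)"] by simp
  also have "\<dots> \<le> (LINT t|simplex_measure. exp \<bar>r\<bar>)"
    using AE_dirichlet_measure[of "k - 1" "a + b"]
    by (intro integral_mono_AE integrable_exp_cos_average dirichlet.integrable_const)
      (auto elim!: eventually_mono simp: mult_le_abs abs_cos_average_le)
  finally show ?thesis by (simp add: mult.commute)
qed

lemma simplex_exp_add:
  "simplex_exp r \<theta> + simplex_exp r \<eta> = (LINT t:unit_simplex (k - 1)|PiM {1..k - 1} (\<lambda>_. lborel).
     (exp (r * cos_average \<theta> t) + exp (r * cos_average \<eta> t)) * (\<Prod>j<k. simplex_ext (k - 1) t j powr (a + b - 1)))"
proof -
  have meas: "(\<lambda>t. exp (r * cos_average \<theta> t) + exp (r * cos_average \<eta> t))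
      \<in> borel_measurable (PiM {1..k - 1} (\<lambda>_. lborel))"
    by measurable
  have "simplex_exp r \<theta> + simplex_exp r \<eta>
      = (LINT t|simplex_measure. exp (r * cos_average \<theta> t) + exp (r * cos_average \<eta> t))"
    unfolding simplex_exp_def
    by (rule Bochner_Integration.integral_add[OF integrable_exp_cos_average integrable_exp_cos_average, symmetric])
  also have "\<dots> = (LINT t:unit_simplex (k - 1)|PiM {1..k - 1} (\<lambda>_. lborel).
     (exp (r * cos_average \<theta> t) + exp (r * cos_average \<eta> t)) * (\<Prod>j<k. simplex_ext (k - 1) t j powr (a + b - 1)))"
    using LINT_dirichlet_measure[OF meas, of "a + b"] by (simp only: Suc_diff_1[OF k_pos])
  finally show ?thesis .
qed

lemma LINT_nu_pair_eq_iterated: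
  assumes f_meas [measurable]: "f \<in> borel_measurable (borel \<Otimes>\<^sub>M borel)" and bound: "\<And>x. \<bar>f x\<bar> \<le> B"
  shows "(LINT x|nu_pair a b. f x)
    = (LINT u:{-1..1}|lborel. LINT v:{-1..1}|lborel. nu_density a u * nu_density b v * f (u, v) :: real)"
proof -
  have "(LINT x|nu_pair a b. f x) = (LINT u|nu_measure a. LINT v|nu_measure b. f (u, v))"
    by (rule LINT_nu_pair_fst[OF integrable_nu_pair[OF f_meas bound]])
  also have "\<dots> = (LINT u:{-1..1}|lborel. nu_density a u * (LINT v|nu_measure b. f (u, v)))"
    by (rule LINT_nu_measure[OF a_pos]) (rule nu_snd.borel_measurable_lebesgue_integral, measurable)
  also have "\<dots> = (LINT u:{-1..1}|lborel. LINT v:{-1..1}|lborel. nu_density a u * nu_density b v * f (u, v))"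
    by (simp add: LINT_nu_measure[OF b_pos] mult.assoc)
  finally show ?thesis .
qed

text \<open>The sign change $(u, v) \mapsto (-u, -v)$ exchanges the angles $q$ and $\pi - q$, so the two exponentials of the
  theorem contribute equally.\<close>

lemma LINT_bessel_measure_exp:
  fixes p s :: real
  assumes ps_le: "\<bar>p\<bar> + \<bar>s\<bar> \<le> 1"
  defines "q \<equiv> \<lambda>u v. arccos (xi p s (u, v))"
  shows "(LINT X|bessel_measure. exp (r * bessel_phase p s X)) = 1 / 2 *
    (LINT u:{-1..1}|lborel. LINT v:{-1..1}|lborel. nu_density a u * nu_density b v *
      (simplex_exp r (q u v) + simplex_exp r (pi - q u v)))"
proof -
  let ?q = "\<lambda>x. arccos (xi p s x)"
  let ?B = "exp \<bar>r\<bar> * measure simplex_measure (space simplex_measure)"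
  have "integrable bessel_measure (\<lambda>X. exp (r * bessel_phase p s X))"
  proof (rule bessel.integrable_const_bound)
    show "AE X in bessel_measure. norm (exp (r * bessel_phase p s X)) \<le> exp \<bar>r\<bar>"
      using AE_abs_bessel_phase_le[of p s] by (rule eventually_mono) (simp add: mult_le_abs)
  qed measurable
  then have fst_angle: "(LINT X|bessel_measure. exp (r * bessel_phase p s X))
      = (LINT x|nu_pair a b. simplex_exp r (?q x))"
    by (simp only: LINT_bessel_measure bessel_phase_def simplex_exp_def fst_conv snd_conv)
  also have "\<dots> = (LINT x|nu_pair a b. simplex_exp r (?q (-1 * fst x, -1 * snd x)))"
    by (rule LINT_nu_pair_signs[symmetric]) (simp, simp, measurable)
  also have "\<dots> = (LINT x|nu_pair a b. simplex_exp r (pi - ?q x))"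
  proof (rule LINT_nu_pair_cong)
    fix x assume "x \<in> unit_box"
    then have "arccos (- xi p s x) = pi - arccos (xi p s x)"
      using abs_xi_le[OF ps_le, of x] by (intro arccos_minus) auto
    then show "simplex_exp r (?q (-1 * fst x, -1 * snd x)) = simplex_exp r (pi - ?q x)"
      by (simp add: xi_def)
  qed measurable
  finally have snd_angle: "(LINT X|bessel_measure. exp (r * bessel_phase p s X))
      = (LINT x|nu_pair a b. simplex_exp r (pi - ?q x))" .
  have "(LINT X|bessel_measure. exp (r * bessel_phase p s X))
      = 1 / 2 * (LINT x|nu_pair a b. simplex_exp r (?q x) + simplex_exp r (pi - ?q x))"
    using fst_angle snd_angle abs_simplex_exp_le[of r]
    by (subst Bochner_Integration.integral_add) (auto intro!: integrable_nu_pair[where B = ?B])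
  also have "(LINT x|nu_pair a b. simplex_exp r (?q x) + simplex_exp r (pi - ?q x))
      = (LINT u:{-1..1}|lborel. LINT v:{-1..1}|lborel. nu_density a u * nu_density b v *
          (simplex_exp r (q u v) + simplex_exp r (pi - q u v)))"
    unfolding q_def
  proof (rule LINT_nu_pair_eq_iterated)
    show "\<bar>simplex_exp r (?q x) + simplex_exp r (pi - ?q x)\<bar> \<le> ?B + ?B" for x
      by (intro order_trans[OF abs_triangle_ineq] add_mono abs_simplex_exp_le)
  qed measurable
  finally show ?thesis .
qed

lemma q_uv_eq_arccos_xi:
  "q_uv u v (real k * Arg z) (real k * Arg w)
    = arccos (xi (kernel_cos (cis (Arg z)) (cis (Arg w))) (kernel_sin (cis (Arg z)) (cis (Arg w))) (u, v))"
  by (simp add: q_uv_def xi_uv_def xi_def kernel_cos_def kernel_sin_def Complex.DeMoivre mult.assoc)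

lemma scaled_cos_sum_eq:
  "(\<Sum>j<k. r * cos ((\<theta> - 2 * real j * pi) / real k) * simplex_ext (k - 1) t j) = r * cos_average \<theta> t"
  by (simp only: cos_average_def sum_distrib_left mult.assoc)

end

theorem mainTheorem7:
  fixes k :: nat and a b :: real and z w :: complex
  assumes "k \<ge> 2" and "a > 0" and "b > 0"
  shows "gen_bessel k a b z w =
    Gamma (real k * (a + b)) / (2 * Gamma (a + b) ^ k) *
    (LINT u:{-1..1}|lborel. LINT v:{-1..1}|lborel.
       nu_density a u * nu_density b v *
       (LINT t:unit_simplex (k - 1)|PiM {1..k - 1} (\<lambda>_. lborel).
          (let q = q_uv u v (real k * Arg z) (real k * Arg w);
               ap = (\<lambda>j. cmod z * cmod w * cos ((q - 2 * real j * pi) / real k));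
               am = (\<lambda>j. cmod z * cmod w * cos ((pi - q - 2 * real j * pi) / real k));
               s = simplex_ext (k - 1) t
           in (exp (\<Sum>j<k. ap j * s j) + exp (\<Sum>j<k. am j * s j))
              * (\<Prod>j<k. s j powr (a + b - 1)))))"
proof -
  interpret dihedral a b k by unfold_locales (use assms in auto)
  define x y where "x = cis (Arg z)" and "y = cis (Arg w)"
  have norm_x: "cmod x = 1" and norm_y: "cmod y = 1" by (simp_all add: x_def y_def)
  have z_eq: "z = cmod z *\<^sub>R x" and w_eq: "w = cmod w *\<^sub>R y"
    using rcis_cmod_Arg[of z] rcis_cmod_Arg[of w] by (simp_all add: x_def y_def rcis_def scaleR_conv_of_real)
  have "gen_bessel k a b z w = (LINT X|bessel_measure.
      exp (cmod z * cmod w * bessel_phase (kernel_cos x y) (kernel_sin x y) X)) / dirichlet_const"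
    using gen_bessel_eq_LINT_exp[OF norm_x norm_y, of "cmod z" "cmod w"] unfolding z_eq[symmetric] w_eq[symmetric] .
  then show ?thesis
    unfolding LINT_bessel_measure_exp[OF abs_kernel_cos_add_abs_sin_le[OF norm_x norm_y]] simplex_exp_add
    by (simp add: Let_def scaled_cos_sum_eq q_uv_eq_arccos_xi x_def y_def dirichlet_const_def del: One_nat_def)
qed

end
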